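(* For every $\epsilon>0$ there exists $C_\epsilon<\infty$ such that for all $N\ge1$ and all $f\in L^2(\mathcal{M})$, $$\|e^{it\Box}P_{\le N}f\|_{\ell^8L^4(\mathbb{R},L^4(\mathcal{M}))}\le C_\epsilon N^{\epsilon}\|f\|_{L^2(\mathcal{M})}.$$
   Context: $\mathcal{M}=\mathbb{R}\times\mathbb{T}$, $\mathbb{T}=\mathbb{R}/\mathbb{Z}$, $\mathbf{x}=(x,y)$. Fourier transform $\widehat f(\xi,k)=\int_{\mathcal{M}}e^{-2\pi i(\xi x+ky)}f\,dx\,dy$, $(\xi,k)\in\mathbb{R}\times\mathbb{Z}$. $\Box=\partial_x^2-\partial_y^2$ and $e^{it\Box}$ is the Fourier multiplier $e^{-4\pi^2it(\xi^2-k^2)}$. $\varphi$ is a fixed smooth radial function on $\mathbb{R}$ equal to $1$ on $|x|\le1$ and $0$ on $|x|\ge2$; $P_{\le N}$ is the Fourier multiplier $\varphi(\xi/N)\varphi(k/N)$. For $u$ on $\mathbb{R}\times\mathcal{M}$, $$\|u\|^q_{\ell^qL^p(\mathbb{R},L^r(\mathcal{M}))}:=\sum_{\gamma\in\mathbb{Z}}\Big(\int_0^1\Big(\int_{\mathcal{M}}|u(\gamma+s,\mathbf{x})|^r\,d\mathbf{x}\Big)^{p/r}ds\Big)^{q/p}.$$ *)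

theory Defs
  imports "HOL-Analysis.Analysis"
begin

text \<open>The cylinder M = R x T is modelled by real x real, the torus coordinate y ranging
over the fundamental domain [0,1).  Functions on M are functions real x real => complex
(their values for y outside [0,1) are irrelevant).\<close>

definition Mdom :: "(real \<times> real) set" where
  "Mdom = UNIV \<times> {0..<1}"

definition cutoff :: "(real \<Rightarrow> real) \<Rightarrow> bool" where
  "cutoff \<phi> \<longleftrightarrow>
     (\<forall>n x. (deriv ^^ n) \<phi> differentiable (at x)) \<and>
     (\<forall>x. \<phi> (-x) = \<phi> x) \<and>
     (\<forall>x. \<bar>x\<bar> \<le> 1 \<longrightarrow> \<phi> x = 1) \<and>
     (\<forall>x. \<bar>x\<bar> \<ge> 2 \<longrightarrow> \<phi> x = 0)"

text \<open>Convolution kernel of e^{it Box} P_{<=N}: the inverse Fourier transform (on R x T) of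
the multiplier phi(xi/N) phi(k/N) exp(-4 pi^2 i t (xi^2 - k^2)).  The k-sum is finite since
phi(k/N) = 0 for |k| > 2N.\<close>
definition kernel :: "(real \<Rightarrow> real) \<Rightarrow> real \<Rightarrow> real \<Rightarrow> real \<Rightarrow> real \<Rightarrow> complex" where
  "kernel \<phi> N t x y =
     (\<Sum>k\<in>{k::int. \<bar>real_of_int k\<bar> \<le> 2 * N}.
        complex_of_real (\<phi> (real_of_int k / N))
        * exp (\<i> * complex_of_real (4 * pi\<^sup>2 * t * (real_of_int k)\<^sup>2))
        * exp (\<i> * complex_of_real (2 * pi * real_of_int k * y)))
     * (\<integral>\<xi>. complex_of_real (\<phi> (\<xi> / N))
              * exp (- \<i> * complex_of_real (4 * pi\<^sup>2 * t * \<xi>\<^sup>2))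
              * exp (\<i> * complex_of_real (2 * pi * \<xi> * x)) \<partial>lborel)"

definition schrod :: "(real \<Rightarrow> real) \<Rightarrow> real \<Rightarrow> (real \<times> real \<Rightarrow> complex)
                       \<Rightarrow> real \<Rightarrow> real \<times> real \<Rightarrow> complex" where
  "schrod \<phi> N f t z =
     set_lebesgue_integral lborel Mdom
       (\<lambda>w. kernel \<phi> N t (fst z - fst w) (snd z - snd w) * f w)"

definition L2sq :: "(real \<times> real \<Rightarrow> complex) \<Rightarrow> ennreal" where
  "L2sq f = (\<integral>\<^sup>+ z\<in>Mdom. ennreal (cmod (f z) ^ 2) \<partial>lborel)"

text \<open>8th power of the l^8 L^4(R, L^4(M)) norm:
  sum over gamma of ( int_0^1 ( int_M |u|^4 )^{4/4} ds )^{8/4}.\<close>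
definition l8L4L4_pow8 :: "(real \<Rightarrow> real \<times> real \<Rightarrow> complex) \<Rightarrow> ennreal" where
  "l8L4L4_pow8 u =
     (\<integral>\<^sup>+ \<gamma>. (\<integral>\<^sup>+ s\<in>{0..1}.
                  (\<integral>\<^sup>+ z\<in>Mdom. ennreal (cmod (u (real_of_int \<gamma> + s) z) ^ 4) \<partial>lborel)
               \<partial>lborel) ^ 2
       \<partial>count_space (UNIV :: int set))"

end

theory Submission
  imports Defs
begin

text \<open>Let \<open>G\<close> be the Fourier transform of \<open>P\<^bsub>\<le>N\<^esub> f\<close> on \<open>\<real> \<times> \<int>\<close>, and write \<open>\<alpha> = (a, m)\<close>, \<open>\<beta> = (b, n)\<close>.
By duality in \<open>\<ell>\<^sup>2\<close> the eighth power of the norm is controlled by \<open>\<integral> w(t) \<integral> |u|\<^sup>4\<close> with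
\<open>w(t) = \<Sum>\<gamma>. c\<^sub>\<gamma> \<chi>(t - \<gamma>)\<close> for a Fejer kernel \<open>\<chi>\<close>. Expanding \<open>|u|\<^sup>2\<close> into frequencies bounds this by
\<open>\<integral>\<integral>\<integral> |G(\<zeta>) G(\<zeta> + \<alpha>) G(\<zeta> + \<beta>) G(\<zeta> + \<alpha> + \<beta>)| g(a b - m n) d\<zeta> d\<alpha> d\<beta>\<close>, where \<open>g\<close> is the modulus of the
rescaled Fourier transform of \<open>w\<close>: it vanishes outside \<open>[-1/2, 1/2]\<close> and its \<open>L\<^sup>2\<close> norm is
bounded by the \<open>\<ell>\<^sup>2\<close> norm of \<open>c\<close>.

The quartic form is estimated by Schur's test. If \<open>n \<noteq> 0\<close> and \<open>|n| \<le> |a|\<close>, fix \<open>\<alpha>\<close>: there are at most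
\<open>2|a|\<close> integers \<open>n\<close>, and each integral over \<open>b\<close> is the integral of \<open>g\<close> divided by \<open>|a|\<close>. If \<open>m n \<noteq> 0\<close> and
\<open>|a| < |n|\<close>, fix \<open>\<beta>\<close>: the support of \<open>g\<close> forces \<open>|m| \<le> |b| + 1/2\<close>, so there are at most \<open>4|b|\<close> integers \<open>m\<close>,
each contributing the integral of \<open>g\<close> divided by \<open>|b|\<close>. If \<open>m n = 0\<close>, the problem is the one-dimensional
\<open>L\<^sup>8 L\<^sup>4\<close> Strichartz estimate, which follows from Cauchy-Schwarz: the integral of \<open>g(a b)\<close> over
\<open>|b| \<le> |a|\<close> is at most \<open>\<surd>2\<close> times the \<open>L\<^sup>2\<close> norm of \<open>g\<close>. The resulting bound is uniform in \<open>N\<close>.\<close>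

section \<open>The quartic form on the dual group\<close>

text \<open>The weight c is controlled in l2 alone. A sup bound on g would cost the l1 norm of c, so
  the estimates must run on the L2 norm of g and on the L1 norm that its bounded support provides.
  The L1 norm enters as an integral over one line, which costs 1/|a|, and this is affordable only
  where a count of integers supplies a factor |a|. On the degenerate set m n = 0 no such count
  exists and 1/|a| is unbounded as a tends to 0; there the L2 norm of g on a window of length
  comparable to |a| takes over.

  Every Fourier inequality is used in one direction and up to a constant. One nonnegative function
  with compactly supported Fourier transform, the Fejer kernel, therefore serves twice: as a
  majorant of the unit time slabs, and as the summability weight behind the Plancherel inequality.

  Square integrable data need not be integrable, so frequency integrals are first formed for
  truncated data; Fatou's lemma then removes the truncation. The constants are products of crude
  factors (3, 12, 28, ...) that are merely carried along.\<close>

definition freq :: "(real \<times> int) measure" where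
  "freq = lborel \<Otimes>\<^sub>M count_space UNIV"

section \<open>Product measure on R x Z: measurability, Fubini and translation invariance\<close>

lemma sets_freq [measurable_cong]: "sets freq = sets (borel \<Otimes>\<^sub>M count_space UNIV)"
  unfolding freq_def by (intro sets_pair_measure_cong) auto

lemma space_freq [simp]: "space freq = UNIV"
  by (simp add: freq_def space_pair_measure)

lemma measurable_count_space_int_add [measurable (raw)]:
  fixes f g :: "'a \<Rightarrow> int"
  assumes [measurable]: "f \<in> M \<rightarrow>\<^sub>M count_space UNIV" "g \<in> M \<rightarrow>\<^sub>M count_space UNIV"
  shows "(\<lambda>x. f x + g x) \<in> M \<rightarrow>\<^sub>M count_space UNIV"
proof -
  have "(\<lambda>p. fst p + snd p :: int) \<in> count_space UNIV \<Otimes>\<^sub>M count_space UNIV \<rightarrow>\<^sub>M count_space UNIV"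
    by (subst pair_measure_countable) auto
  from measurable_compose[OF _ this, of "\<lambda>x. (f x, g x)" M] show ?thesis by simp
qed

lemma measurable_freq_fst [measurable]: "fst \<in> freq \<rightarrow>\<^sub>M borel"
  by (subst measurable_cong_sets[OF sets_freq refl]) (rule measurable_fst)

lemma measurable_freq_snd [measurable]: "snd \<in> freq \<rightarrow>\<^sub>M count_space UNIV"
  by (subst measurable_cong_sets[OF sets_freq refl]) (rule measurable_snd)

lemma measurable_freq_Pair [measurable (raw)]:
  assumes "f \<in> M \<rightarrow>\<^sub>M borel" "g \<in> M \<rightarrow>\<^sub>M count_space UNIV"
  shows "(\<lambda>x. (f x, g x)) \<in> M \<rightarrow>\<^sub>M freq"
  using measurable_Pair[OF assms] by (simp cong: measurable_cong_sets add: measurable_cong_sets[OF refl sets_freq])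

lemma measurable_freq_add [measurable (raw)]:
  assumes [measurable]: "f \<in> M \<rightarrow>\<^sub>M freq" "g \<in> M \<rightarrow>\<^sub>M freq"
  shows "(\<lambda>x. f x + g x) \<in> M \<rightarrow>\<^sub>M freq"
proof -
  have "(\<lambda>x. (fst (f x) + fst (g x), snd (f x) + snd (g x))) \<in> M \<rightarrow>\<^sub>M freq"
    by measurable
  then show ?thesis by (simp add: plus_prod_def)
qed

interpretation counting_int: sigma_finite_measure "count_space (UNIV :: int set)"
  by (rule sigma_finite_measure_count_space)

interpretation line_int: pair_sigma_finite "lborel :: real measure" "count_space (UNIV :: int set)" ..

interpretation freq: sigma_finite_measure freq
  unfolding freq_def ..

interpretation freq_freq: pair_sigma_finite freq freq ..

interpretation line_freq: pair_sigma_finite "lborel :: real measure" freq ..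

lemma nn_integral_freq:
  assumes "f \<in> borel_measurable freq"
  shows "(\<integral>\<^sup>+\<zeta>. f \<zeta> \<partial>freq) = (\<integral>\<^sup>+\<xi>. (\<integral>\<^sup>+k. f (\<xi>, k) \<partial>count_space UNIV) \<partial>lborel)"
  using counting_int.nn_integral_fst[of f lborel] assms by (simp add: freq_def)

lemma nn_integral_freq_int_first:
  assumes "f \<in> borel_measurable freq"
  shows "(\<integral>\<^sup>+\<zeta>. f \<zeta> \<partial>freq) = (\<integral>\<^sup>+k. (\<integral>\<^sup>+\<xi>. f (\<xi>, k) \<partial>lborel) \<partial>count_space UNIV)"
  using line_int.nn_integral_snd[of f] assms by (simp add: freq_def)

lemma nn_integral_int_shift:
  fixes f :: "int \<Rightarrow> ennreal"
  shows "(\<integral>\<^sup>+k. f (k + m) \<partial>count_space UNIV) = (\<integral>\<^sup>+k. f k \<partial>count_space UNIV)"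
  by (rule nn_integral_bij_count_space) (auto intro!: bij_betwI[where g="\<lambda>k. k - m"])

lemma nn_integral_real_shift:
  fixes f :: "real \<Rightarrow> ennreal"
  assumes "f \<in> borel_measurable borel"
  shows "(\<integral>\<^sup>+x. f (x + a) \<partial>lborel) = (\<integral>\<^sup>+x. f x \<partial>lborel)"
  using nn_integral_real_affine[OF assms, of 1 a] by (simp add: add.commute)

text \<open>Each factor measure is translation invariant. This is what makes zeta, alpha and beta
  independent integration variables in the quartic form.\<close>

lemma nn_integral_freq_shift:
  assumes [measurable]: "f \<in> borel_measurable freq"
  shows "(\<integral>\<^sup>+\<zeta>. f (\<zeta> + \<alpha>) \<partial>freq) = (\<integral>\<^sup>+\<zeta>. f \<zeta> \<partial>freq)"
proof -
  obtain a m where \<alpha>: "\<alpha> = (a, m)" by (cases \<alpha>)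
  have "(\<integral>\<^sup>+\<zeta>. f (\<zeta> + \<alpha>) \<partial>freq) = (\<integral>\<^sup>+\<xi>. (\<integral>\<^sup>+k. f (\<xi> + a, k + m) \<partial>count_space UNIV) \<partial>lborel)"
    by (subst nn_integral_freq) (auto simp: \<alpha>)
  also have "\<dots> = (\<integral>\<^sup>+\<xi>. (\<integral>\<^sup>+k. f (\<xi> + a, k) \<partial>count_space UNIV) \<partial>lborel)"
    by (intro nn_integral_cong nn_integral_int_shift)
  also have "\<dots> = (\<integral>\<^sup>+\<xi>. (\<integral>\<^sup>+k. f (\<xi>, k) \<partial>count_space UNIV) \<partial>lborel)"
    by (rule nn_integral_real_shift) measurable
  finally show ?thesis by (simp add: nn_integral_freq)
qed

section \<open>The quartic form and Schur's test\<close>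

lemma ennreal_mult_le_squares: "x * y \<le> x\<^sup>2 + (y :: ennreal)\<^sup>2"
\<comment> \<open>The factor 1/2 of the arithmetic-geometric inequality is given up: comparing x
  with y avoids subtraction in \<open>ennreal\<close>.\<close>
proof (cases "x \<le> y")
  case True
  then have "x * y \<le> y\<^sup>2" by (simp add: power2_eq_square mult_right_mono)
  then show ?thesis by (simp add: add_increasing)
next
  case False
  then have "x * y \<le> x\<^sup>2" by (simp add: power2_eq_square mult_left_mono)
  then show ?thesis by (simp add: add_increasing2)
qed

text \<open>The points \<open>\<zeta>, \<zeta> + \<alpha>, \<zeta> + \<beta>, \<zeta> + \<alpha> + \<beta>\<close> parametrise the resonant quadruples
\<open>\<zeta>\<^sub>1 + \<zeta>\<^sub>2 = \<zeta>\<^sub>3 + \<zeta>\<^sub>4\<close>.\<close>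

definition quartic_form :: "(real \<times> int \<Rightarrow> ennreal) \<Rightarrow> (real \<times> int \<Rightarrow> real \<times> int \<Rightarrow> ennreal) \<Rightarrow> ennreal" where
  "quartic_form h W = (\<integral>\<^sup>+\<alpha>. \<integral>\<^sup>+\<beta>. W \<alpha> \<beta> *
     (\<integral>\<^sup>+\<zeta>. h \<zeta> * h (\<zeta> + \<alpha>) * h (\<zeta> + \<beta>) * h (\<zeta> + \<alpha> + \<beta>) \<partial>freq) \<partial>freq \<partial>freq)"

lemma quartic_form_mono:
  assumes "\<And>\<alpha> \<beta>. W \<alpha> \<beta> \<le> W' \<alpha> \<beta>"
  shows "quartic_form h W \<le> quartic_form h W'"
  unfolding quartic_form_def by (intro nn_integral_mono mult_right_mono assms) auto

lemma quartic_form_add: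
  assumes [measurable]: "h \<in> borel_measurable freq" "case_prod W \<in> borel_measurable (freq \<Otimes>\<^sub>M freq)"
    "case_prod W' \<in> borel_measurable (freq \<Otimes>\<^sub>M freq)"
  shows "quartic_form h (\<lambda>\<alpha> \<beta>. W \<alpha> \<beta> + W' \<alpha> \<beta>) = quartic_form h W + quartic_form h W'"
  unfolding quartic_form_def distrib_right
  by (subst nn_integral_add[symmetric]; (measurable)?) (intro nn_integral_cong nn_integral_add; measurable)

text \<open>The product of the four values of h is symmetric in alpha and beta, so for each piece of
  the weight one may choose which of the two variables Schur's test freezes.\<close>

lemma quartic_form_swap:
  assumes [measurable]: "h \<in> borel_measurable freq" "case_prod W \<in> borel_measurable (freq \<Otimes>\<^sub>M freq)"
  shows "quartic_form h (\<lambda>\<alpha> \<beta>. W \<beta> \<alpha>) = quartic_form h W"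
  unfolding quartic_form_def
  by (subst freq_freq.Fubini') (measurable, simp add: mult_ac add_ac)

text \<open>The shear sending (zeta, alpha) to (zeta, zeta + alpha) preserves the product measure
  and separates the two factors.\<close>

lemma nn_integral_pair_shift:
  assumes [measurable]: "p \<in> borel_measurable freq" "q \<in> borel_measurable freq"
  shows "(\<integral>\<^sup>+\<alpha>. \<integral>\<^sup>+\<zeta>. p \<zeta> * q (\<zeta> + \<alpha>) \<partial>freq \<partial>freq) = (\<integral>\<^sup>+\<zeta>. p \<zeta> \<partial>freq) * (\<integral>\<^sup>+\<zeta>. q \<zeta> \<partial>freq)"
proof -
  have "(\<integral>\<^sup>+\<alpha>. \<integral>\<^sup>+\<zeta>. p \<zeta> * q (\<zeta> + \<alpha>) \<partial>freq \<partial>freq) = (\<integral>\<^sup>+\<zeta>. \<integral>\<^sup>+\<alpha>. p \<zeta> * q (\<alpha> + \<zeta>) \<partial>freq \<partial>freq)"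
    by (subst freq_freq.Fubini') (measurable, simp add: add.commute)
  also have "\<dots> = (\<integral>\<^sup>+\<zeta>. p \<zeta> * (\<integral>\<^sup>+\<alpha>. q \<alpha> \<partial>freq) \<partial>freq)"
    by (simp add: nn_integral_cmult nn_integral_freq_shift)
  finally show ?thesis by (simp add: nn_integral_multc)
qed

text \<open>Pair the points as (zeta, zeta + alpha) and (zeta + beta, zeta + beta + alpha). The two
  products are translates of each other, so bounding their product by the sum of the squares yields
  \<open>2 * P \<alpha>\<close>, free of beta. The weight may then be integrated in beta alone, and
  \<open>P\<close> has total mass equal to the square of the integral of h^2.\<close>

lemma quartic_form_schur:
  assumes [measurable]: "h \<in> borel_measurable freq" "case_prod W \<in> borel_measurable (freq \<Otimes>\<^sub>M freq)"
    and B: "\<And>\<alpha>. (\<integral>\<^sup>+\<beta>. W \<alpha> \<beta> \<partial>freq) \<le> B"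
  shows "quartic_form h W \<le> 2 * B * (\<integral>\<^sup>+\<zeta>. (h \<zeta>)\<^sup>2 \<partial>freq)\<^sup>2"
proof -
  define P where "P \<alpha> = (\<integral>\<^sup>+\<zeta>. (h \<zeta>)\<^sup>2 * (h (\<zeta> + \<alpha>))\<^sup>2 \<partial>freq)" for \<alpha>
  have [measurable]: "P \<in> borel_measurable freq" unfolding P_def by measurable
  have inner: "(\<integral>\<^sup>+\<zeta>. h \<zeta> * h (\<zeta> + \<alpha>) * h (\<zeta> + \<beta>) * h (\<zeta> + \<alpha> + \<beta>) \<partial>freq) \<le> 2 * P \<alpha>" for \<alpha> \<beta>
  proof -
    have "(\<integral>\<^sup>+\<zeta>. h \<zeta> * h (\<zeta> + \<alpha>) * h (\<zeta> + \<beta>) * h (\<zeta> + \<alpha> + \<beta>) \<partial>freq)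
      \<le> (\<integral>\<^sup>+\<zeta>. (h \<zeta>)\<^sup>2 * (h (\<zeta> + \<alpha>))\<^sup>2 + (h (\<zeta> + \<beta>))\<^sup>2 * (h (\<zeta> + \<beta> + \<alpha>))\<^sup>2 \<partial>freq)"
      using ennreal_mult_le_squares[of "h \<zeta> * h (\<zeta> + \<alpha>)" "h (\<zeta> + \<beta>) * h (\<zeta> + \<beta> + \<alpha>)" for \<zeta>]
      by (intro nn_integral_mono) (simp add: power_mult_distrib mult_ac add_ac)
    also have "\<dots> = P \<alpha> + (\<integral>\<^sup>+\<zeta>. (h (\<zeta> + \<beta>))\<^sup>2 * (h (\<zeta> + \<beta> + \<alpha>))\<^sup>2 \<partial>freq)"
      unfolding P_def by (intro nn_integral_add) measurable
    also have "(\<integral>\<^sup>+\<zeta>. (h (\<zeta> + \<beta>))\<^sup>2 * (h (\<zeta> + \<beta> + \<alpha>))\<^sup>2 \<partial>freq) = P \<alpha>"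
      unfolding P_def by (rule nn_integral_freq_shift[of "\<lambda>\<zeta>. (h \<zeta>)\<^sup>2 * (h (\<zeta> + \<alpha>))\<^sup>2"]) measurable
    finally show ?thesis by (simp add: mult_2)
  qed
  have "quartic_form h W \<le> (\<integral>\<^sup>+\<alpha>. \<integral>\<^sup>+\<beta>. W \<alpha> \<beta> * (2 * P \<alpha>) \<partial>freq \<partial>freq)"
    unfolding quartic_form_def by (intro nn_integral_mono mult_left_mono inner) auto
  also have "\<dots> = (\<integral>\<^sup>+\<alpha>. (\<integral>\<^sup>+\<beta>. W \<alpha> \<beta> \<partial>freq) * (2 * P \<alpha>) \<partial>freq)"
    by (intro nn_integral_cong nn_integral_multc) measurable
  also have "\<dots> \<le> (\<integral>\<^sup>+\<alpha>. B * (2 * P \<alpha>) \<partial>freq)"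
    by (intro nn_integral_mono mult_right_mono B) auto
  also have "\<dots> = 2 * B * (\<integral>\<^sup>+\<alpha>. P \<alpha> \<partial>freq)"
    by (simp add: nn_integral_cmult nn_integral_multc mult_ac)
  also have "(\<integral>\<^sup>+\<alpha>. P \<alpha> \<partial>freq) = (\<integral>\<^sup>+\<zeta>. (h \<zeta>)\<^sup>2 \<partial>freq)\<^sup>2"
    unfolding P_def power2_eq_square[of "integral\<^sup>N _ _"] by (rule nn_integral_pair_shift) measurable
  finally show ?thesis .
qed

section \<open>Lattice point counts and integrals of the profile g\<close>

lemma ennreal_le_of_square_le:
  fixes x :: ennreal
  assumes "x\<^sup>2 \<le> ennreal (c\<^sup>2)" "0 \<le> c"
  shows "x \<le> ennreal c"
proof (cases x)
  case (real r)
  then have "r\<^sup>2 \<le> c\<^sup>2" using assms by (simp add: ennreal_power)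
  then have "r \<le> c" using assms(2) by (rule power2_le_imp_le)
  then show ?thesis using real by (simp add: ennreal_leI)
next
  case top
  then show ?thesis using assms by (simp add: power2_eq_square ennreal_mult_top top_unique)
qed

text \<open>Leaving out 0 removes the additive constant from the count. The bound is then
  proportional to r even for r < 1, which is what cancels a factor 1/r in
  \<open>g_slices\<close>.\<close>

lemma card_nonzero_ints_le:
  assumes "0 \<le> r"
  shows "finite {n::int. n \<noteq> 0 \<and> \<bar>real_of_int n\<bar> \<le> r}"
    and "real (card {n::int. n \<noteq> 0 \<and> \<bar>real_of_int n\<bar> \<le> r}) \<le> 2 * r"
proof -
  have eq: "{n::int. n \<noteq> 0 \<and> \<bar>real_of_int n\<bar> \<le> r} = {1..\<lfloor>r\<rfloor>} \<union> {-\<lfloor>r\<rfloor>..-1}"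
    by (auto simp: abs_le_iff) linarith+
  show "finite {n::int. n \<noteq> 0 \<and> \<bar>real_of_int n\<bar> \<le> r}" unfolding eq by simp
  have "card ({1..\<lfloor>r\<rfloor>} \<union> {-\<lfloor>r\<rfloor>..-1}) \<le> card {1..\<lfloor>r\<rfloor>} + card {-\<lfloor>r\<rfloor>..-1}"
    by (rule card_Un_le)
  also have "\<dots> = 2 * nat \<lfloor>r\<rfloor>" by simp
  finally have "real (card ({1..\<lfloor>r\<rfloor>} \<union> {-\<lfloor>r\<rfloor>..-1})) \<le> real (2 * nat \<lfloor>r\<rfloor>)"
    by (simp only: of_nat_le_iff)
  also have "\<dots> \<le> 2 * r" using assms by simp
  finally show "real (card {n::int. n \<noteq> 0 \<and> \<bar>real_of_int n\<bar> \<le> r}) \<le> 2 * r" unfolding eq .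
qed

text \<open>In the application g is the modulus of the rescaled Fourier transform of a time weight,
  and B is a multiple of the l2 norm of its coefficients. The support lies in an interval of length
  1, so Cauchy-Schwarz lets the same B bound the L1 norm.\<close>

locale kernel_profile =
  fixes g :: "real \<Rightarrow> ennreal" and B :: real
  assumes g_measurable [measurable]: "g \<in> borel_measurable borel"
    and g_support: "\<And>s. 1/2 < \<bar>s\<bar> \<Longrightarrow> g s = 0"
    and g_L2: "(\<integral>\<^sup>+s. (g s)\<^sup>2 \<partial>lborel) \<le> ennreal (B\<^sup>2)"
    and B_nonneg: "0 \<le> B"
begin

lemma g_affine:
  assumes "a \<noteq> 0"
  shows "(\<integral>\<^sup>+b. g (a * b - c) \<partial>lborel) = (\<integral>\<^sup>+s. g s \<partial>lborel) / ennreal \<bar>a\<bar>"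
proof -
  have "(\<integral>\<^sup>+s. g s \<partial>lborel) = ennreal \<bar>a\<bar> * (\<integral>\<^sup>+b. g (a * b - c) \<partial>lborel)"
    using nn_integral_real_affine[of g a "-c"] assms by simp
  then show ?thesis
    using assms mult_divide_eq_ennreal[of "ennreal \<bar>a\<bar>" "\<integral>\<^sup>+b. g (a * b - c) \<partial>lborel"]
    by (simp only: mult.commute[of "ennreal \<bar>a\<bar>"]) simp
qed

lemma g_L1: "(\<integral>\<^sup>+s. g s \<partial>lborel) \<le> ennreal B"
proof (rule ennreal_le_of_square_le)
  have "(\<integral>\<^sup>+s. g s \<partial>lborel) = (\<integral>\<^sup>+s. g s * indicator {-1/2..1/2} s \<partial>lborel)"
  proof (intro nn_integral_cong)
    fix s show "g s = g s * indicator {-1/2..1/2} s"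
      using g_support[of s] by (cases "1/2 < \<bar>s\<bar>") (auto simp: indicator_def)
  qed
  then have "(\<integral>\<^sup>+s. g s \<partial>lborel)\<^sup>2 \<le> (\<integral>\<^sup>+s. (g s)\<^sup>2 \<partial>lborel) * (\<integral>\<^sup>+s. (indicator {-1/2..1/2::real} s)\<^sup>2 \<partial>lborel)"
    using Cauchy_Schwarz_nn_integral[of g lborel "indicator {-1/2..1/2}"] by simp
  also have "(\<integral>\<^sup>+s. (indicator {-1/2..1/2::real} s)\<^sup>2 \<partial>lborel) = (\<integral>\<^sup>+s. indicator {-1/2..1/2::real} s \<partial>lborel)"
    by (intro nn_integral_cong) (auto simp: indicator_def)
  also have "\<dots> = 1" by simp
  finally show "(\<integral>\<^sup>+s. g s \<partial>lborel)\<^sup>2 \<le> ennreal (B\<^sup>2)" using g_L2 by simp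
qed (rule B_nonneg)

text \<open>Scale-invariant Cauchy-Schwarz: the squared L2 norm of b -> g (a * b) carries 1/|a|, the
  window has length 2|a|, and the powers of a cancel. The L1 norm of g would only give B/|a|.
  Replacing the square root of 2 by 2 keeps square roots out of the constant.\<close>

lemma g_dilate_L1: "(\<integral>\<^sup>+b. g (a * b) * indicator {b. \<bar>b\<bar> \<le> \<bar>a\<bar>} b \<partial>lborel) \<le> ennreal (2 * B)"
proof (cases "a = 0")
  case True
  \<comment> \<open>For a = 0 the window is the single point 0, a null set, so even an infinite
    value g 0 contributes nothing.\<close>
  have "(\<integral>\<^sup>+b. g (a * b) * indicator {b. \<bar>b\<bar> \<le> \<bar>a\<bar>} b \<partial>lborel) = (\<integral>\<^sup>+b. g 0 * indicator {0::real} b \<partial>lborel)"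
    using True by (intro nn_integral_cong) (auto simp: indicator_def)
  then show ?thesis by (simp add: nn_integral_cmult_indicator)
next
  case False
  have I: "{b. \<bar>b\<bar> \<le> \<bar>a\<bar>} = {-\<bar>a\<bar>..\<bar>a\<bar>}" by auto
  have "(\<integral>\<^sup>+s. (g s)\<^sup>2 \<partial>lborel) = ennreal \<bar>a\<bar> * (\<integral>\<^sup>+b. (g (a * b))\<^sup>2 \<partial>lborel)"
    using nn_integral_real_affine[of "\<lambda>s. (g s)\<^sup>2" a 0] False by simp
  note sq = this
  show ?thesis
  proof (rule ennreal_le_of_square_le)
    have "(\<integral>\<^sup>+b. g (a * b) * indicator {b. \<bar>b\<bar> \<le> \<bar>a\<bar>} b \<partial>lborel)\<^sup>2
      \<le> (\<integral>\<^sup>+b. (g (a * b))\<^sup>2 \<partial>lborel) * (\<integral>\<^sup>+b. (indicator {-\<bar>a\<bar>..\<bar>a\<bar>} b)\<^sup>2 \<partial>lborel)"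
      unfolding I by (rule Cauchy_Schwarz_nn_integral) measurable
    also have "(\<integral>\<^sup>+b. (indicator {-\<bar>a\<bar>..\<bar>a\<bar>} b)\<^sup>2 \<partial>lborel) = (\<integral>\<^sup>+b. indicator {-\<bar>a\<bar>..\<bar>a\<bar>} b \<partial>lborel)"
      by (intro nn_integral_cong) (auto simp: indicator_def)
    also have "\<dots> = 2 * ennreal \<bar>a\<bar>" by (simp add: ennreal_mult[symmetric] flip: ennreal_numeral)
    also have "(\<integral>\<^sup>+b. (g (a * b))\<^sup>2 \<partial>lborel) * (2 * ennreal \<bar>a\<bar>) = 2 * (\<integral>\<^sup>+s. (g s)\<^sup>2 \<partial>lborel)"
      unfolding sq by (simp add: mult_ac)
    also have "\<dots> \<le> 2 * ennreal (B\<^sup>2)" by (intro mult_left_mono g_L2) simp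
    also have "\<dots> = ennreal (2 * B\<^sup>2)" by (simp add: ennreal_mult)
    also have "\<dots> \<le> ennreal ((2 * B)\<^sup>2)"
      by (intro ennreal_leI) (simp add: power_mult_distrib)
    finally show "(\<integral>\<^sup>+b. g (a * b) * indicator {b. \<bar>b\<bar> \<le> \<bar>a\<bar>} b \<partial>lborel)\<^sup>2 \<le> ennreal ((2 * B)\<^sup>2)" .
  qed (use B_nonneg in simp)
qed

text \<open>On each slice the phase is affine in b with slope a. Its offset, which depends on m and
  n, does not affect the integral, so every slice costs the L1 norm of g over |a|, and the number of
  slices compensates.\<close>

lemma g_slices:
  assumes "finite S" "real (card S) \<le> c * \<bar>a\<bar>"
  shows "(\<integral>\<^sup>+\<beta>. g (a * fst \<beta> - real_of_int m * real_of_int (snd \<beta>)) * indicator S (snd \<beta>) \<partial>freq) \<le> ennreal (c * B)"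
proof (cases "a = 0")
  case True
  \<comment> \<open>A count of at most c * 0 leaves no slice, so slope 0 never has to be
    integrated.\<close>
  then have "S = {}" using assms by auto
  then show ?thesis by simp
next
  case False
  have c: "0 \<le> c" using assms(2) False
    by (metis abs_not_less_zero linorder_not_less mult_neg_pos of_nat_0_le_iff order.trans zero_less_abs_iff)
  have "(\<integral>\<^sup>+\<beta>. g (a * fst \<beta> - real_of_int m * real_of_int (snd \<beta>)) * indicator S (snd \<beta>) \<partial>freq)
     = (\<integral>\<^sup>+n. (\<integral>\<^sup>+b. g (a * b - real_of_int m * real_of_int n) \<partial>lborel) * indicator S n \<partial>count_space UNIV)"
    by (subst nn_integral_freq_int_first) (measurable, simp add: nn_integral_multc)
  also have "\<dots> = (\<integral>\<^sup>+n. ((\<integral>\<^sup>+s. g s \<partial>lborel) / ennreal \<bar>a\<bar>) * indicator S n \<partial>count_space UNIV)"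
    by (simp add: g_affine[OF False])
  also have "\<dots> = ((\<integral>\<^sup>+s. g s \<partial>lborel) / ennreal \<bar>a\<bar>) * ennreal (card S)"
    using assms(1) by (subst nn_integral_cmult_indicator) (auto simp: ennreal_of_nat_eq_real_of_nat)
  also have "\<dots> \<le> (ennreal B / ennreal \<bar>a\<bar>) * ennreal (c * \<bar>a\<bar>)"
    by (intro mult_mono divide_right_mono_ennreal g_L1 ennreal_leI assms) auto
  also have "\<dots> = ennreal (c * B)"
    using False B_nonneg c by (simp add: divide_ennreal ennreal_mult[symmetric])
  finally show ?thesis .
qed

section \<open>Bounds for the quartic form, region by region\<close>

lemma quartic_form_row_schur:
  assumes [measurable]: "h \<in> borel_measurable freq"
  shows "quartic_form h (\<lambda>\<alpha> \<beta>. g (fst \<alpha> * fst \<beta>) * (if snd \<beta> = 0 \<and> \<bar>fst \<beta>\<bar> \<le> \<bar>fst \<alpha>\<bar> then 1 else 0))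
    \<le> 2 * ennreal (2 * B) * (\<integral>\<^sup>+\<zeta>. (h \<zeta>)\<^sup>2 \<partial>freq)\<^sup>2"
proof (rule quartic_form_schur)
  fix \<alpha> :: "real \<times> int"
  have "(\<integral>\<^sup>+\<beta>. g (fst \<alpha> * fst \<beta>) * (if snd \<beta> = 0 \<and> \<bar>fst \<beta>\<bar> \<le> \<bar>fst \<alpha>\<bar> then 1 else 0) \<partial>freq)
    = (\<integral>\<^sup>+n. (\<integral>\<^sup>+b. g (fst \<alpha> * b) * (if n = 0 \<and> \<bar>b\<bar> \<le> \<bar>fst \<alpha>\<bar> then 1 else 0) \<partial>lborel) \<partial>count_space (UNIV :: int set))"
    by (subst nn_integral_freq_int_first) auto
  also have "\<dots> = (\<integral>\<^sup>+b. g (fst \<alpha> * b) * (if \<bar>b\<bar> \<le> \<bar>fst \<alpha>\<bar> then 1 else 0) \<partial>lborel)"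
    by (subst nn_integral_count_space'[of "{0}"]) auto
  also have "\<dots> = (\<integral>\<^sup>+b. g (fst \<alpha> * b) * indicator {b. \<bar>b\<bar> \<le> \<bar>fst \<alpha>\<bar>} b \<partial>lborel)"
    by (intro nn_integral_cong) (auto simp: indicator_def)
  also have "\<dots> \<le> ennreal (2 * B)" by (rule g_dilate_L1)
  finally show "(\<integral>\<^sup>+\<beta>. g (fst \<alpha> * fst \<beta>) * (if snd \<beta> = 0 \<and> \<bar>fst \<beta>\<bar> \<le> \<bar>fst \<alpha>\<bar> then 1 else 0) \<partial>freq) \<le> ennreal (2 * B)" .
qed measurable

lemma quartic_form_few_columns:
  assumes [measurable]: "h \<in> borel_measurable freq"
  shows "quartic_form h (\<lambda>\<alpha> \<beta>. g (fst \<alpha> * fst \<beta> - real_of_int (snd \<alpha>) * real_of_int (snd \<beta>)) *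
      (if snd \<beta> \<noteq> 0 \<and> \<bar>real_of_int (snd \<beta>)\<bar> \<le> \<bar>fst \<alpha>\<bar> then 1 else 0))
    \<le> 2 * ennreal (2 * B) * (\<integral>\<^sup>+\<zeta>. (h \<zeta>)\<^sup>2 \<partial>freq)\<^sup>2"
proof (rule quartic_form_schur)
  fix \<alpha> :: "real \<times> int"
  define S where "S = {n::int. n \<noteq> 0 \<and> \<bar>real_of_int n\<bar> \<le> \<bar>fst \<alpha>\<bar>}"
  have "(\<integral>\<^sup>+\<beta>. g (fst \<alpha> * fst \<beta> - real_of_int (snd \<alpha>) * real_of_int (snd \<beta>)) *
      (if snd \<beta> \<noteq> 0 \<and> \<bar>real_of_int (snd \<beta>)\<bar> \<le> \<bar>fst \<alpha>\<bar> then 1 else 0) \<partial>freq)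
    = (\<integral>\<^sup>+\<beta>. g (fst \<alpha> * fst \<beta> - real_of_int (snd \<alpha>) * real_of_int (snd \<beta>)) * indicator S (snd \<beta>) \<partial>freq)"
    by (intro nn_integral_cong) (auto simp: indicator_def S_def)
  also have "\<dots> \<le> ennreal (2 * B)"
    unfolding S_def by (intro g_slices card_nonzero_ints_le) auto
  finally show "(\<integral>\<^sup>+\<beta>. g (fst \<alpha> * fst \<beta> - real_of_int (snd \<alpha>) * real_of_int (snd \<beta>)) *
      (if snd \<beta> \<noteq> 0 \<and> \<bar>real_of_int (snd \<beta>)\<bar> \<le> \<bar>fst \<alpha>\<bar> then 1 else 0) \<partial>freq) \<le> ennreal (2 * B)" .
qed measurable

text \<open>The weight takes beta as its first argument, so that \<open>quartic_form_schur\<close>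
  freezes beta and integrates alpha. The factor 4 instead of 2 pays for the half unit by which the
  support of g enlarges the range of m.\<close>

lemma quartic_form_few_rows:
  assumes [measurable]: "h \<in> borel_measurable freq"
  shows "quartic_form h (\<lambda>\<beta> \<alpha>. g (fst \<alpha> * fst \<beta> - real_of_int (snd \<alpha>) * real_of_int (snd \<beta>)) *
      (if snd \<alpha> \<noteq> 0 \<and> snd \<beta> \<noteq> 0 \<and> \<bar>fst \<alpha>\<bar> < \<bar>real_of_int (snd \<beta>)\<bar> then 1 else 0))
    \<le> 2 * ennreal (4 * B) * (\<integral>\<^sup>+\<zeta>. (h \<zeta>)\<^sup>2 \<partial>freq)\<^sup>2"
proof (rule quartic_form_schur)
  fix \<beta> :: "real \<times> int"
  obtain b n where \<beta>: "\<beta> = (b, n)" by (cases \<beta>)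
  define S where "S = {m::int. m \<noteq> 0 \<and> \<bar>real_of_int m\<bar> \<le> \<bar>b\<bar> + 1/2}"
  \<comment> \<open>If |b| < 1/2, a nonzero integer m cannot satisfy |m| <= |b| + 1/2 < 1. Otherwise
    1/2 <= |b|, and the count 2 * (|b| + 1/2) is at most 4|b|.\<close>
  have "real (card S) \<le> 4 * \<bar>b\<bar>"
  proof (cases "\<bar>b\<bar> < 1/2")
    case True
    have "\<not> (m \<noteq> 0 \<and> \<bar>real_of_int m\<bar> \<le> \<bar>b\<bar> + 1/2)" for m :: int
      using True by linarith
    then have "S = {}" unfolding S_def by blast
    then show ?thesis by simp
  next
    case False
    have "real (card S) \<le> 2 * (\<bar>b\<bar> + 1/2)"
      unfolding S_def by (intro card_nonzero_ints_le) simp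
    then show ?thesis using False by simp
  qed
  note card = this
  have supp: "m \<in> S" if "n \<noteq> 0" "m \<noteq> 0" "\<bar>a\<bar> < \<bar>real_of_int n\<bar>" "g (a * b - real_of_int m * real_of_int n) \<noteq> 0" for a m
  proof -
    have "\<bar>a * b - real_of_int m * real_of_int n\<bar> \<le> 1/2" using g_support that(4) by (meson not_le)
    then have "\<bar>real_of_int m\<bar> * \<bar>real_of_int n\<bar> \<le> \<bar>a\<bar> * \<bar>b\<bar> + 1/2"
      unfolding abs_mult[symmetric] by linarith
    also have "\<bar>a\<bar> * \<bar>b\<bar> \<le> \<bar>real_of_int n\<bar> * \<bar>b\<bar>" using that(3) by (intro mult_right_mono) auto
    \<comment> \<open>As n is a nonzero integer, |n| >= 1, so the error 1/2 also acquires a factor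
      |n|, by which the inequality is then divided.\<close>
    also have "1/2 \<le> \<bar>real_of_int n\<bar> * (1/2)" using that(1) by simp
    finally have "\<bar>real_of_int m\<bar> * \<bar>real_of_int n\<bar> \<le> (\<bar>b\<bar> + 1/2) * \<bar>real_of_int n\<bar>"
      by (simp add: algebra_simps)
    then have "\<bar>real_of_int m\<bar> \<le> \<bar>b\<bar> + 1/2" using that(1) by simp
    then show ?thesis using that(2) by (simp add: S_def)
  qed
  have "(\<integral>\<^sup>+\<alpha>. g (fst \<alpha> * fst \<beta> - real_of_int (snd \<alpha>) * real_of_int (snd \<beta>)) *
      (if snd \<alpha> \<noteq> 0 \<and> snd \<beta> \<noteq> 0 \<and> \<bar>fst \<alpha>\<bar> < \<bar>real_of_int (snd \<beta>)\<bar> then 1 else 0) \<partial>freq)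
    \<le> (\<integral>\<^sup>+\<alpha>. g (b * fst \<alpha> - real_of_int n * real_of_int (snd \<alpha>)) * indicator S (snd \<alpha>) \<partial>freq)"
  proof (intro nn_integral_mono)
    fix \<alpha> :: "real \<times> int"
    obtain a m where \<alpha>: "\<alpha> = (a, m)" by (cases \<alpha>)
    have comm: "b * a - real_of_int n * real_of_int m = a * b - real_of_int m * real_of_int n" by simp
    show "g (fst \<alpha> * fst \<beta> - real_of_int (snd \<alpha>) * real_of_int (snd \<beta>)) *
        (if snd \<alpha> \<noteq> 0 \<and> snd \<beta> \<noteq> 0 \<and> \<bar>fst \<alpha>\<bar> < \<bar>real_of_int (snd \<beta>)\<bar> then 1 else 0)
      \<le> g (b * fst \<alpha> - real_of_int n * real_of_int (snd \<alpha>)) * indicator S (snd \<alpha>)"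
      unfolding \<alpha> \<beta> fst_conv snd_conv comm using supp[of m a]
      by (cases "g (a * b - real_of_int m * real_of_int n) = 0") (auto simp: indicator_def)
  qed
  also have "\<dots> \<le> ennreal (4 * B)"
    using card unfolding S_def by (intro g_slices card_nonzero_ints_le) auto
  finally show "(\<integral>\<^sup>+\<alpha>. g (fst \<alpha> * fst \<beta> - real_of_int (snd \<alpha>) * real_of_int (snd \<beta>)) *
      (if snd \<alpha> \<noteq> 0 \<and> snd \<beta> \<noteq> 0 \<and> \<bar>fst \<alpha>\<bar> < \<bar>real_of_int (snd \<beta>)\<bar> then 1 else 0) \<partial>freq) \<le> ennreal (4 * B)" .
qed measurable

text \<open>Here Schur's test in \<open>\<beta>\<close> would have to sum over the integer part of \<open>\<alpha>\<close>. Summing over \<open>k\<close> first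
turns the form into one for \<open>\<Phi> b \<xi> = (\<Sum>k. h (\<xi>, k) * h (\<xi> + b, k))\<close>, a purely one-dimensional estimate.\<close>

lemma quartic_form_row_cauchy_schwarz:
  assumes h [measurable]: "h \<in> borel_measurable freq"
  shows "quartic_form h (\<lambda>\<alpha> \<beta>. g (fst \<alpha> * fst \<beta>) * (if snd \<beta> = 0 \<and> \<bar>fst \<alpha>\<bar> < \<bar>fst \<beta>\<bar> then 1 else 0))
    \<le> 2 * ennreal (2 * B) * (\<integral>\<^sup>+\<zeta>. (h \<zeta>)\<^sup>2 \<partial>freq)\<^sup>2"
proof -
  define T where "T \<alpha> \<beta> = (\<integral>\<^sup>+\<zeta>. h \<zeta> * h (\<zeta> + \<alpha>) * h (\<zeta> + \<beta>) * h (\<zeta> + \<alpha> + \<beta>) \<partial>freq)" for \<alpha> \<beta>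
  define \<Phi> where "\<Phi> b \<xi> = (\<integral>\<^sup>+k. h (\<xi>, k) * h (\<xi> + b, k) \<partial>count_space UNIV)" for b \<xi>
  define S where "S \<xi> = (\<integral>\<^sup>+k. (h (\<xi>, k))\<^sup>2 \<partial>count_space UNIV)" for \<xi>
  define v where "v a b = g (a * b) * indicator {a. \<bar>a\<bar> < \<bar>b\<bar>} a" for a b
  define R where "R b = (\<integral>\<^sup>+\<xi>. (\<Phi> b \<xi>)\<^sup>2 \<partial>lborel)" for b
  have [measurable (raw)]: "(\<lambda>x. T (p x) (q x)) \<in> borel_measurable M"
    if [measurable]: "p \<in> M \<rightarrow>\<^sub>M freq" "q \<in> M \<rightarrow>\<^sub>M freq" for p q and M :: "'z measure"
    unfolding T_def by measurable
  have [measurable]: "case_prod \<Phi> \<in> borel_measurable (borel \<Otimes>\<^sub>M borel)" unfolding \<Phi>_def by measurable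
  have [measurable]: "S \<in> borel_measurable borel" unfolding S_def by measurable
  have [measurable]: "case_prod v \<in> borel_measurable (borel \<Otimes>\<^sub>M borel)"
  proof -
    have "case_prod v = (\<lambda>(a, b). if \<bar>a\<bar> < \<bar>b\<bar> then g (a * b) else 0)"
      by (auto simp: v_def indicator_def fun_eq_iff)
    then show ?thesis by simp
  qed
  have [measurable]: "R \<in> borel_measurable borel" unfolding R_def by measurable

  have inner: "(\<integral>\<^sup>+\<beta>. g (a * fst \<beta>) * (if snd \<beta> = 0 \<and> \<bar>a\<bar> < \<bar>fst \<beta>\<bar> then 1 else 0) * T (a, m) \<beta> \<partial>freq)
    = (\<integral>\<^sup>+b. v a b * T (a, m) (b, 0) \<partial>lborel)" for a m
  proof -
    have "(\<integral>\<^sup>+\<beta>. g (a * fst \<beta>) * (if snd \<beta> = 0 \<and> \<bar>a\<bar> < \<bar>fst \<beta>\<bar> then 1 else 0) * T (a, m) \<beta> \<partial>freq)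
      = (\<integral>\<^sup>+n. (\<integral>\<^sup>+b. g (a * b) * (if n = 0 \<and> \<bar>a\<bar> < \<bar>b\<bar> then 1 else 0) * T (a, m) (b, n) \<partial>lborel) \<partial>count_space UNIV)"
      by (subst nn_integral_freq_int_first) auto
    also have "\<dots> = (\<integral>\<^sup>+b. g (a * b) * (if \<bar>a\<bar> < \<bar>b\<bar> then 1 else 0) * T (a, m) (b, 0) \<partial>lborel)"
      by (subst nn_integral_count_space'[of "{0}"]) auto
    also have "\<dots> = (\<integral>\<^sup>+b. v a b * T (a, m) (b, 0) \<partial>lborel)"
      by (intro nn_integral_cong) (auto simp: v_def indicator_def)
    finally show ?thesis .
  qed
  \<comment> \<open>With n = 0 the translation by beta leaves k alone. Summing over m decouples the
    integer coordinates of the pairs at zeta and zeta + alpha and leaves the autocorrelation of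
    \<open>\<Phi> b\<close> at a.\<close>
  have sum_T: "(\<integral>\<^sup>+m. T (a, m) (b, 0) \<partial>count_space UNIV) = (\<integral>\<^sup>+\<xi>. \<Phi> b \<xi> * \<Phi> b (\<xi> + a) \<partial>lborel)" for a b
  proof -
    have "(\<integral>\<^sup>+m. T (a, m) (b, 0) \<partial>count_space UNIV)
      = (\<integral>\<^sup>+m. \<integral>\<^sup>+\<zeta>. (h \<zeta> * h (\<zeta> + (b, 0))) * (h (\<zeta> + (a, m)) * h (\<zeta> + (a, m) + (b, 0))) \<partial>freq \<partial>count_space UNIV)"
      by (simp add: T_def mult_ac)
    also have "\<dots> = (\<integral>\<^sup>+\<zeta>. \<integral>\<^sup>+m. (h \<zeta> * h (\<zeta> + (b, 0))) * (h (\<zeta> + (a, m)) * h (\<zeta> + (a, m) + (b, 0))) \<partial>count_space UNIV \<partial>freq)"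
    proof -
      interpret pair_sigma_finite "count_space (UNIV :: int set)" freq ..
      show ?thesis by (rule Fubini'[symmetric]) measurable
    qed
    also have "\<dots> = (\<integral>\<^sup>+\<zeta>. (h \<zeta> * h (\<zeta> + (b, 0))) * \<Phi> b (fst \<zeta> + a) \<partial>freq)"
    proof (intro nn_integral_cong)
      fix \<zeta> :: "real \<times> int"
      obtain \<xi> k where \<zeta>: "\<zeta> = (\<xi>, k)" by (cases \<zeta>)
      have "(\<integral>\<^sup>+m. (h \<zeta> * h (\<zeta> + (b, 0))) * (h (\<zeta> + (a, m)) * h (\<zeta> + (a, m) + (b, 0))) \<partial>count_space UNIV)
        = (h \<zeta> * h (\<zeta> + (b, 0))) * (\<integral>\<^sup>+m. h (\<xi> + a, m + k) * h (\<xi> + a + b, m + k) \<partial>count_space UNIV)"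
        by (subst nn_integral_cmult) (auto simp: \<zeta> add.commute)
      also have "(\<integral>\<^sup>+m. h (\<xi> + a, m + k) * h (\<xi> + a + b, m + k) \<partial>count_space UNIV) = \<Phi> b (fst \<zeta> + a)"
        unfolding \<Phi>_def using nn_integral_int_shift[of "\<lambda>m. h (\<xi> + a, m) * h (\<xi> + a + b, m)" k] by (simp add: \<zeta>)
      finally show "(\<integral>\<^sup>+m. (h \<zeta> * h (\<zeta> + (b, 0))) * (h (\<zeta> + (a, m)) * h (\<zeta> + (a, m) + (b, 0))) \<partial>count_space UNIV)
        = (h \<zeta> * h (\<zeta> + (b, 0))) * \<Phi> b (fst \<zeta> + a)" .
    qed
    also have "\<dots> = (\<integral>\<^sup>+\<xi>. \<Phi> b \<xi> * \<Phi> b (\<xi> + a) \<partial>lborel)"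
      by (subst nn_integral_freq) (measurable, simp add: \<Phi>_def nn_integral_multc)
    finally show ?thesis .
  qed
  have sum_T_le: "(\<integral>\<^sup>+m. T (a, m) (b, 0) \<partial>count_space UNIV) \<le> 2 * R b" for a b
  proof -
    have "(\<integral>\<^sup>+\<xi>. \<Phi> b \<xi> * \<Phi> b (\<xi> + a) \<partial>lborel) \<le> (\<integral>\<^sup>+\<xi>. (\<Phi> b \<xi>)\<^sup>2 + (\<Phi> b (\<xi> + a))\<^sup>2 \<partial>lborel)"
      by (intro nn_integral_mono ennreal_mult_le_squares)
    also have "\<dots> = R b + (\<integral>\<^sup>+\<xi>. (\<Phi> b (\<xi> + a))\<^sup>2 \<partial>lborel)"
      unfolding R_def by (intro nn_integral_add) measurable
    also have "(\<integral>\<^sup>+\<xi>. (\<Phi> b (\<xi> + a))\<^sup>2 \<partial>lborel) = R b"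
      unfolding R_def by (rule nn_integral_real_shift[of "\<lambda>\<xi>. (\<Phi> b \<xi>)\<^sup>2"]) measurable
    finally show ?thesis by (simp add: sum_T mult_2)
  qed
  \<comment> \<open>Cauchy-Schwarz in k gives
    \<open>(\<Phi> b \<xi>)\<^sup>2 \<le> S \<xi> * S (\<xi> + b)\<close>; integrating in b and xi
    factors the right-hand side.\<close>
  have R_total: "(\<integral>\<^sup>+b. R b \<partial>lborel) \<le> (\<integral>\<^sup>+\<zeta>. (h \<zeta>)\<^sup>2 \<partial>freq)\<^sup>2"
  proof -
    have "(\<integral>\<^sup>+b. R b \<partial>lborel) \<le> (\<integral>\<^sup>+b. \<integral>\<^sup>+\<xi>. S \<xi> * S (\<xi> + b) \<partial>lborel \<partial>lborel)"
      unfolding R_def \<Phi>_def S_def by (intro nn_integral_mono Cauchy_Schwarz_nn_integral) auto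
    also have "\<dots> = (\<integral>\<^sup>+\<xi>. \<integral>\<^sup>+b. S \<xi> * S (b + \<xi>) \<partial>lborel \<partial>lborel)"
      by (subst lborel_pair.Fubini') (measurable, simp add: add.commute)
    also have "\<dots> = (\<integral>\<^sup>+\<xi>. S \<xi> * (\<integral>\<^sup>+b. S b \<partial>lborel) \<partial>lborel)"
      by (simp add: nn_integral_cmult nn_integral_real_shift)
    also have "\<dots> = (\<integral>\<^sup>+\<xi>. S \<xi> \<partial>lborel)\<^sup>2"
      by (simp add: nn_integral_multc power2_eq_square)
    also have "(\<integral>\<^sup>+\<xi>. S \<xi> \<partial>lborel) = (\<integral>\<^sup>+\<zeta>. (h \<zeta>)\<^sup>2 \<partial>freq)"
      unfolding S_def by (subst nn_integral_freq) auto
    finally show ?thesis .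
  qed
  have "quartic_form h (\<lambda>\<alpha> \<beta>. g (fst \<alpha> * fst \<beta>) * (if snd \<beta> = 0 \<and> \<bar>fst \<alpha>\<bar> < \<bar>fst \<beta>\<bar> then 1 else 0))
    = (\<integral>\<^sup>+a. \<integral>\<^sup>+m. \<integral>\<^sup>+b. v a b * T (a, m) (b, 0) \<partial>lborel \<partial>count_space UNIV \<partial>lborel)"
    unfolding quartic_form_def T_def[symmetric]
    by (subst nn_integral_freq) (measurable, simp add: inner)
  also have "\<dots> = (\<integral>\<^sup>+a. \<integral>\<^sup>+b. \<integral>\<^sup>+m. v a b * T (a, m) (b, 0) \<partial>count_space UNIV \<partial>lborel \<partial>lborel)"
    by (intro nn_integral_cong line_int.Fubini') measurable
  also have "\<dots> = (\<integral>\<^sup>+a. \<integral>\<^sup>+b. v a b * (\<integral>\<^sup>+m. T (a, m) (b, 0) \<partial>count_space UNIV) \<partial>lborel \<partial>lborel)"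
    by (simp add: nn_integral_cmult)
  also have "\<dots> \<le> (\<integral>\<^sup>+a. \<integral>\<^sup>+b. v a b * (2 * R b) \<partial>lborel \<partial>lborel)"
    by (intro nn_integral_mono mult_left_mono sum_T_le) auto
  \<comment> \<open>The bound \<open>2 * R b\<close> no longer depends on a, so a is integrated
    first: \<open>g_dilate_L1\<close> applies with a and b exchanged, because here |a| <
    |b|.\<close>
  also have "\<dots> = (\<integral>\<^sup>+b. \<integral>\<^sup>+a. v a b * (2 * R b) \<partial>lborel \<partial>lborel)"
    by (rule lborel_pair.Fubini'[symmetric]) measurable
  also have "\<dots> = (\<integral>\<^sup>+b. (\<integral>\<^sup>+a. v a b \<partial>lborel) * (2 * R b) \<partial>lborel)"
    by (simp add: nn_integral_multc)
  also have "\<dots> \<le> (\<integral>\<^sup>+b. ennreal (2 * B) * (2 * R b) \<partial>lborel)"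
  proof (intro nn_integral_mono mult_right_mono)
    fix b :: real
    have "(\<integral>\<^sup>+a. v a b \<partial>lborel) \<le> (\<integral>\<^sup>+a. g (b * a) * indicator {a. \<bar>a\<bar> \<le> \<bar>b\<bar>} a \<partial>lborel)"
      by (intro nn_integral_mono) (auto simp: v_def indicator_def mult.commute)
    also have "\<dots> \<le> ennreal (2 * B)" by (rule g_dilate_L1)
    finally show "(\<integral>\<^sup>+a. v a b \<partial>lborel) \<le> ennreal (2 * B)" .
  qed simp
  also have "\<dots> = 2 * ennreal (2 * B) * (\<integral>\<^sup>+b. R b \<partial>lborel)"
    by (simp add: nn_integral_cmult nn_integral_multc mult_ac)
  also have "\<dots> \<le> 2 * ennreal (2 * B) * (\<integral>\<^sup>+\<zeta>. (h \<zeta>)\<^sup>2 \<partial>freq)\<^sup>2"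
    by (intro mult_left_mono R_total) simp
  finally show ?thesis .
qed

text \<open>For n = 0 the sizes of a and b decide between \<open>V1\<close> and \<open>V4\<close>;
  for m = 0 the same holds with the roles exchanged; otherwise the choice is between
  \<open>V2\<close> and \<open>V3\<close>. The overlap at m = n = 0 is harmless for an upper bound.
  As \<open>V1\<close> and \<open>V4\<close> each occur twice, five terms 4B and one term 8B add up
  to 28B.\<close>

lemma quartic_form_bound:
  assumes [measurable]: "h \<in> borel_measurable freq"
  shows "quartic_form h (\<lambda>\<alpha> \<beta>. g (fst \<alpha> * fst \<beta> - real_of_int (snd \<alpha>) * real_of_int (snd \<beta>)))
    \<le> ennreal (28 * B) * (\<integral>\<^sup>+\<zeta>. (h \<zeta>)\<^sup>2 \<partial>freq)\<^sup>2"
proof -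
  define V1 :: "real \<times> int \<Rightarrow> real \<times> int \<Rightarrow> ennreal" where
    "V1 \<alpha> \<beta> = g (fst \<alpha> * fst \<beta>) * (if snd \<beta> = 0 \<and> \<bar>fst \<beta>\<bar> \<le> \<bar>fst \<alpha>\<bar> then 1 else 0)" for \<alpha> \<beta>
  define V2 :: "real \<times> int \<Rightarrow> real \<times> int \<Rightarrow> ennreal" where
    "V2 \<alpha> \<beta> = g (fst \<alpha> * fst \<beta> - real_of_int (snd \<alpha>) * real_of_int (snd \<beta>)) *
      (if snd \<beta> \<noteq> 0 \<and> \<bar>real_of_int (snd \<beta>)\<bar> \<le> \<bar>fst \<alpha>\<bar> then 1 else 0)" for \<alpha> \<beta>
  define V3 :: "real \<times> int \<Rightarrow> real \<times> int \<Rightarrow> ennreal" where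
    "V3 \<beta> \<alpha> = g (fst \<alpha> * fst \<beta> - real_of_int (snd \<alpha>) * real_of_int (snd \<beta>)) *
      (if snd \<alpha> \<noteq> 0 \<and> snd \<beta> \<noteq> 0 \<and> \<bar>fst \<alpha>\<bar> < \<bar>real_of_int (snd \<beta>)\<bar> then 1 else 0)" for \<alpha> \<beta>
  define V4 :: "real \<times> int \<Rightarrow> real \<times> int \<Rightarrow> ennreal" where
    "V4 \<alpha> \<beta> = g (fst \<alpha> * fst \<beta>) * (if snd \<beta> = 0 \<and> \<bar>fst \<alpha>\<bar> < \<bar>fst \<beta>\<bar> then 1 else 0)" for \<alpha> \<beta>
  let ?E = "(\<integral>\<^sup>+\<zeta>. (h \<zeta>)\<^sup>2 \<partial>freq)\<^sup>2"
  have V [measurable]: "case_prod V1 \<in> borel_measurable (freq \<Otimes>\<^sub>M freq)"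
    "case_prod V2 \<in> borel_measurable (freq \<Otimes>\<^sub>M freq)"
    "case_prod V3 \<in> borel_measurable (freq \<Otimes>\<^sub>M freq)"
    "case_prod V4 \<in> borel_measurable (freq \<Otimes>\<^sub>M freq)"
    unfolding V1_def V2_def V3_def V4_def by measurable
  have "quartic_form h (\<lambda>\<alpha> \<beta>. g (fst \<alpha> * fst \<beta> - real_of_int (snd \<alpha>) * real_of_int (snd \<beta>)))
    \<le> quartic_form h (\<lambda>\<alpha> \<beta>. V1 \<alpha> \<beta> + (V1 \<beta> \<alpha> + (V2 \<alpha> \<beta> + (V3 \<beta> \<alpha> + (V4 \<alpha> \<beta> + V4 \<beta> \<alpha>)))))"
  proof (rule quartic_form_mono)
    fix \<alpha> \<beta> :: "real \<times> int"
    let ?G = "g (fst \<alpha> * fst \<beta> - real_of_int (snd \<alpha>) * real_of_int (snd \<beta>))"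
    have "?G = V1 \<alpha> \<beta> \<or> ?G = V4 \<alpha> \<beta>" if "snd \<beta> = 0"
      using that by (cases "\<bar>fst \<beta>\<bar> \<le> \<bar>fst \<alpha>\<bar>") (simp_all add: V1_def V4_def)
    moreover have "?G = V1 \<beta> \<alpha> \<or> ?G = V4 \<beta> \<alpha>" if "snd \<alpha> = 0"
      using that by (cases "\<bar>fst \<alpha>\<bar> \<le> \<bar>fst \<beta>\<bar>") (simp_all add: V1_def V4_def mult.commute)
    moreover have "?G = V2 \<alpha> \<beta> \<or> ?G = V3 \<beta> \<alpha>" if "snd \<alpha> \<noteq> 0" "snd \<beta> \<noteq> 0"
      using that by (cases "\<bar>real_of_int (snd \<beta>)\<bar> \<le> \<bar>fst \<alpha>\<bar>") (simp_all add: V2_def V3_def)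
    ultimately consider "?G = V1 \<alpha> \<beta>" | "?G = V4 \<alpha> \<beta>" | "?G = V1 \<beta> \<alpha>" | "?G = V4 \<beta> \<alpha>"
      | "?G = V2 \<alpha> \<beta>" | "?G = V3 \<beta> \<alpha>" by blast
    then show "?G \<le> V1 \<alpha> \<beta> + (V1 \<beta> \<alpha> + (V2 \<alpha> \<beta> + (V3 \<beta> \<alpha> + (V4 \<alpha> \<beta> + V4 \<beta> \<alpha>))))"
      apply cases
           apply (drule eq_refl; (assumption | (rule add_increasing2[OF zero_le], assumption)
            | rule add_increasing[OF zero_le])+)+
      done
  qed
  also have "\<dots> = quartic_form h V1 + (quartic_form h V1 + (quartic_form h V2 + (quartic_form h V3
      + (quartic_form h V4 + quartic_form h V4))))"
    by (simp add: quartic_form_add quartic_form_swap[of h V1] quartic_form_swap[of h V3]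
        quartic_form_swap[of h V4])
  also have "\<dots> \<le> 2 * ennreal (2 * B) * ?E + (2 * ennreal (2 * B) * ?E + (2 * ennreal (2 * B) * ?E
      + (2 * ennreal (4 * B) * ?E + (2 * ennreal (2 * B) * ?E + 2 * ennreal (2 * B) * ?E))))"
    unfolding V1_def V2_def V3_def V4_def
    by (intro add_mono quartic_form_row_schur quartic_form_few_columns quartic_form_few_rows
        quartic_form_row_cauchy_schwarz assms)
  also have "\<dots> = ennreal (28 * B) * ?E"
  proof -
    have "2 * ennreal (2 * B) = ennreal (4 * B)" "2 * ennreal (4 * B) = ennreal (8 * B)"
      using B_nonneg by (simp_all add: ennreal_mult[symmetric] flip: ennreal_numeral)
    then show ?thesis
      using B_nonneg by (simp add: distrib_right[symmetric] ennreal_plus[symmetric] del: ennreal_plus)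
  qed
  finally show ?thesis .
qed

end

section \<open>Oscillatory integrals and the Fejer kernel\<close>

lemma borel_measurable_cis [measurable (raw)]:
  assumes [measurable]: "f \<in> borel_measurable M"
  shows "(\<lambda>x. cis (f x)) \<in> borel_measurable M"
proof -
  have "cis \<in> borel_measurable borel"
    by (intro borel_measurable_continuous_onI continuous_on_cis continuous_intros)
  then show ?thesis by measurable
qed

lemma borel_measurable_cnj [measurable (raw)]:
  assumes [measurable]: "f \<in> borel_measurable M"
  shows "(\<lambda>x. cnj (f x)) \<in> borel_measurable M"
proof -
  have "cnj \<in> borel_measurable borel"
    by (intro borel_measurable_continuous_onI continuous_on_cnj continuous_intros)
  then show ?thesis by measurable
qed

lemma integrable_mult_cis:
  fixes h :: "'a \<Rightarrow> complex"
  assumes "integrable M h" and [measurable]: "f \<in> borel_measurable M"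
  shows "integrable M (\<lambda>x. h x * cis (f x))"
  by (rule Bochner_Integration.integrable_bound[OF assms(1)]) (use assms in \<open>auto simp: norm_mult\<close>)

lemma integrable_tensor:
  fixes f :: "'a \<Rightarrow> complex" and g :: "'b \<Rightarrow> complex"
  assumes "sigma_finite_measure M" "sigma_finite_measure N"
    and f: "integrable M f" and g: "integrable N g"
  shows "integrable (M \<Otimes>\<^sub>M N) (\<lambda>p. f (fst p) * g (snd p))"
proof -
  interpret M: sigma_finite_measure M by fact
  interpret N: sigma_finite_measure N by fact
  interpret pair_sigma_finite M N ..
  note [measurable] = borel_measurable_integrable[OF f] borel_measurable_integrable[OF g]
  show ?thesis
  proof (rule Fubini_integrable)
    show "integrable M (\<lambda>x. \<integral>y. norm (f (fst (x, y)) * g (snd (x, y))) \<partial>N)"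
      using f by (simp add: norm_mult)
    show "AE x in M. integrable N (\<lambda>y. f (fst (x, y)) * g (snd (x, y)))"
      using g by simp
  qed measurable
qed

text \<open>Write the square as a double integral over zeta and eta, integrate in t first, and take
  absolute values only afterwards: the oscillation in t survives as the Fourier transform of w at
  the phase difference. It is used with M the line, for the Plancherel inequality, and with M =
  \<open>freq\<close>, for the time integral of the autocorrelation.\<close>

lemma weighted_L2_oscillatory:
  fixes H :: "'a \<Rightarrow> complex" and w :: "real \<Rightarrow> real"
  assumes sf: "sigma_finite_measure M" and H: "integrable M H" and l [measurable]: "l \<in> borel_measurable M"
    and w: "integrable lborel w" and w_nonneg: "\<And>t. 0 \<le> w t"
  shows "(\<integral>\<^sup>+t. ennreal (w t * (cmod (\<integral>\<zeta>. H \<zeta> * cis (t * l \<zeta>) \<partial>M))\<^sup>2) \<partial>lborel)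
    \<le> (\<integral>\<^sup>+\<zeta>. \<integral>\<^sup>+\<eta>. ennreal (cmod (H \<zeta>) * cmod (H \<eta>) *
          cmod (\<integral>t. w t * cis (t * (l \<zeta> - l \<eta>)) \<partial>lborel)) \<partial>M \<partial>M)"
proof -
  interpret M: sigma_finite_measure M by fact
  interpret MM: pair_sigma_finite M M ..
  interpret L: pair_sigma_finite lborel "M \<Otimes>\<^sub>M M" ..
  note [measurable] = borel_measurable_integrable[OF H] borel_measurable_integrable[OF w]
  define \<Phi> where "\<Phi> t = (\<integral>\<zeta>. H \<zeta> * cis (t * l \<zeta>) \<partial>M)" for t
  define P where "P p = H (fst p) * cnj (H (snd p))" for p
  define \<delta> where "\<delta> p = l (fst p) - l (snd p)" for p
  define W where "W \<mu> = (\<integral>t. w t * cis (t * \<mu>) \<partial>lborel)" for \<mu>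
  have [measurable]: "\<Phi> \<in> borel_measurable borel"
    unfolding \<Phi>_def by measurable
  have [measurable]: "P \<in> borel_measurable (M \<Otimes>\<^sub>M M)" "\<delta> \<in> borel_measurable (M \<Otimes>\<^sub>M M)"
    unfolding P_def \<delta>_def by measurable
  have [measurable]: "W \<in> borel_measurable borel" unfolding W_def by measurable
  have P: "integrable (M \<Otimes>\<^sub>M M) P"
    unfolding P_def using H by (intro integrable_tensor sf) auto
  have sq: "(\<Phi> t) * cnj (\<Phi> t) = (\<integral>p. P p * cis (t * \<delta> p) \<partial>(M \<Otimes>\<^sub>M M))" for t
  proof -
    have "(\<integral>p. P p * cis (t * \<delta> p) \<partial>(M \<Otimes>\<^sub>M M))
      = (\<integral>\<zeta>. \<integral>\<eta>. P (\<zeta>, \<eta>) * cis (t * \<delta> (\<zeta>, \<eta>)) \<partial>M \<partial>M)"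
      by (rule MM.integral_fst'[symmetric]) (intro integrable_mult_cis P, measurable)
    also have "\<dots> = (\<integral>\<zeta>. \<integral>\<eta>. (H \<zeta> * cis (t * l \<zeta>)) * cnj (H \<eta> * cis (t * l \<eta>)) \<partial>M \<partial>M)"
    proof -
      have "cis (t * (x - y)) = cis (t * x) * cnj (cis (t * y))" for x y
        by (simp add: cis_cnj cis_mult right_diff_distrib)
      then show ?thesis by (simp add: P_def \<delta>_def mult_ac)
    qed
    also have "\<dots> = \<Phi> t * cnj (\<Phi> t)"
      unfolding \<Phi>_def by (simp only: integral_mult_right_zero integral_mult_left_zero Bochner_Integration.integral_cnj)
    finally show ?thesis ..
  qed
  have bound: "cmod (\<Phi> t) \<le> (\<integral>\<zeta>. cmod (H \<zeta>) \<partial>M)" for t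
    unfolding \<Phi>_def using integral_norm_bound[of M "\<lambda>\<zeta>. H \<zeta> * cis (t * l \<zeta>)"] by (simp add: norm_mult)
  have int: "integrable lborel (\<lambda>t. w t * (cmod (\<Phi> t))\<^sup>2)"
  proof (rule Bochner_Integration.integrable_bound)
    show "integrable lborel (\<lambda>t. w t * (\<integral>\<zeta>. cmod (H \<zeta>) \<partial>M)\<^sup>2)" using w by simp
    show "AE t in lborel. norm (w t * (cmod (\<Phi> t))\<^sup>2) \<le> norm (w t * (\<integral>\<zeta>. cmod (H \<zeta>) \<partial>M)\<^sup>2)"
      using bound by (intro AE_I2) (auto simp: abs_mult w_nonneg intro!: mult_left_mono power_mono)
  qed measurable
  \<comment> \<open>The factor cis has modulus 1, so absolute integrability reduces to a tensor
    product of w with two copies of H. This justifies exchanging t with the frequency pair.\<close>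
  have joint: "integrable (lborel \<Otimes>\<^sub>M (M \<Otimes>\<^sub>M M)) (\<lambda>(t, p). (w t * P p) * cis (t * \<delta> p))"
  proof -
    have "integrable (lborel \<Otimes>\<^sub>M (M \<Otimes>\<^sub>M M)) (\<lambda>q. complex_of_real (w (fst q)) * P (snd q))"
    proof (rule integrable_tensor)
      show "sigma_finite_measure (lborel :: real measure)" ..
      show "sigma_finite_measure (M \<Otimes>\<^sub>M M)" ..
    qed (use w P in auto)
    then have "integrable (lborel \<Otimes>\<^sub>M (M \<Otimes>\<^sub>M M)) (\<lambda>q. complex_of_real (w (fst q)) * P (snd q) * cis (fst q * \<delta> (snd q)))"
      by (rule integrable_mult_cis) measurable
    then show ?thesis by (simp only: case_prod_unfold)
  qed
  have "complex_of_real (\<integral>t. w t * (cmod (\<Phi> t))\<^sup>2 \<partial>lborel) = (\<integral>t. complex_of_real (w t) * (\<Phi> t * cnj (\<Phi> t)) \<partial>lborel)"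
    by (simp add: complex_norm_square[symmetric] flip: integral_complex_of_real of_real_mult of_real_power)
  also have "\<dots> = (\<integral>t. \<integral>p. (w t * P p) * cis (t * \<delta> p) \<partial>(M \<Otimes>\<^sub>M M) \<partial>lborel)"
    by (simp add: sq mult.assoc)
  also have "\<dots> = (\<integral>p. \<integral>t. (w t * P p) * cis (t * \<delta> p) \<partial>lborel \<partial>(M \<Otimes>\<^sub>M M))"
    by (rule L.Fubini_integral[symmetric]) (rule joint)
  also have "\<dots> = (\<integral>p. P p * W (\<delta> p) \<partial>(M \<Otimes>\<^sub>M M))"
    unfolding W_def by (intro Bochner_Integration.integral_cong refl)
      (simp add: mult_ac flip: integral_mult_right_zero)
  finally have eq: "complex_of_real (\<integral>t. w t * (cmod (\<Phi> t))\<^sup>2 \<partial>lborel) = (\<integral>p. P p * W (\<delta> p) \<partial>(M \<Otimes>\<^sub>M M))" .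
  have "(\<integral>\<^sup>+t. ennreal (w t * (cmod (\<Phi> t))\<^sup>2) \<partial>lborel) = ennreal (\<integral>t. w t * (cmod (\<Phi> t))\<^sup>2 \<partial>lborel)"
    using int w_nonneg by (intro nn_integral_eq_integral) auto
  also have "\<dots> = ennreal (cmod (\<integral>p. P p * W (\<delta> p) \<partial>(M \<Otimes>\<^sub>M M)))"
    unfolding eq[symmetric] norm_of_real by (subst abs_of_nonneg) (auto intro!: integral_nonneg_AE simp: w_nonneg)
  also have "\<dots> \<le> (\<integral>\<^sup>+p. ennreal (cmod (P p * W (\<delta> p))) \<partial>(M \<Otimes>\<^sub>M M))"
  \<comment> \<open>Without integrability the integral on the left has value 0 and the bound is
    trivial.\<close>
  proof (cases "integrable (M \<Otimes>\<^sub>M M) (\<lambda>p. P p * W (\<delta> p))")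
    case True
    then show ?thesis by (rule integral_norm_bound_ennreal)
  qed (simp add: not_integrable_integral_eq)
  also have "\<dots> = (\<integral>\<^sup>+\<zeta>. \<integral>\<^sup>+\<eta>. ennreal (cmod (P (\<zeta>, \<eta>) * W (\<delta> (\<zeta>, \<eta>)))) \<partial>M \<partial>M)"
    by (rule M.nn_integral_fst[symmetric]) measurable
  finally show ?thesis unfolding \<Phi>_def P_def W_def \<delta>_def by (simp add: norm_mult)
qed

text \<open>The Fourier transform of \<open>fejer\<close> is a multiple of the triangle function because
\<open>(1 - cos t) * cos (\<mu> * t)\<close> is a combination of functions \<open>1 - cos (a * t)\<close>, and scaling gives
\<open>\<integral> (1 - cos (a * t)) / t\<^sup>2 = \<bar>a\<bar> * fejer_mass\<close>; the value of \<open>fejer_mass\<close> (which is \<open>\<pi>\<close>) is never needed.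
The junk value \<open>fejer 0 = 0\<close> is harmless.\<close>

definition fejer :: "real \<Rightarrow> real" where
  "fejer t = (1 - cos t) / t\<^sup>2"

definition fejer_mass :: real where
  "fejer_mass = (\<integral>t. fejer t \<partial>lborel)"

text \<open>This is max 0 (1 - |mu|), written as the second difference of the absolute value that
  \<open>fejer_dilate\<close> produces.\<close>

definition triangle :: "real \<Rightarrow> real" where
  "triangle \<mu> = (\<bar>\<mu> + 1\<bar> + \<bar>\<mu> - 1\<bar>) / 2 - \<bar>\<mu>\<bar>"

lemma fejer_measurable [measurable]: "fejer \<in> borel_measurable borel"
  unfolding fejer_def by measurable

lemma fejer_nonneg: "0 \<le> fejer t"
  by (simp add: fejer_def)

lemma one_minus_cos_eq: "1 - cos t = 2 * (sin (t / 2))\<^sup>2" for t :: real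
  using cos_double_sin[of "t/2"] by simp

lemma fejer_le: "fejer t \<le> 1 / 2"
proof -
  have "(sin (t / 2))\<^sup>2 \<le> (t / 2)\<^sup>2"
    using abs_sin_x_le_abs_x[of "t/2"] by (simp only: abs_le_square_iff)
  then show ?thesis by (cases "t = 0") (simp_all add: fejer_def one_minus_cos_eq field_simps)
qed

text \<open>This makes the Fejer kernel dominate one third of the indicator of [-1, 1] off the
  origin, and it is the source of the factors 3 below. The origin is excluded because
  \<open>fejer 0 = 0\<close>.\<close>

lemma fejer_ge:
  assumes "t \<noteq> 0" "\<bar>t\<bar> \<le> 1"
  shows "1 / 3 \<le> fejer t"
proof -
  define s where "s = \<bar>t\<bar> / 2"
  have s: "0 < s" "s \<le> 1/2" using assms by (auto simp: s_def)
  \<comment> \<open>For s <= 1/2 the Taylor remainder s^3/6 is at most s/24, so sin s >= 23/24 * s.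
    Inserted into 1 - cos t = 2 (sin (t/2))^2, this gives 2 * (23/24)^2 / 4 = 529/1152, which
    exceeds 1/3.\<close>
  have "\<bar>sin s - s\<bar> \<le> inverse (fact 3) * \<bar>s\<bar> ^ 3"
    using Maclaurin_sin_bound[of s 3] by (simp add: sin_coeff_def numeral_3_eq_3)
  then have "s - s ^ 3 / 6 \<le> sin s" using s by (simp add: fact_numeral abs_if split: if_splits)
  moreover have "s ^ 3 \<le> s * (1/4)"
    using s mult_mono[of s "1/2" s "1/2"] by (simp add: power3_eq_cube)
  ultimately have "23/24 * s \<le> sin s" by linarith
  then have "(23/24 * s)\<^sup>2 \<le> (sin s)\<^sup>2" using s by (intro power_mono) auto
  moreover have "(sin s)\<^sup>2 = (sin (t / 2))\<^sup>2" by (simp add: s_def abs_if)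
  moreover have "s\<^sup>2 = t\<^sup>2 / 4" by (simp add: s_def power_divide)
  ultimately have "529/1152 * t\<^sup>2 \<le> 1 - cos t" by (simp add: one_minus_cos_eq power_mult_distrib power_divide)
  moreover have "1/3 * t\<^sup>2 \<le> 529/1152 * t\<^sup>2" by (intro mult_right_mono) auto
  ultimately have "1/3 * t\<^sup>2 \<le> 1 - cos t" by linarith
  then show ?thesis using assms(1) unfolding fejer_def by (subst pos_le_divide_eq) auto
qed

lemma fejer_integrable: "integrable lborel fejer"
proof -
  have half: "(\<integral>\<^sup>+x. ennreal (1 / (1 + x\<^sup>2)) * indicator {0..} x \<partial>lborel) = ennreal (pi/2 - arctan 0)"
  proof (rule nn_integral_FTC_atLeast)
    show "DERIV arctan x :> 1 / (1 + x\<^sup>2)" for x :: real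
      using DERIV_arctan[of x] by (simp add: inverse_eq_divide)
    show "(arctan \<longlongrightarrow> pi / 2) at_top" by (rule tendsto_arctan_at_top)
  qed (auto simp: add_nonneg_nonneg)
  have "(\<integral>\<^sup>+x. ennreal (1 / (1 + x\<^sup>2)) \<partial>lborel)
    \<le> (\<integral>\<^sup>+x. ennreal (1 / (1 + x\<^sup>2)) * indicator {0..} x + ennreal (1 / (1 + (-x)\<^sup>2)) * indicator {0..} (-x) \<partial>lborel)"
    by (intro nn_integral_mono) (auto simp: indicator_def)
  also have "\<dots> = (\<integral>\<^sup>+x. ennreal (1 / (1 + x\<^sup>2)) * indicator {0..} x \<partial>lborel)
      + (\<integral>\<^sup>+x. ennreal (1 / (1 + (-x)\<^sup>2)) * indicator {0..} (-x) \<partial>lborel)"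
    by (rule nn_integral_add) measurable
  also have "(\<integral>\<^sup>+x. ennreal (1 / (1 + (-x)\<^sup>2)) * indicator {0..} (-x) \<partial>lborel)
      = (\<integral>\<^sup>+x. ennreal (1 / (1 + x\<^sup>2)) * indicator {0..} x \<partial>lborel)"
    using nn_integral_real_affine[of "\<lambda>x. ennreal (1 / (1 + x\<^sup>2)) * indicator {0..} x" "-1" 0] by simp
  also have "\<dots> + \<dots> < \<infinity>" unfolding half by simp
  finally have fin: "(\<integral>\<^sup>+x. ennreal (1 / (1 + x\<^sup>2)) \<partial>lborel) < \<infinity>" by (simp add: half)
  have "integrable lborel (\<lambda>x::real. 1 / (1 + x\<^sup>2))"
    by (rule integrableI_bounded) (use fin in \<open>auto simp: abs_of_nonneg add_nonneg_nonneg\<close>)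
  then have "integrable lborel (\<lambda>x::real. 5/2 * (1 / (1 + x\<^sup>2)))"
    by (intro Bochner_Integration.integrable_mult_right)
  then show ?thesis
  proof (rule Bochner_Integration.integrable_bound)
    \<comment> \<open>The two bounds \<open>x\<^sup>2 * fejer x \<le> 2\<close> and
      \<open>fejer x \<le> 1/2\<close> add up to 5/2.\<close>
    have "fejer x \<le> 5/2 * (1 / (1 + x\<^sup>2))" for x
    proof -
      have "x\<^sup>2 * fejer x \<le> 2" using cos_ge_minus_one[of x] by (cases "x = 0") (auto simp: fejer_def)
      then have "fejer x * (1 + x\<^sup>2) \<le> 5/2" using fejer_le[of x] by (simp add: algebra_simps)
      moreover have "0 < 1 + x\<^sup>2" by (simp add: add_pos_nonneg)
      ultimately have "fejer x \<le> (5/2) / (1 + x\<^sup>2)" by (simp only: pos_le_divide_eq)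
      then show ?thesis by simp
    qed
    then show "AE x in lborel. norm (fejer x) \<le> norm (5/2 * (1 / (1 + x\<^sup>2)))"
      using fejer_nonneg by (auto simp: abs_of_nonneg add_nonneg_nonneg)
  qed measurable
qed

lemma fejer_mass_nonneg: "0 \<le> fejer_mass"
  unfolding fejer_mass_def by (intro integral_nonneg_AE AE_I2 fejer_nonneg)

lemma fejer_dilate:
  shows "integrable lborel (\<lambda>t. (1 - cos (a * t)) / t\<^sup>2)"
    and "(\<integral>t. (1 - cos (a * t)) / t\<^sup>2 \<partial>lborel) = \<bar>a\<bar> * fejer_mass"
proof -
  have eq: "(1 - cos (a * t)) / t\<^sup>2 = a\<^sup>2 * fejer (0 + a * t)" for t
    by (simp add: fejer_def power_mult_distrib)
  show "integrable lborel (\<lambda>t. (1 - cos (a * t)) / t\<^sup>2)"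
    unfolding eq using lborel_integrable_real_affine[OF fejer_integrable, of a 0] by (cases "a = 0") auto
  show "(\<integral>t. (1 - cos (a * t)) / t\<^sup>2 \<partial>lborel) = \<bar>a\<bar> * fejer_mass"
  proof (cases "a = 0")
    case False
    have "fejer_mass = \<bar>a\<bar> * (\<integral>t. fejer (0 + a * t) \<partial>lborel)"
      unfolding fejer_mass_def using lborel_integral_real_affine[OF False, of fejer 0] by simp
    then have "\<bar>a\<bar> * fejer_mass = a\<^sup>2 * (\<integral>t. fejer (0 + a * t) \<partial>lborel)"
      by (metis abs_mult_self_eq mult.assoc power2_eq_square)
    then show ?thesis unfolding eq by simp
  qed simp
qed

lemma fejer_fourier:
  "(\<integral>t. fejer t * cis (t * \<mu>) \<partial>lborel) = complex_of_real (fejer_mass * triangle \<mu>)"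
proof -
  have int: "integrable lborel (\<lambda>t. complex_of_real (fejer t) * cis (t * \<mu>))"
    using fejer_integrable by (intro integrable_mult_cis) auto
  let ?c = "\<lambda>a t. (1 - cos (a * t)) / t\<^sup>2"
  \<comment> \<open>Kept abstract in A, B, C, D so that the point t = 0, where the denominator
    vanishes and every quotient is 0, is covered as well.\<close>
  have split: "((1/2 * (1 - A) + 1/2 * (1 - B)) - (1 - C)) / D
    = (1/2 * ((1 - A) / D) + 1/2 * ((1 - B) / D)) - (1 - C) / D" for A B C D :: real
    by (cases "D = 0") (simp_all add: field_simps)
  have "Re (\<integral>t. fejer t * cis (t * \<mu>) \<partial>lborel) = (\<integral>t. fejer t * cos (t * \<mu>) \<partial>lborel)"
    using integral_Re[OF int] by simp
  also have "(\<lambda>t. fejer t * cos (t * \<mu>)) = (\<lambda>t. (1/2 * ?c (\<mu> + 1) t + 1/2 * ?c (\<mu> - 1) t) - ?c \<mu> t)"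
  proof
    fix t
    have "2 * (cos t * cos (\<mu> * t)) = cos ((\<mu> + 1) * t) + cos ((\<mu> - 1) * t)"
      by (simp add: distrib_right left_diff_distrib cos_add cos_diff)
    then have "(1 - cos t) * cos (\<mu> * t)
      = (1/2 * (1 - cos ((\<mu> + 1) * t)) + 1/2 * (1 - cos ((\<mu> - 1) * t))) - (1 - cos (\<mu> * t))"
      by (simp add: algebra_simps)
    moreover have "fejer t * cos (t * \<mu>) = (1 - cos t) * cos (\<mu> * t) / t\<^sup>2"
      by (simp add: fejer_def mult.commute)
    ultimately have "fejer t * cos (t * \<mu>)
      = ((1/2 * (1 - cos ((\<mu> + 1) * t)) + 1/2 * (1 - cos ((\<mu> - 1) * t))) - (1 - cos (\<mu> * t))) / t\<^sup>2"
      by simp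
    then show "fejer t * cos (t * \<mu>) = (1/2 * ?c (\<mu> + 1) t + 1/2 * ?c (\<mu> - 1) t) - ?c \<mu> t"
      by (simp only: split)
  qed
  also have "(\<integral>t. (1/2 * ?c (\<mu> + 1) t + 1/2 * ?c (\<mu> - 1) t) - ?c \<mu> t \<partial>lborel)
      = 1/2 * (\<bar>\<mu> + 1\<bar> * fejer_mass) + 1/2 * (\<bar>\<mu> - 1\<bar> * fejer_mass) - \<bar>\<mu>\<bar> * fejer_mass"
    by (simp only: Bochner_Integration.integral_diff Bochner_Integration.integral_add fejer_dilate
        Bochner_Integration.integrable_add Bochner_Integration.integrable_mult_right
        integral_mult_right_zero simp_thms)
  also have "\<dots> = fejer_mass * triangle \<mu>"
    by (simp add: triangle_def algebra_simps)
  finally have Re: "Re (\<integral>t. fejer t * cis (t * \<mu>) \<partial>lborel) = fejer_mass * triangle \<mu>" .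
  have "Im (\<integral>t. fejer t * cis (t * \<mu>) \<partial>lborel) = (\<integral>t. fejer t * sin (t * \<mu>) \<partial>lborel)"
    using integral_Im[OF int] by simp
  \<comment> \<open>The integrand is odd: reflection in t shows that the integral equals its own
    negative.\<close>
  also have "\<dots> = 0"
    using lborel_integral_real_affine[of "-1" "\<lambda>t. fejer t * sin (t * \<mu>)" 0] by (simp add: fejer_def)
  finally show ?thesis using Re by (simp add: complex_eq_iff)
qed

lemma triangle_nonneg: "0 \<le> triangle \<mu>"
  and triangle_le_1: "triangle \<mu> \<le> 1"
  and triangle_support: "1 \<le> \<bar>\<mu>\<bar> \<Longrightarrow> triangle \<mu> = 0"
  by (auto simp: triangle_def abs_if split: if_splits)

lemma triangle_measurable [measurable]: "triangle \<in> borel_measurable borel"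
  unfolding triangle_def by measurable


text \<open>Weight the x-integral by \<open>fejer (\<epsilon> * x)\<close>. Its Fourier transform is
  supported in a band of width comparable to epsilon and has height at most
  \<open>fejer_mass / \<epsilon>\<close>, so as a kernel in (xi, eta) it has mass at most
  \<open>2 * fejer_mass\<close> in each variable, uniformly in epsilon. Schur's test gives 4,
  passing from the weight to the window |x| <= 1/epsilon gives 3, and epsilon -> 0 recovers the
  whole line.\<close>

lemma plancherel_real_le:
  fixes H :: "real \<Rightarrow> complex"
  assumes [measurable]: "H \<in> borel_measurable borel" and \<kappa>: "1 \<le> \<bar>\<kappa>\<bar>"
  shows "(\<integral>\<^sup>+x. ennreal ((cmod (\<integral>\<xi>. H \<xi> * cis (x * (\<kappa> * \<xi>)) \<partial>lborel))\<^sup>2) \<partial>lborel)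
    \<le> ennreal (12 * fejer_mass) * (\<integral>\<^sup>+\<xi>. ennreal ((cmod (H \<xi>))\<^sup>2) \<partial>lborel)"
proof (cases "integrable lborel H")
  case False
  \<comment> \<open>Multiplying by a unimodular factor does not affect integrability, so for such H
    every integral on the left takes its default value 0.\<close>
  have "\<not> integrable lborel (\<lambda>\<xi>. H \<xi> * cis (x * (\<kappa> * \<xi>)))" for x
  proof
    assume "integrable lborel (\<lambda>\<xi>. H \<xi> * cis (x * (\<kappa> * \<xi>)))"
    then have "integrable lborel (\<lambda>\<xi>. H \<xi> * cis (x * (\<kappa> * \<xi>)) * cis (- (x * (\<kappa> * \<xi>))))"
      by (rule integrable_mult_cis) measurable
    then show False using False by (simp add: mult.assoc cis_mult)
  qed
  then show ?thesis by (simp add: not_integrable_integral_eq)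
next
  case True
  define \<Phi> where "\<Phi> x = (\<integral>\<xi>. H \<xi> * cis (x * (\<kappa> * \<xi>)) \<partial>lborel)" for x
  define E where "E = (\<integral>\<^sup>+\<xi>. ennreal ((cmod (H \<xi>))\<^sup>2) \<partial>lborel)"
  have [measurable]: "\<Phi> \<in> borel_measurable borel" unfolding \<Phi>_def by measurable
  have trunc: "(\<integral>\<^sup>+x. ennreal ((cmod (\<Phi> x))\<^sup>2) * indicator {-1/\<epsilon>..1/\<epsilon>} x \<partial>lborel) \<le> ennreal (12 * fejer_mass) * E"
    if \<epsilon>: "0 < \<epsilon>" for \<epsilon>
  proof -
    have w_int: "integrable lborel (\<lambda>x. fejer (\<epsilon> * x))"
      using lborel_integrable_real_affine[OF fejer_integrable, of \<epsilon> 0] \<epsilon> by simp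
    have w_hat: "(\<integral>t. fejer (\<epsilon> * t) * cis (t * \<mu>) \<partial>lborel) = complex_of_real (fejer_mass * triangle (\<mu> / \<epsilon>) / \<epsilon>)" for \<mu>
    proof -
      have "complex_of_real (fejer_mass * triangle (\<mu> / \<epsilon>)) = (\<integral>t. fejer t * cis (t * (\<mu> / \<epsilon>)) \<partial>lborel)"
        by (rule fejer_fourier[symmetric])
      also have "\<dots> = \<epsilon> *\<^sub>R (\<integral>t. fejer (\<epsilon> * t) * cis (t * \<mu>) \<partial>lborel)"
        using lborel_integral_real_affine[of \<epsilon> "\<lambda>t. complex_of_real (fejer t) * cis (t * (\<mu> / \<epsilon>))" 0] \<epsilon> by simp
      finally have "(\<integral>t. fejer (\<epsilon> * t) * cis (t * \<mu>) \<partial>lborel) = (1/\<epsilon>) *\<^sub>R complex_of_real (fejer_mass * triangle (\<mu> / \<epsilon>))"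
        using \<epsilon> by simp
      then show ?thesis by (simp add: scaleR_conv_of_real)
    qed
    \<comment> \<open>A box majorant of the Fourier transform of the weight: it keeps only the
      height and the support of \<open>triangle\<close>, and it is symmetric in xi and eta.\<close>
    define K where "K \<xi> \<eta> = ennreal (fejer_mass / \<epsilon>) * indicator {\<eta> - \<epsilon>..\<eta> + \<epsilon>} \<xi>" for \<xi> \<eta> :: real
    have K_eq: "K \<xi> \<eta> = ennreal (fejer_mass / \<epsilon>) * indicator {\<xi> - \<epsilon>..\<xi> + \<epsilon>} \<eta>" for \<xi> \<eta>
      by (auto simp: K_def indicator_def)
    have K_meas [measurable]: "case_prod K \<in> borel_measurable (borel \<Otimes>\<^sub>M borel)"
    proof -
      have "case_prod K = (\<lambda>(\<xi>, \<eta>). if \<eta> - \<epsilon> \<le> \<xi> \<and> \<xi> \<le> \<eta> + \<epsilon> then ennreal (fejer_mass / \<epsilon>) else 0)"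
        by (auto simp: K_def fun_eq_iff indicator_def)
      then show ?thesis by simp
    qed
    have K_mass: "(\<integral>\<^sup>+\<eta>. K \<xi> \<eta> \<partial>lborel) = ennreal (2 * fejer_mass)" for \<xi>
      unfolding K_eq using \<epsilon> fejer_mass_nonneg
      by (simp add: nn_integral_cmult_indicator ennreal_mult[symmetric])
    have K_mass': "(\<integral>\<^sup>+\<xi>. K \<xi> \<eta> \<partial>lborel) = ennreal (2 * fejer_mass)" for \<eta>
      unfolding K_def using \<epsilon> fejer_mass_nonneg
      by (simp add: nn_integral_cmult_indicator ennreal_mult[symmetric])
    have "(\<integral>\<^sup>+x. ennreal (fejer (\<epsilon> * x) * (cmod (\<Phi> x))\<^sup>2) \<partial>lborel)
      \<le> (\<integral>\<^sup>+\<xi>. \<integral>\<^sup>+\<eta>. ennreal (cmod (H \<xi>) * cmod (H \<eta>) *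
          cmod (\<integral>t. fejer (\<epsilon> * t) * cis (t * (\<kappa> * \<xi> - \<kappa> * \<eta>)) \<partial>lborel)) \<partial>lborel \<partial>lborel)"
      unfolding \<Phi>_def
      by (rule weighted_L2_oscillatory[OF lborel.sigma_finite_measure_axioms True _ w_int]) (auto simp: fejer_nonneg)
    also have "\<dots> \<le> (\<integral>\<^sup>+\<xi>. \<integral>\<^sup>+\<eta>. ennreal ((cmod (H \<xi>))\<^sup>2) * K \<xi> \<eta> + ennreal ((cmod (H \<eta>))\<^sup>2) * K \<xi> \<eta> \<partial>lborel \<partial>lborel)"
    proof (intro nn_integral_mono)
      fix \<xi> \<eta> :: real
      let ?m = "cmod (\<integral>t. fejer (\<epsilon> * t) * cis (t * (\<kappa> * \<xi> - \<kappa> * \<eta>)) \<partial>lborel)"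
      have "ennreal ?m \<le> K \<xi> \<eta>"
      proof (cases "\<xi> \<in> {\<eta> - \<epsilon>..\<eta> + \<epsilon>}")
        case True
        have "?m \<le> fejer_mass / \<epsilon>"
          unfolding w_hat norm_of_real using \<epsilon> fejer_mass_nonneg triangle_nonneg triangle_le_1
          by (auto simp: abs_mult abs_of_nonneg intro!: divide_right_mono mult_left_le)
        then show ?thesis using True by (simp add: K_def ennreal_leI)
      next
        case False
        then have "\<epsilon> < \<bar>\<xi> - \<eta>\<bar>" by auto
        \<comment> \<open>Since |kappa| >= 1, the dilation only pushes separated frequencies further
          apart, so the band in xi - eta is no wider than epsilon on either side.\<close>
        also have "\<dots> \<le> \<bar>\<kappa>\<bar> * \<bar>\<xi> - \<eta>\<bar>" using \<kappa> mult_right_mono[of 1 "\<bar>\<kappa>\<bar>" "\<bar>\<xi> - \<eta>\<bar>"] by simp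
        also have "\<dots> = \<bar>\<kappa> * \<xi> - \<kappa> * \<eta>\<bar>" by (simp add: abs_mult[symmetric] right_diff_distrib)
        finally have "1 \<le> \<bar>(\<kappa> * \<xi> - \<kappa> * \<eta>) / \<epsilon>\<bar>" using \<epsilon> by simp
        then show ?thesis unfolding w_hat by (simp add: triangle_support)
      qed
      then have "ennreal (cmod (H \<xi>) * cmod (H \<eta>) * ?m) \<le> ennreal (cmod (H \<xi>)) * ennreal (cmod (H \<eta>)) * K \<xi> \<eta>"
        by (simp add: ennreal_mult mult_left_mono)
      also have "\<dots> \<le> ((ennreal (cmod (H \<xi>)))\<^sup>2 + (ennreal (cmod (H \<eta>)))\<^sup>2) * K \<xi> \<eta>"
        by (intro mult_right_mono ennreal_mult_le_squares) simp
      finally show "ennreal (cmod (H \<xi>) * cmod (H \<eta>) * ?m)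
        \<le> ennreal ((cmod (H \<xi>))\<^sup>2) * K \<xi> \<eta> + ennreal ((cmod (H \<eta>))\<^sup>2) * K \<xi> \<eta>"
        by (simp add: ennreal_power distrib_right)
    qed
    also have "\<dots> = (\<integral>\<^sup>+\<xi>. \<integral>\<^sup>+\<eta>. ennreal ((cmod (H \<xi>))\<^sup>2) * K \<xi> \<eta> \<partial>lborel \<partial>lborel)
        + (\<integral>\<^sup>+\<xi>. \<integral>\<^sup>+\<eta>. ennreal ((cmod (H \<eta>))\<^sup>2) * K \<xi> \<eta> \<partial>lborel \<partial>lborel)"
      by (subst nn_integral_add[symmetric]; (measurable)?) (intro nn_integral_cong nn_integral_add; measurable)
    also have "(\<integral>\<^sup>+\<xi>. \<integral>\<^sup>+\<eta>. ennreal ((cmod (H \<eta>))\<^sup>2) * K \<xi> \<eta> \<partial>lborel \<partial>lborel)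
        = (\<integral>\<^sup>+\<eta>. \<integral>\<^sup>+\<xi>. ennreal ((cmod (H \<eta>))\<^sup>2) * K \<xi> \<eta> \<partial>lborel \<partial>lborel)"
      by (rule lborel_pair.Fubini') measurable
    also have "\<dots> = E * ennreal (2 * fejer_mass)"
      by (simp add: nn_integral_cmult K_mass' nn_integral_multc E_def)
    also have "(\<integral>\<^sup>+\<xi>. \<integral>\<^sup>+\<eta>. ennreal ((cmod (H \<xi>))\<^sup>2) * K \<xi> \<eta> \<partial>lborel \<partial>lborel) = E * ennreal (2 * fejer_mass)"
      by (simp add: nn_integral_cmult K_mass nn_integral_multc E_def)
    also have "E * ennreal (2 * fejer_mass) + E * ennreal (2 * fejer_mass) = ennreal (4 * fejer_mass) * E"
      using fejer_mass_nonneg by (simp add: distrib_left[symmetric] ennreal_plus[symmetric] mult.commute del: ennreal_plus)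
    finally have weighted: "(\<integral>\<^sup>+x. ennreal (fejer (\<epsilon> * x) * (cmod (\<Phi> x))\<^sup>2) \<partial>lborel) \<le> ennreal (4 * fejer_mass) * E" .
    have "(\<integral>\<^sup>+x. ennreal ((cmod (\<Phi> x))\<^sup>2) * indicator {-1/\<epsilon>..1/\<epsilon>} x \<partial>lborel)
      \<le> (\<integral>\<^sup>+x. 3 * ennreal (fejer (\<epsilon> * x) * (cmod (\<Phi> x))\<^sup>2) \<partial>lborel)"
    proof (rule nn_integral_mono_AE, rule AE_mp[OF AE_lborel_singleton[of 0]], intro AE_I2 impI)
      fix x :: real assume "x \<noteq> 0"
      show "ennreal ((cmod (\<Phi> x))\<^sup>2) * indicator {-1/\<epsilon>..1/\<epsilon>} x \<le> 3 * ennreal (fejer (\<epsilon> * x) * (cmod (\<Phi> x))\<^sup>2)"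
      proof (cases "x \<in> {-1/\<epsilon>..1/\<epsilon>}")
        case True
        then have "\<bar>\<epsilon> * x\<bar> \<le> 1" using \<epsilon> by (auto simp: field_simps abs_le_iff)
        then have "1/3 \<le> fejer (\<epsilon> * x)" using \<epsilon> \<open>x \<noteq> 0\<close> by (intro fejer_ge) auto
        then have "(cmod (\<Phi> x))\<^sup>2 \<le> 3 * (fejer (\<epsilon> * x) * (cmod (\<Phi> x))\<^sup>2)"
          using mult_right_mono[of "1/3" "fejer (\<epsilon> * x)" "(cmod (\<Phi> x))\<^sup>2"] by simp
        then show ?thesis using True by (simp add: ennreal_leI ennreal_mult[symmetric] fejer_nonneg flip: ennreal_numeral)
      qed simp
    qed
    also have "\<dots> \<le> 3 * (ennreal (4 * fejer_mass) * E)"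
      using weighted by (simp add: nn_integral_cmult mult_left_mono)
    also have "\<dots> = ennreal (12 * fejer_mass) * E"
      using fejer_mass_nonneg by (simp add: mult.assoc[symmetric] ennreal_mult[symmetric] flip: ennreal_numeral)
    finally show ?thesis .
  qed
  \<comment> \<open>Exhaustion by the windows [-(n + 1), n + 1], that is epsilon = 1/(n + 1), and
    monotone convergence.\<close>
  have "(\<integral>\<^sup>+x. ennreal ((cmod (\<Phi> x))\<^sup>2) \<partial>lborel)
    = (\<integral>\<^sup>+x. (SUP n. ennreal ((cmod (\<Phi> x))\<^sup>2) * indicator {-real (Suc n)..real (Suc n)} x) \<partial>lborel)"
  proof (intro nn_integral_cong antisym)
    fix x :: real
    obtain n where "\<bar>x\<bar> \<le> real n" using real_arch_simple by blast
    then have "x \<in> {-real (Suc n)..real (Suc n)}" by auto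
    then show "ennreal ((cmod (\<Phi> x))\<^sup>2) \<le> (SUP n. ennreal ((cmod (\<Phi> x))\<^sup>2) * indicator {-real (Suc n)..real (Suc n)} x)"
      by (intro SUP_upper2[of n]) auto
  qed (auto intro!: SUP_least simp: indicator_def)
  also have "\<dots> = (SUP n. \<integral>\<^sup>+x. ennreal ((cmod (\<Phi> x))\<^sup>2) * indicator {-real (Suc n)..real (Suc n)} x \<partial>lborel)"
    by (intro nn_integral_monotone_convergence_SUP)
      (auto simp: incseq_def le_fun_def indicator_def)
  also have "\<dots> \<le> ennreal (12 * fejer_mass) * E"
  proof (rule SUP_least)
    fix n
    show "(\<integral>\<^sup>+x. ennreal ((cmod (\<Phi> x))\<^sup>2) * indicator {-real (Suc n)..real (Suc n)} x \<partial>lborel) \<le> ennreal (12 * fejer_mass) * E"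
      using trunc[of "1 / real (Suc n)"] by simp
  qed
  finally show ?thesis unfolding \<Phi>_def E_def .
qed

section \<open>Parseval and Plancherel inequalities\<close>

lemma integral_cis_period:
  fixes k :: int
  shows "(\<integral>y. indicator {0..<1} y *\<^sub>R cis (2 * pi * real_of_int k * y) \<partial>lborel) = (if k = 0 then 1 else 0)"
proof (cases "k = 0")
  case True
  have "(\<integral>y. indicator {0..<1::real} y *\<^sub>R (1::complex) \<partial>lborel) = 1"
    by simp
  then show ?thesis using True by simp
next
  case False
  define c where "c = 2 * pi * real_of_int k"
  have c: "c \<noteq> 0" using False by (simp add: c_def)
  have deriv: "((\<lambda>y. - (\<i> / c) * cis (c * y)) has_vector_derivative cis (c * y)) (at y within {0..1})" for y :: real
  proof -
    have "((\<lambda>y. cis (c * y)) has_derivative (\<lambda>h. (c * h) *\<^sub>R (\<i> * cis (c * y)))) (at y within {0..1})"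
      by (intro derivative_intros)
    then have "((\<lambda>y. cis (c * y)) has_vector_derivative (c *\<^sub>R (\<i> * cis (c * y)))) (at y within {0..1})"
      by (simp add: has_vector_derivative_def mult.commute)
    from has_vector_derivative_mult_right[OF this, of "- (\<i> / c)"]
    show ?thesis using c by (simp add: scaleR_conv_of_real)
  qed
  have "(\<integral>y. indicator {0..<1} y *\<^sub>R cis (c * y) \<partial>lborel) = (\<integral>y. indicator {0..1} y *\<^sub>R cis (c * y) \<partial>lborel)"
  proof (rule integral_cong_AE)
    show "AE y in lborel. indicator {0..<1} y *\<^sub>R cis (c * y) = indicator {0..1} y *\<^sub>R cis (c * y)"
      by (rule AE_mp[OF AE_lborel_singleton[of 1]]) (auto simp: indicator_def)
  qed measurable
  also have "\<dots> = - (\<i> / c) * cis (c * 1) - (- (\<i> / c) * cis (c * 0))"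
    by (rule integral_FTC_atLeastAtMost[OF zero_le_one deriv]) (intro continuous_intros)
  also have "cis (c * 1) = 1"
    by (simp add: c_def) 
  finally show ?thesis using False by (simp add: c_def)
qed

lemma parseval_trig_poly:
  fixes a :: "int \<Rightarrow> complex"
  assumes K: "finite K"
  shows "(\<integral>\<^sup>+y. ennreal ((cmod (\<Sum>k\<in>K. a k * cis (2 * pi * real_of_int k * y)))\<^sup>2) * indicator {0..<1} y \<partial>lborel)
    = ennreal (\<Sum>k\<in>K. (cmod (a k))\<^sup>2)"
proof -
  define P where "P y = (\<Sum>k\<in>K. a k * cis (2 * pi * real_of_int k * y))" for y
  define e where "e k y = indicator {0..<1} y *\<^sub>R cis (2 * pi * real_of_int k * y)" for k :: int and y :: real
  have e_int: "integrable lborel (e k)" for k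
  proof -
    have "integrable lborel (\<lambda>y. complex_of_real (indicator {0..<1::real} y) * cis (2 * pi * real_of_int k * y))"
      by (intro integrable_mult_cis) auto
    then show ?thesis by (simp add: e_def[abs_def] scaleR_conv_of_real)
  qed
  have P_meas [measurable]: "P \<in> borel_measurable borel" unfolding P_def by measurable
  have expand: "complex_of_real (indicator {0..<1} y * (cmod (P y))\<^sup>2) = (\<Sum>k\<in>K. \<Sum>l\<in>K. a k * cnj (a l) * e (k - l) y)" for y
  proof -
    have "complex_of_real ((cmod (P y))\<^sup>2) = (\<Sum>k\<in>K. \<Sum>l\<in>K. (a k * cis (2 * pi * real_of_int k * y)) * cnj (a l * cis (2 * pi * real_of_int l * y)))"
      unfolding P_def complex_norm_square sum_product cnj_sum ..
    also have "\<dots> = (\<Sum>k\<in>K. \<Sum>l\<in>K. a k * cnj (a l) * cis (2 * pi * real_of_int (k - l) * y))"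
    proof (intro sum.cong refl)
      fix k l
      have "cis (2 * pi * real_of_int (k - l) * y) = cis (2 * pi * real_of_int k * y) * cnj (cis (2 * pi * real_of_int l * y))"
        by (simp add: cis_cnj cis_mult algebra_simps)
      then show "(a k * cis (2 * pi * real_of_int k * y)) * cnj (a l * cis (2 * pi * real_of_int l * y))
        = a k * cnj (a l) * cis (2 * pi * real_of_int (k - l) * y)" by simp
    qed
    finally have "complex_of_real ((cmod (P y))\<^sup>2) = (\<Sum>k\<in>K. \<Sum>l\<in>K. a k * cnj (a l) * cis (2 * pi * real_of_int (k - l) * y))" .
    then show ?thesis
      by (cases "y \<in> {0..<1}") (simp_all add: e_def)
  qed
  have int: "integrable lborel (\<lambda>y. indicator {0..<1} y * (cmod (P y))\<^sup>2)"
  proof -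
    have "integrable lborel (\<lambda>y. \<Sum>k\<in>K. \<Sum>l\<in>K. a k * cnj (a l) * e (k - l) y)"
      using e_int by auto
    then have "integrable lborel (\<lambda>y. complex_of_real (indicator {0..<1} y * (cmod (P y))\<^sup>2))"
      by (simp only: expand)
    from integrable_Re[OF this] show ?thesis by simp
  qed
  have "complex_of_real (\<integral>y. indicator {0..<1} y * (cmod (P y))\<^sup>2 \<partial>lborel)
    = (\<integral>y. (\<Sum>k\<in>K. \<Sum>l\<in>K. a k * cnj (a l) * e (k - l) y) \<partial>lborel)"
    by (simp only: integral_complex_of_real[symmetric] expand)
  also have "\<dots> = (\<Sum>k\<in>K. \<Sum>l\<in>K. a k * cnj (a l) * (if k - l = 0 then 1 else 0))"
    using e_int unfolding integral_cis_period[symmetric] e_def[symmetric]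
    by (simp add: Bochner_Integration.integral_sum)
  also have "\<dots> = (\<Sum>k\<in>K. a k * cnj (a k))"
    using K by (intro sum.cong refl) (simp add: if_distrib[of "\<lambda>x. _ * x"] cong: if_cong)
  also have "\<dots> = complex_of_real (\<Sum>k\<in>K. (cmod (a k))\<^sup>2)"
    by (simp add: complex_norm_square del: of_real_power)
  finally have eq: "(\<integral>y. indicator {0..<1} y * (cmod (P y))\<^sup>2 \<partial>lborel) = (\<Sum>k\<in>K. (cmod (a k))\<^sup>2)"
    by (simp only: of_real_eq_iff)
  have "(\<integral>\<^sup>+y. ennreal ((cmod (P y))\<^sup>2) * indicator {0..<1} y \<partial>lborel) = (\<integral>\<^sup>+y. ennreal (indicator {0..<1} y * (cmod (P y))\<^sup>2) \<partial>lborel)"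
    by (intro nn_integral_cong) (auto simp: indicator_def)
  also have "\<dots> = ennreal (\<integral>y. indicator {0..<1} y * (cmod (P y))\<^sup>2 \<partial>lborel)"
    using int by (intro nn_integral_eq_integral) auto
  also note eq
  finally show ?thesis unfolding P_def .
qed

text \<open>Pair v with the partial Fourier sum P. The pairing equals S, and P has squared norm S by
  Parseval, so Cauchy-Schwarz reads S^2 <= ||v||^2 S. Finiteness of K makes S finite, so that it may
  be cancelled.\<close>

lemma bessel_periodic:
  fixes v :: "real \<Rightarrow> complex"
  assumes v: "integrable lborel v" and supp: "\<And>y. y \<notin> {0..<1} \<Longrightarrow> v y = 0" and K: "finite (K :: int set)"
  shows "ennreal (\<Sum>k\<in>K. (cmod (\<integral>y. v y * cis (- (2 * pi * real_of_int k * y)) \<partial>lborel))\<^sup>2)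
    \<le> (\<integral>\<^sup>+y. ennreal ((cmod (v y))\<^sup>2) \<partial>lborel)"
proof -
  note [measurable] = borel_measurable_integrable[OF v]
  define a where "a k = (\<integral>y. v y * cis (- (2 * pi * real_of_int k * y)) \<partial>lborel)" for k :: int
  define P where "P y = (\<Sum>k\<in>K. a k * cis (2 * pi * real_of_int k * y))" for y
  define S where "S = (\<Sum>k\<in>K. (cmod (a k))\<^sup>2)"
  have S: "0 \<le> S" by (simp add: S_def sum_nonneg)
  have [measurable]: "P \<in> borel_measurable borel" unfolding P_def by measurable
  have term_int: "integrable lborel (\<lambda>y. v y * cis (- (2 * pi * real_of_int k * y)))" for k :: int
    using v by (intro integrable_mult_cis) auto
  have expand: "v y * cnj (P y) = (\<Sum>k\<in>K. cnj (a k) * (v y * cis (- (2 * pi * real_of_int k * y))))" for y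
    by (simp add: P_def sum_distrib_left cis_cnj mult_ac)
  have int: "integrable lborel (\<lambda>y. v y * cnj (P y))"
    unfolding expand using term_int by (intro Bochner_Integration.integrable_sum integrable_mult_right) auto
  have "(\<integral>y. v y * cnj (P y) \<partial>lborel) = (\<Sum>k\<in>K. cnj (a k) * a k)"
    unfolding expand a_def using term_int by (subst Bochner_Integration.integral_sum) auto
  also have "\<dots> = complex_of_real S"
    by (simp add: S_def complex_norm_square mult.commute del: of_real_power)
  finally have "ennreal S = ennreal (cmod (\<integral>y. v y * cnj (P y) \<partial>lborel))"
    using S by simp
  also have "\<dots> \<le> (\<integral>\<^sup>+y. ennreal (cmod (v y * cnj (P y))) \<partial>lborel)"
    by (rule integral_norm_bound_ennreal[OF int])
  also have "\<dots> = (\<integral>\<^sup>+y. ennreal (cmod (v y)) * ennreal (cmod (P y) * indicator {0..<1} y) \<partial>lborel)"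
    using supp by (intro nn_integral_cong) (auto simp: norm_mult ennreal_mult indicator_def)
  finally have "(ennreal S)\<^sup>2 \<le> (\<integral>\<^sup>+y. ennreal (cmod (v y)) * ennreal (cmod (P y) * indicator {0..<1} y) \<partial>lborel)\<^sup>2"
    by (rule power_mono) simp
  also have "\<dots> \<le> (\<integral>\<^sup>+y. (ennreal (cmod (v y)))\<^sup>2 \<partial>lborel) * (\<integral>\<^sup>+y. (ennreal (cmod (P y) * indicator {0..<1} y))\<^sup>2 \<partial>lborel)"
    by (rule Cauchy_Schwarz_nn_integral) measurable
  also have "(\<integral>\<^sup>+y. (ennreal (cmod (P y) * indicator {0..<1} y))\<^sup>2 \<partial>lborel)
      = (\<integral>\<^sup>+y. ennreal ((cmod (P y))\<^sup>2) * indicator {0..<1} y \<partial>lborel)"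
    by (intro nn_integral_cong) (auto simp: indicator_def ennreal_power)
  also have "\<dots> = ennreal S"
    unfolding P_def S_def by (rule parseval_trig_poly[OF K])
  finally have le: "ennreal S * ennreal S \<le> (\<integral>\<^sup>+y. (ennreal (cmod (v y)))\<^sup>2 \<partial>lborel) * ennreal S"
    by (simp only: power2_eq_square)
  have "ennreal S \<le> (\<integral>\<^sup>+y. (ennreal (cmod (v y)))\<^sup>2 \<partial>lborel)"
  proof (cases "S = 0")
    case False
    then have "ennreal S \<noteq> 0" "ennreal S \<noteq> top" using S by auto
    then show ?thesis using le by (simp add: mult.commute ennreal_mult_le_mult_iff)
  qed simp
  then show ?thesis unfolding S_def a_def by (simp add: ennreal_power)
qed

lemma integral_freq_finite:
  fixes f :: "real \<times> int \<Rightarrow> complex"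
  assumes f: "integrable freq f" and K: "finite K" and supp: "\<And>\<xi> k. k \<notin> K \<Longrightarrow> f (\<xi>, k) = 0"
  shows "(\<integral>\<zeta>. f \<zeta> \<partial>freq) = (\<Sum>k\<in>K. \<integral>\<xi>. f (\<xi>, k) \<partial>lborel)"
proof -
  have "(\<integral>\<zeta>. f \<zeta> \<partial>freq) = (\<integral>k. (\<integral>\<xi>. f (\<xi>, k) \<partial>lborel) \<partial>count_space UNIV)"
    using line_int.integral_snd[of "\<lambda>\<xi> k. f (\<xi>, k)"] f by (simp add: freq_def)
  also have "\<dots> = (\<Sum>k | k \<in> UNIV \<and> (\<integral>\<xi>. f (\<xi>, k) \<partial>lborel) \<noteq> 0. \<integral>\<xi>. f (\<xi>, k) \<partial>lborel)"
    using supp by (intro lebesgue_integral_count_space_finite_support finite_subset[OF _ K]) force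
  also have "\<dots> = (\<Sum>k\<in>K. \<integral>\<xi>. f (\<xi>, k) \<partial>lborel)"
    using supp K by (intro sum.mono_neutral_left) force+
  finally show ?thesis .
qed

lemma nn_integral_freq_finite:
  assumes [measurable]: "f \<in> borel_measurable freq" and K: "finite K" and supp: "\<And>\<xi> k. k \<notin> K \<Longrightarrow> f (\<xi>, k) = 0"
  shows "(\<integral>\<^sup>+\<zeta>. f \<zeta> \<partial>freq) = (\<Sum>k\<in>K. \<integral>\<^sup>+\<xi>. f (\<xi>, k) \<partial>lborel)"
  unfolding nn_integral_freq_int_first[OF assms(1)] using K supp by (intro nn_integral_count_space') auto

lemma nn_integral_Mdom:
  assumes "f \<in> borel_measurable borel"
  shows "(\<integral>\<^sup>+z. f z * indicator Mdom z \<partial>lborel) = (\<integral>\<^sup>+x. \<integral>\<^sup>+y. f (x, y) * indicator {0..<1} y \<partial>lborel \<partial>lborel)"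
proof -
  have [measurable]: "f \<in> borel_measurable (borel \<Otimes>\<^sub>M borel)" using assms by (simp add: borel_prod)
  have "(\<integral>\<^sup>+z. f z * indicator Mdom z \<partial>lborel) = (\<integral>\<^sup>+z. f z * indicator {0..<1} (snd z) \<partial>(lborel \<Otimes>\<^sub>M lborel))"
    unfolding lborel_prod by (intro nn_integral_cong) (auto simp: Mdom_def indicator_def)
  also have "\<dots> = (\<integral>\<^sup>+x. \<integral>\<^sup>+y. f (x, y) * indicator {0..<1} y \<partial>lborel \<partial>lborel)"
    by (subst lborel.nn_integral_fst[symmetric]) auto
  finally show ?thesis .
qed

text \<open>For fixed x, Parseval in y is exact and leaves the coefficients \<open>b m x\<close>.
  These are Fourier integrals on the line with kappa = 2 pi, so the constant is lost only in
  x.\<close>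

lemma plancherel_freq_le:
  fixes H :: "real \<times> int \<Rightarrow> complex"
  assumes H: "integrable freq H" and K: "finite K" and supp: "\<And>a m. m \<notin> K \<Longrightarrow> H (a, m) = 0"
  shows "(\<integral>\<^sup>+z. ennreal ((cmod (\<integral>\<alpha>. H \<alpha> * cis (2 * pi * (fst \<alpha> * fst z + real_of_int (snd \<alpha>) * snd z)) \<partial>freq))\<^sup>2) * indicator Mdom z \<partial>lborel)
    \<le> ennreal (12 * fejer_mass) * (\<integral>\<^sup>+\<alpha>. ennreal ((cmod (H \<alpha>))\<^sup>2) \<partial>freq)"
proof -
  note [measurable] = borel_measurable_integrable[OF H]
  define u where "u z = (\<integral>\<alpha>. H \<alpha> * cis (2 * pi * (fst \<alpha> * fst z + real_of_int (snd \<alpha>) * snd z)) \<partial>freq)" for z :: "real \<times> real"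
  define b where "b m x = (\<integral>a. H (a, m) * cis (x * (2 * pi * a)) \<partial>lborel)" for m x
  have [measurable]: "b m \<in> borel_measurable borel" for m unfolding b_def by measurable
  have u_meas [measurable]: "u \<in> borel_measurable borel"
    unfolding borel_prod[symmetric] u_def by measurable
  have u_eq: "u (x, y) = (\<Sum>m\<in>K. b m x * cis (2 * pi * real_of_int m * y))" for x y
  proof -
    have "u (x, y) = (\<Sum>m\<in>K. \<integral>a. H (a, m) * cis (2 * pi * (a * x + m * y)) \<partial>lborel)"
      unfolding u_def using supp by (subst integral_freq_finite[OF _ K]) (auto intro!: integrable_mult_cis H)
    also have "\<dots> = (\<Sum>m\<in>K. b m x * cis (2 * pi * real_of_int m * y))"
    proof (intro sum.cong refl)
      fix m
      have "H (a, m) * cis (2 * pi * (a * x + m * y)) = (H (a, m) * cis (x * (2 * pi * a))) * cis (2 * pi * real_of_int m * y)" for a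
        by (simp add: cis_mult algebra_simps)
      then show "(\<integral>a. H (a, m) * cis (2 * pi * (a * x + m * y)) \<partial>lborel) = b m x * cis (2 * pi * real_of_int m * y)"
        by (simp only: b_def integral_mult_left_zero)
    qed
    finally show ?thesis .
  qed
  have "(\<integral>\<^sup>+z. ennreal ((cmod (u z))\<^sup>2) * indicator Mdom z \<partial>lborel)
    = (\<integral>\<^sup>+x. \<integral>\<^sup>+y. ennreal ((cmod (u (x, y)))\<^sup>2) * indicator {0..<1} y \<partial>lborel \<partial>lborel)"
    by (rule nn_integral_Mdom) measurable
  also have "\<dots> = (\<integral>\<^sup>+x. (\<Sum>m\<in>K. ennreal ((cmod (b m x))\<^sup>2)) \<partial>lborel)"
    unfolding u_eq parseval_trig_poly[OF K] by (simp add: sum_ennreal)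
  also have "\<dots> = (\<Sum>m\<in>K. \<integral>\<^sup>+x. ennreal ((cmod (b m x))\<^sup>2) \<partial>lborel)"
    by (rule nn_integral_sum) measurable
  also have "\<dots> \<le> (\<Sum>m\<in>K. ennreal (12 * fejer_mass) * (\<integral>\<^sup>+a. ennreal ((cmod (H (a, m)))\<^sup>2) \<partial>lborel))"
  proof (intro sum_mono)
    fix m
    show "(\<integral>\<^sup>+x. ennreal ((cmod (b m x))\<^sup>2) \<partial>lborel) \<le> ennreal (12 * fejer_mass) * (\<integral>\<^sup>+a. ennreal ((cmod (H (a, m)))\<^sup>2) \<partial>lborel)"
      unfolding b_def using pi_gt3 by (intro plancherel_real_le) auto
  qed
  also have "\<dots> = ennreal (12 * fejer_mass) * (\<integral>\<^sup>+\<alpha>. ennreal ((cmod (H \<alpha>))\<^sup>2) \<partial>freq)"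
    by (subst nn_integral_freq_finite[OF _ K]) (auto simp: supp sum_distrib_left)
  finally show ?thesis unfolding u_def .
qed

text \<open>Transform in x first. Bessel in y is applied for fixed xi, and then, for fixed y,
  \<open>plancherel_real_le\<close> with kappa = -2 pi and the roles of x and xi exchanged.
  Restricting k to a finite set is enough because the symbol vanishes for large k.\<close>

lemma bessel_freq:
  fixes v :: "real \<times> real \<Rightarrow> complex"
  assumes v: "integrable lborel v" and supp: "\<And>z. z \<notin> Mdom \<Longrightarrow> v z = 0" and K: "finite (K :: int set)"
  shows "(\<integral>\<^sup>+\<zeta>. ennreal ((cmod (\<integral>z. v z * cis (- (2 * pi * (fst \<zeta> * fst z + real_of_int (snd \<zeta>) * snd z))) \<partial>lborel))\<^sup>2) * indicator K (snd \<zeta>) \<partial>freq)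
    \<le> ennreal (12 * fejer_mass) * (\<integral>\<^sup>+z. ennreal ((cmod (v z))\<^sup>2) \<partial>lborel)"
proof -
  have [measurable]: "v \<in> borel_measurable (borel \<Otimes>\<^sub>M borel)"
    using borel_measurable_integrable[OF v] by (simp add: borel_prod)
  define F where "F \<zeta> = (\<integral>z. v z * cis (- (2 * pi * (fst \<zeta> * fst z + real_of_int (snd \<zeta>) * snd z))) \<partial>lborel)" for \<zeta> :: "real \<times> int"
  define V where "V \<xi> y = (\<integral>x. v (x, y) * cis (\<xi> * ((-2 * pi) * x)) \<partial>lborel)" for \<xi> y
  have [measurable]: "F \<in> borel_measurable freq"
    unfolding F_def lborel_prod[symmetric] by measurable
  have [measurable]: "case_prod V \<in> borel_measurable (borel \<Otimes>\<^sub>M borel)" unfolding V_def by measurable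
  have V_int: "integrable lborel (V \<xi>)"
    and F_eq: "F (\<xi>, k) = (\<integral>y. V \<xi> y * cis (- (2 * pi * real_of_int k * y)) \<partial>lborel)" for \<xi> k
  proof -
    have v': "integrable (lborel \<Otimes>\<^sub>M lborel) v" using v by (simp add: lborel_prod)
    have "integrable (lborel \<Otimes>\<^sub>M lborel) (\<lambda>p. v p * cis (\<xi> * ((-2 * pi) * fst p)))"
      by (rule integrable_mult_cis[OF v']) measurable
    then have "integrable (lborel \<Otimes>\<^sub>M lborel) (\<lambda>(x, y). v (x, y) * cis (\<xi> * ((-2 * pi) * x)))"
      by (simp add: case_prod_unfold)
    from lborel_pair.integrable_snd[OF this] show "integrable lborel (V \<xi>)" by (simp add: V_def[abs_def])
    have "integrable (lborel \<Otimes>\<^sub>M lborel) (\<lambda>p. v p * cis (- (2 * pi * (\<xi> * fst p + real_of_int k * snd p))))"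
      by (rule integrable_mult_cis[OF v']) measurable
    then have int: "integrable (lborel \<Otimes>\<^sub>M lborel) (\<lambda>(x, y). v (x, y) * cis (- (2 * pi * (\<xi> * x + real_of_int k * y))))"
      by (simp add: case_prod_unfold)
    have "F (\<xi>, k) = (\<integral>(x, y). v (x, y) * cis (- (2 * pi * (\<xi> * x + real_of_int k * y))) \<partial>(lborel \<Otimes>\<^sub>M lborel))"
      unfolding F_def lborel_prod by (simp add: case_prod_unfold)
    also have "\<dots> = (\<integral>y. \<integral>x. v (x, y) * cis (- (2 * pi * (\<xi> * x + real_of_int k * y))) \<partial>lborel \<partial>lborel)"
      by (rule lborel_pair.integral_snd[OF int, symmetric])
    also have "\<dots> = (\<integral>y. V \<xi> y * cis (- (2 * pi * real_of_int k * y)) \<partial>lborel)"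
    proof (intro Bochner_Integration.integral_cong refl)
      fix y
      have "v (x, y) * cis (- (2 * pi * (\<xi> * x + real_of_int k * y)))
        = (v (x, y) * cis (\<xi> * ((-2 * pi) * x))) * cis (- (2 * pi * real_of_int k * y))" for x
        by (simp add: cis_mult algebra_simps)
      then show "(\<integral>x. v (x, y) * cis (- (2 * pi * (\<xi> * x + real_of_int k * y))) \<partial>lborel)
        = V \<xi> y * cis (- (2 * pi * real_of_int k * y))" by (simp only: V_def integral_mult_left_zero)
    qed
    finally show "F (\<xi>, k) = (\<integral>y. V \<xi> y * cis (- (2 * pi * real_of_int k * y)) \<partial>lborel)" .
  qed
  have V_supp: "V \<xi> y = 0" if "y \<notin> {0..<1}" for \<xi> y
    using that supp by (simp add: V_def Mdom_def)
  have "(\<integral>\<^sup>+\<zeta>. ennreal ((cmod (F \<zeta>))\<^sup>2) * indicator K (snd \<zeta>) \<partial>freq)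
    = (\<integral>\<^sup>+\<xi>. \<integral>\<^sup>+k. ennreal ((cmod (F (\<xi>, k)))\<^sup>2) * indicator K k \<partial>count_space UNIV \<partial>lborel)"
    by (subst nn_integral_freq) auto
  also have "\<dots> = (\<integral>\<^sup>+\<xi>. ennreal (\<Sum>k\<in>K. (cmod (F (\<xi>, k)))\<^sup>2) \<partial>lborel)"
    using K by (intro nn_integral_cong) (subst nn_integral_count_space'[of K], auto simp: sum_ennreal)
  also have "\<dots> \<le> (\<integral>\<^sup>+\<xi>. \<integral>\<^sup>+y. ennreal ((cmod (V \<xi> y))\<^sup>2) \<partial>lborel \<partial>lborel)"
    unfolding F_eq by (intro nn_integral_mono bessel_periodic V_int V_supp K)
  also have "\<dots> = (\<integral>\<^sup>+y. \<integral>\<^sup>+\<xi>. ennreal ((cmod (V \<xi> y))\<^sup>2) \<partial>lborel \<partial>lborel)"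
    by (rule lborel_pair.Fubini'[symmetric]) measurable
  also have "\<dots> \<le> (\<integral>\<^sup>+y. ennreal (12 * fejer_mass) * (\<integral>\<^sup>+x. ennreal ((cmod (v (x, y)))\<^sup>2) \<partial>lborel) \<partial>lborel)"
    unfolding V_def using pi_gt3 by (intro nn_integral_mono plancherel_real_le) auto
  also have "\<dots> = ennreal (12 * fejer_mass) * (\<integral>\<^sup>+y. \<integral>\<^sup>+x. ennreal ((cmod (v (x, y)))\<^sup>2) \<partial>lborel \<partial>lborel)"
    by (rule nn_integral_cmult) measurable
  also have "(\<integral>\<^sup>+y. \<integral>\<^sup>+x. ennreal ((cmod (v (x, y)))\<^sup>2) \<partial>lborel \<partial>lborel) = (\<integral>\<^sup>+z. ennreal ((cmod (v z))\<^sup>2) \<partial>lborel)"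
    by (subst lborel_pair.nn_integral_snd) (measurable, simp add: lborel_prod)
  finally show ?thesis unfolding F_def .
qed

section \<open>Reduction to the quartic form\<close>

lemma distr_freq_shift: "distr freq freq (\<lambda>\<zeta>. \<zeta> + \<alpha>) = freq"
proof (rule measure_eqI)
  fix A assume "A \<in> sets (distr freq freq (\<lambda>\<zeta>. \<zeta> + \<alpha>))"
  then have A [measurable]: "A \<in> sets freq" by simp
  have "emeasure (distr freq freq (\<lambda>\<zeta>. \<zeta> + \<alpha>)) A = (\<integral>\<^sup>+\<zeta>. indicator A \<zeta> \<partial>distr freq freq (\<lambda>\<zeta>. \<zeta> + \<alpha>))"
    using A by simp
  also have "\<dots> = (\<integral>\<^sup>+\<zeta>. indicator A (\<zeta> + \<alpha>) \<partial>freq)"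
    by (rule nn_integral_distr) measurable
  also have "\<dots> = emeasure freq A"
    by (subst nn_integral_freq_shift) auto
  finally show "emeasure (distr freq freq (\<lambda>\<zeta>. \<zeta> + \<alpha>)) A = emeasure freq A" .
qed simp

lemma integral_freq_shift:
  fixes f :: "real \<times> int \<Rightarrow> complex"
  assumes [measurable]: "f \<in> borel_measurable freq"
  shows "(\<integral>\<zeta>. f (\<zeta> + \<alpha>) \<partial>freq) = (\<integral>\<zeta>. f \<zeta> \<partial>freq)"
proof -
  have "(\<integral>\<zeta>. f \<zeta> \<partial>distr freq freq (\<lambda>\<zeta>. \<zeta> + \<alpha>)) = (\<integral>\<zeta>. f (\<zeta> + \<alpha>) \<partial>freq)"
    by (rule integral_distr) measurable
  then show ?thesis by (simp add: distr_freq_shift)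
qed

text \<open>The conjugate of a character is its inverse, so in u times the conjugate of u the
  substitution zeta -> zeta + alpha leaves only the character at alpha. This exhibits |u|^2 as the
  transform of the autocorrelation of G.\<close>

lemma autocorrelation:
  fixes G :: "real \<times> int \<Rightarrow> complex"
  assumes G: "integrable freq G"
  shows "integrable freq (\<lambda>\<alpha>. \<integral>\<zeta>. G (\<zeta> + \<alpha>) * cnj (G \<zeta>) \<partial>freq)"
    and "complex_of_real ((cmod (\<integral>\<zeta>. G \<zeta> * cis (2 * pi * (fst \<zeta> * x + real_of_int (snd \<zeta>) * y)) \<partial>freq))\<^sup>2)
      = (\<integral>\<alpha>. (\<integral>\<zeta>. G (\<zeta> + \<alpha>) * cnj (G \<zeta>) \<partial>freq) * cis (2 * pi * (fst \<alpha> * x + real_of_int (snd \<alpha>) * y)) \<partial>freq)"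
proof -
  note [measurable] = borel_measurable_integrable[OF G]
  define e where "e \<zeta> = cis (2 * pi * (fst \<zeta> * x + real_of_int (snd \<zeta>) * y))" for \<zeta> :: "real \<times> int"
  have [measurable]: "e \<in> borel_measurable freq" unfolding e_def by measurable
  have e_add: "e (\<zeta> + \<alpha>) = e \<zeta> * e \<alpha>" for \<zeta> \<alpha>
    by (simp add: e_def cis_mult algebra_simps)
  have e_cnj: "e \<zeta> * cnj (e \<zeta>) = 1" for \<zeta> by (simp add: e_def cis_cnj cis_mult)
  \<comment> \<open>Absolute integrability on the product: the same shear as before turns the double
    integral into the square of the L1 norm of G.\<close>
  have "(\<integral>\<^sup>+p. ennreal (cmod (G (snd p + fst p) * cnj (G (snd p)))) \<partial>(freq \<Otimes>\<^sub>M freq))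
    = (\<integral>\<^sup>+\<alpha>. \<integral>\<^sup>+\<zeta>. ennreal (cmod (G \<zeta>)) * ennreal (cmod (G (\<zeta> + \<alpha>))) \<partial>freq \<partial>freq)"
    by (subst freq.nn_integral_fst[symmetric]) (measurable, simp add: norm_mult ennreal_mult mult.commute)
  also have "\<dots> = (\<integral>\<^sup>+\<zeta>. ennreal (cmod (G \<zeta>)) \<partial>freq) * (\<integral>\<^sup>+\<zeta>. ennreal (cmod (G \<zeta>)) \<partial>freq)"
    by (rule nn_integral_pair_shift) measurable
  also have "\<dots> < \<infinity>" using G by (simp add: integrable_iff_bounded ennreal_mult_less_top)
  finally have fin: "(\<integral>\<^sup>+p. ennreal (cmod (G (snd p + fst p) * cnj (G (snd p)))) \<partial>(freq \<Otimes>\<^sub>M freq)) < \<infinity>" .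
  have joint: "integrable (freq \<Otimes>\<^sub>M freq) (\<lambda>p. G (snd p + fst p) * cnj (G (snd p)))"
    by (rule integrableI_bounded[OF _ fin]) measurable
  then have joint': "integrable (freq \<Otimes>\<^sub>M freq) (\<lambda>(\<alpha>, \<zeta>). G (\<zeta> + \<alpha>) * cnj (G \<zeta>))"
    by (simp add: case_prod_unfold)
  from freq_freq.integrable_fst[OF joint']
  show "integrable freq (\<lambda>\<alpha>. \<integral>\<zeta>. G (\<zeta> + \<alpha>) * cnj (G \<zeta>) \<partial>freq)" .
  have joint_e: "integrable (freq \<Otimes>\<^sub>M freq) (\<lambda>(\<alpha>, \<zeta>). G (\<zeta> + \<alpha>) * cnj (G \<zeta>) * e \<alpha>)"
    using integrable_mult_cis[OF joint, of "\<lambda>p. 2 * pi * (fst (fst p) * x + real_of_int (snd (fst p)) * y)"]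
    by (simp add: case_prod_unfold e_def)
  define u where "u = (\<integral>\<zeta>. G \<zeta> * e \<zeta> \<partial>freq)"
  have "complex_of_real ((cmod u)\<^sup>2) = u * cnj u"
    by (rule complex_norm_square)
  also have "\<dots> = (\<integral>\<zeta>. u * cnj (G \<zeta> * e \<zeta>) \<partial>freq)"
    by (simp only: u_def integral_mult_right_zero Bochner_Integration.integral_cnj)
  also have "\<dots> = (\<integral>\<zeta>. (\<integral>\<alpha>. G (\<zeta> + \<alpha>) * cnj (G \<zeta>) * e \<alpha> \<partial>freq) \<partial>freq)"
  proof (intro Bochner_Integration.integral_cong refl)
    fix \<zeta>
    have "u = (\<integral>\<alpha>. G (\<alpha> + \<zeta>) * e (\<alpha> + \<zeta>) \<partial>freq)"
      unfolding u_def by (rule integral_freq_shift[symmetric]) measurable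
    then have "u * cnj (G \<zeta> * e \<zeta>) = (\<integral>\<alpha>. G (\<alpha> + \<zeta>) * e (\<alpha> + \<zeta>) * cnj (G \<zeta> * e \<zeta>) \<partial>freq)"
      by (simp only: integral_mult_left_zero)
    also have "\<dots> = (\<integral>\<alpha>. G (\<zeta> + \<alpha>) * cnj (G \<zeta>) * e \<alpha> \<partial>freq)"
    proof (intro Bochner_Integration.integral_cong refl)
      fix \<alpha>
      have "G (\<alpha> + \<zeta>) * e (\<alpha> + \<zeta>) * cnj (G \<zeta> * e \<zeta>) = G (\<zeta> + \<alpha>) * cnj (G \<zeta>) * e \<alpha> * (e \<zeta> * cnj (e \<zeta>))"
        by (simp add: e_add add.commute mult_ac)
      then show "G (\<alpha> + \<zeta>) * e (\<alpha> + \<zeta>) * cnj (G \<zeta> * e \<zeta>) = G (\<zeta> + \<alpha>) * cnj (G \<zeta>) * e \<alpha>"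
        by (simp only: e_cnj mult_1_right)
    qed
    finally show "u * cnj (G \<zeta> * e \<zeta>) = (\<integral>\<alpha>. G (\<zeta> + \<alpha>) * cnj (G \<zeta>) * e \<alpha> \<partial>freq)" .
  qed
  also have "\<dots> = (\<integral>\<alpha>. (\<integral>\<zeta>. G (\<zeta> + \<alpha>) * cnj (G \<zeta>) * e \<alpha> \<partial>freq) \<partial>freq)"
    by (rule freq_freq.Fubini_integral[OF joint_e])
  finally show "complex_of_real ((cmod (\<integral>\<zeta>. G \<zeta> * cis (2 * pi * (fst \<zeta> * x + real_of_int (snd \<zeta>) * y)) \<partial>freq))\<^sup>2)
      = (\<integral>\<alpha>. (\<integral>\<zeta>. G (\<zeta> + \<alpha>) * cnj (G \<zeta>) \<partial>freq) * cis (2 * pi * (fst \<alpha> * x + real_of_int (snd \<alpha>) * y)) \<partial>freq)"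
    by (simp only: u_def e_def integral_mult_left_zero)
qed

text \<open>An L4 norm of u is an L2 norm of |u|^2, and |u|^2 is a frequency integral of the
  autocorrelation, to which the Plancherel inequality applies.\<close>

lemma L4_le_autocorrelation:
  fixes G :: "real \<times> int \<Rightarrow> complex"
  assumes G: "integrable freq G" and K: "finite K" and supp: "\<And>\<xi> k. k \<notin> K \<Longrightarrow> G (\<xi>, k) = 0"
  shows "(\<integral>\<^sup>+z. ennreal (cmod (\<integral>\<zeta>. G \<zeta> * cis (2 * pi * (fst \<zeta> * fst z + real_of_int (snd \<zeta>) * snd z)) \<partial>freq) ^ 4) * indicator Mdom z \<partial>lborel)
    \<le> ennreal (12 * fejer_mass) * (\<integral>\<^sup>+\<alpha>. ennreal ((cmod (\<integral>\<zeta>. G (\<zeta> + \<alpha>) * cnj (G \<zeta>) \<partial>freq))\<^sup>2) \<partial>freq)"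
proof -
  define \<rho> where "\<rho> \<alpha> = (\<integral>\<zeta>. G (\<zeta> + \<alpha>) * cnj (G \<zeta>) \<partial>freq)" for \<alpha>
  \<comment> \<open>The autocorrelation lives on the difference set K - K, which is again
    finite.\<close>
  define K' where "K' = (\<lambda>(k, l). k - l) ` (K \<times> K)"
  have K': "finite K'" using K by (simp add: K'_def)
  have supp': "\<rho> (a, m) = 0" if "m \<notin> K'" for a m
  proof -
    have "G (\<zeta> + (a, m)) * cnj (G \<zeta>) = 0" for \<zeta>
    proof (cases "snd \<zeta> \<in> K \<and> snd \<zeta> + m \<in> K")
      case True
      then have "(snd \<zeta> + m) - snd \<zeta> \<in> K'" unfolding K'_def by force
      then show ?thesis using that by simp
    next
      case False
      then show ?thesis using supp by (cases \<zeta>) auto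
    qed
    then show ?thesis unfolding \<rho>_def by (simp only: integral_zero)
  qed
  have "cmod (\<integral>\<zeta>. G \<zeta> * cis (2 * pi * (fst \<zeta> * fst z + real_of_int (snd \<zeta>) * snd z)) \<partial>freq) ^ 4
    = (cmod (\<integral>\<alpha>. \<rho> \<alpha> * cis (2 * pi * (fst \<alpha> * fst z + real_of_int (snd \<alpha>) * snd z)) \<partial>freq))\<^sup>2" for z
    unfolding \<rho>_def autocorrelation(2)[OF G, symmetric] norm_of_real by simp
  then show ?thesis
    using plancherel_freq_le[of \<rho>, OF _ K' supp'] autocorrelation(1)[OF G] by (simp add: \<rho>_def[abs_def])
qed

text \<open>Parametrised by Fourier data, so that the convolution kernel (data
  \<open>symbol\<close>) and the solution (data \<open>symbol\<close> times the transform of f) are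
  both instances.\<close>

definition evolution :: "(real \<times> int \<Rightarrow> complex) \<Rightarrow> real \<Rightarrow> real \<times> real \<Rightarrow> complex" where
  "evolution G t z = (\<integral>\<zeta>. G \<zeta> * cis (- (4 * pi\<^sup>2 * t * ((fst \<zeta>)\<^sup>2 - (real_of_int (snd \<zeta>))\<^sup>2))
     + 2 * pi * (fst \<zeta> * fst z + real_of_int (snd \<zeta>) * snd z)) \<partial>freq)"

text \<open>For fixed t the L4 norm is bounded by the L2 norm in alpha of the autocorrelation. For
  fixed alpha the latter is an oscillatory integral whose phase is linear in t, so
  \<open>weighted_L2_oscillatory\<close> handles the time integral; writing eta = zeta + beta then
  produces the quartic form.\<close>

lemma weighted_L4_le_quartic_form:
  fixes G :: "real \<times> int \<Rightarrow> complex" and w :: "real \<Rightarrow> real"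
  assumes G: "integrable freq G" and bdd: "\<And>\<zeta>. cmod (G \<zeta>) \<le> c"
    and K: "finite K" and supp: "\<And>\<xi> k. k \<notin> K \<Longrightarrow> G (\<xi>, k) = 0"
    and w: "integrable lborel w" and w_nonneg: "\<And>t. 0 \<le> w t"
  shows "(\<integral>\<^sup>+t. ennreal (w t) * (\<integral>\<^sup>+z. ennreal (cmod (evolution G t z) ^ 4) * indicator Mdom z \<partial>lborel) \<partial>lborel)
    \<le> ennreal (12 * fejer_mass) * quartic_form (\<lambda>\<zeta>. ennreal (cmod (G \<zeta>)))
        (\<lambda>\<alpha> \<beta>. ennreal (cmod (\<integral>t. w t * cis (t * (8 * pi\<^sup>2 * (fst \<alpha> * fst \<beta> - real_of_int (snd \<alpha>) * real_of_int (snd \<beta>)))) \<partial>lborel)))"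
proof -
  note [measurable] = borel_measurable_integrable[OF G] borel_measurable_integrable[OF w]
  define q where "q \<zeta> = (fst \<zeta>)\<^sup>2 - (real_of_int (snd \<zeta>))\<^sup>2" for \<zeta> :: "real \<times> int"
  have [measurable]: "q \<in> borel_measurable freq" unfolding q_def by measurable
  define Gt where "Gt t \<zeta> = G \<zeta> * cis (- (4 * pi\<^sup>2 * t * q \<zeta>))" for t \<zeta>
  define l where "l \<alpha> \<zeta> = - (4 * pi\<^sup>2 * (q (\<zeta> + \<alpha>) - q \<zeta>))" for \<alpha> \<zeta>
  define \<rho> where "\<rho> t \<alpha> = (\<integral>\<zeta>. (G (\<zeta> + \<alpha>) * cnj (G \<zeta>)) * cis (t * l \<alpha> \<zeta>) \<partial>freq)" for t \<alpha>
  have [measurable]: "case_prod l \<in> borel_measurable (freq \<Otimes>\<^sub>M freq)" unfolding l_def by measurable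
  have [measurable]: "case_prod \<rho> \<in> borel_measurable (borel \<Otimes>\<^sub>M freq)" unfolding \<rho>_def by measurable
  define W where "W \<mu> = (\<integral>t. w t * cis (t * \<mu>) \<partial>lborel)" for \<mu>
  have [measurable]: "W \<in> borel_measurable borel" unfolding W_def by measurable
  have Gt: "integrable freq (Gt t)" for t
    unfolding Gt_def[abs_def] by (intro integrable_mult_cis G) measurable
  have spatial: "(\<integral>\<^sup>+z. ennreal (cmod (evolution G t z) ^ 4) * indicator Mdom z \<partial>lborel)
    \<le> ennreal (12 * fejer_mass) * (\<integral>\<^sup>+\<alpha>. ennreal ((cmod (\<rho> t \<alpha>))\<^sup>2) \<partial>freq)" for t
  proof -
    have "evolution G t z = (\<integral>\<zeta>. Gt t \<zeta> * cis (2 * pi * (fst \<zeta> * fst z + real_of_int (snd \<zeta>) * snd z)) \<partial>freq)" for z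
      by (simp add: evolution_def Gt_def q_def cis_mult mult.assoc)
    moreover have "(\<integral>\<zeta>. Gt t (\<zeta> + \<alpha>) * cnj (Gt t \<zeta>) \<partial>freq) = \<rho> t \<alpha>" for \<alpha>
    proof -
      have "Gt t (\<zeta> + \<alpha>) * cnj (Gt t \<zeta>) = (G (\<zeta> + \<alpha>) * cnj (G \<zeta>)) * cis (t * l \<alpha> \<zeta>)" for \<zeta>
      proof -
        have "cis (t * l \<alpha> \<zeta>) = cis (- (4 * pi\<^sup>2 * t * q (\<zeta> + \<alpha>))) * cnj (cis (- (4 * pi\<^sup>2 * t * q \<zeta>)))"
          by (simp add: l_def cis_cnj cis_mult algebra_simps)
        then show ?thesis by (simp add: Gt_def mult_ac)
      qed
      then show ?thesis by (simp add: \<rho>_def)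
    qed
    moreover have "Gt t (\<xi>, k) = 0" if "k \<notin> K" for \<xi> k using supp[OF that] by (simp add: Gt_def)
    ultimately show ?thesis using L4_le_autocorrelation[OF Gt K, of t] by simp
  qed
  have "(\<integral>\<^sup>+t. ennreal (w t) * (\<integral>\<^sup>+z. ennreal (cmod (evolution G t z) ^ 4) * indicator Mdom z \<partial>lborel) \<partial>lborel)
    \<le> (\<integral>\<^sup>+t. ennreal (12 * fejer_mass) * (\<integral>\<^sup>+\<alpha>. ennreal (w t * (cmod (\<rho> t \<alpha>))\<^sup>2) \<partial>freq) \<partial>lborel)"
  proof (intro nn_integral_mono)
    fix t
    have "ennreal (w t) * (\<integral>\<^sup>+z. ennreal (cmod (evolution G t z) ^ 4) * indicator Mdom z \<partial>lborel)
      \<le> ennreal (w t) * (ennreal (12 * fejer_mass) * (\<integral>\<^sup>+\<alpha>. ennreal ((cmod (\<rho> t \<alpha>))\<^sup>2) \<partial>freq))"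
      by (intro mult_left_mono spatial) simp
    also have "\<dots> = ennreal (12 * fejer_mass) * (\<integral>\<^sup>+\<alpha>. ennreal (w t * (cmod (\<rho> t \<alpha>))\<^sup>2) \<partial>freq)"
      using w_nonneg by (simp add: ennreal_mult nn_integral_cmult mult.left_commute)
    finally show "ennreal (w t) * (\<integral>\<^sup>+z. ennreal (cmod (evolution G t z) ^ 4) * indicator Mdom z \<partial>lborel)
      \<le> ennreal (12 * fejer_mass) * (\<integral>\<^sup>+\<alpha>. ennreal (w t * (cmod (\<rho> t \<alpha>))\<^sup>2) \<partial>freq)" .
  qed
  also have "\<dots> = ennreal (12 * fejer_mass) * (\<integral>\<^sup>+t. \<integral>\<^sup>+\<alpha>. ennreal (w t * (cmod (\<rho> t \<alpha>))\<^sup>2) \<partial>freq \<partial>lborel)"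
    by (rule nn_integral_cmult) measurable
  also have "(\<integral>\<^sup>+t. \<integral>\<^sup>+\<alpha>. ennreal (w t * (cmod (\<rho> t \<alpha>))\<^sup>2) \<partial>freq \<partial>lborel)
      = (\<integral>\<^sup>+\<alpha>. \<integral>\<^sup>+t. ennreal (w t * (cmod (\<rho> t \<alpha>))\<^sup>2) \<partial>lborel \<partial>freq)"
    by (rule line_freq.Fubini'[symmetric]) measurable
  also have "\<dots> \<le> (\<integral>\<^sup>+\<alpha>. \<integral>\<^sup>+\<beta>. ennreal (cmod (W (8 * pi\<^sup>2 * (fst \<alpha> * fst \<beta> - real_of_int (snd \<alpha>) * real_of_int (snd \<beta>))))) *
      (\<integral>\<^sup>+\<zeta>. ennreal (cmod (G \<zeta>)) * ennreal (cmod (G (\<zeta> + \<alpha>))) * ennreal (cmod (G (\<zeta> + \<beta>)))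
        * ennreal (cmod (G (\<zeta> + \<alpha> + \<beta>))) \<partial>freq) \<partial>freq \<partial>freq)"
  proof (intro nn_integral_mono)
    fix \<alpha> :: "real \<times> int"
    define H where "H \<zeta> = G (\<zeta> + \<alpha>) * cnj (G \<zeta>)" for \<zeta>
    have [measurable]: "H \<in> borel_measurable freq" unfolding H_def by measurable
    \<comment> \<open>The bound c makes the product of two values of G integrable: one factor is
      bounded, the other integrable.\<close>
    have H: "integrable freq H"
    proof (rule Bochner_Integration.integrable_bound)
      show "integrable freq (\<lambda>\<zeta>. c * cmod (G \<zeta>))" using G by auto
      show "AE \<zeta> in freq. norm (H \<zeta>) \<le> norm (c * cmod (G \<zeta>))"
      proof (intro AE_I2)
        fix \<zeta>
        have "norm (H \<zeta>) \<le> c * cmod (G \<zeta>)"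
          using bdd[of "\<zeta> + \<alpha>"] by (simp add: H_def norm_mult mult_right_mono)
        then show "norm (H \<zeta>) \<le> norm (c * cmod (G \<zeta>))" by simp
      qed
    qed measurable
    have l_meas: "l \<alpha> \<in> borel_measurable freq" unfolding l_def by measurable
    have "(\<integral>\<^sup>+t. ennreal (w t * (cmod (\<rho> t \<alpha>))\<^sup>2) \<partial>lborel)
      \<le> (\<integral>\<^sup>+\<zeta>. \<integral>\<^sup>+\<eta>. ennreal (cmod (H \<zeta>) * cmod (H \<eta>) * cmod (W (l \<alpha> \<zeta> - l \<alpha> \<eta>))) \<partial>freq \<partial>freq)"
      unfolding \<rho>_def W_def H_def[symmetric]
      by (rule weighted_L2_oscillatory[OF freq.sigma_finite_measure_axioms H l_meas w w_nonneg])
    also have "\<dots> = (\<integral>\<^sup>+\<zeta>. \<integral>\<^sup>+\<beta>. ennreal (cmod (H \<zeta>) * cmod (H (\<beta> + \<zeta>)) * cmod (W (l \<alpha> \<zeta> - l \<alpha> (\<beta> + \<zeta>)))) \<partial>freq \<partial>freq)"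
      by (intro nn_integral_cong nn_integral_freq_shift[symmetric]) measurable
    also have "\<dots> = (\<integral>\<^sup>+\<beta>. \<integral>\<^sup>+\<zeta>. ennreal (cmod (H \<zeta>) * cmod (H (\<beta> + \<zeta>)) * cmod (W (l \<alpha> \<zeta> - l \<alpha> (\<beta> + \<zeta>)))) \<partial>freq \<partial>freq)"
      by (rule freq_freq.Fubini'[symmetric]) measurable
    also have "\<dots> = (\<integral>\<^sup>+\<beta>. ennreal (cmod (W (8 * pi\<^sup>2 * (fst \<alpha> * fst \<beta> - real_of_int (snd \<alpha>) * real_of_int (snd \<beta>))))) *
      (\<integral>\<^sup>+\<zeta>. ennreal (cmod (G \<zeta>)) * ennreal (cmod (G (\<zeta> + \<alpha>))) * ennreal (cmod (G (\<zeta> + \<beta>)))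
        * ennreal (cmod (G (\<zeta> + \<alpha> + \<beta>))) \<partial>freq) \<partial>freq)"
    proof (intro nn_integral_cong)
      fix \<beta> :: "real \<times> int"
      \<comment> \<open>A first difference of the quadratic form q is affine in zeta, so a second
        difference is constant in zeta. Hence the factor \<open>W\<close> leaves the
        zeta-integral.\<close>
      have phase: "l \<alpha> \<zeta> - l \<alpha> (\<beta> + \<zeta>) = 8 * pi\<^sup>2 * (fst \<alpha> * fst \<beta> - real_of_int (snd \<alpha>) * real_of_int (snd \<beta>))" for \<zeta>
        by (simp add: l_def q_def power2_eq_square algebra_simps)
      show "(\<integral>\<^sup>+\<zeta>. ennreal (cmod (H \<zeta>) * cmod (H (\<beta> + \<zeta>)) * cmod (W (l \<alpha> \<zeta> - l \<alpha> (\<beta> + \<zeta>)))) \<partial>freq)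
        = ennreal (cmod (W (8 * pi\<^sup>2 * (fst \<alpha> * fst \<beta> - real_of_int (snd \<alpha>) * real_of_int (snd \<beta>))))) *
      (\<integral>\<^sup>+\<zeta>. ennreal (cmod (G \<zeta>)) * ennreal (cmod (G (\<zeta> + \<alpha>))) * ennreal (cmod (G (\<zeta> + \<beta>)))
        * ennreal (cmod (G (\<zeta> + \<alpha> + \<beta>))) \<partial>freq)"
        unfolding phase
        by (subst nn_integral_cmult[symmetric])
          (measurable, simp add: H_def norm_mult ennreal_mult mult_ac add_ac)
    qed
    finally show "(\<integral>\<^sup>+t. ennreal (w t * (cmod (\<rho> t \<alpha>))\<^sup>2) \<partial>lborel)
      \<le> (\<integral>\<^sup>+\<beta>. ennreal (cmod (W (8 * pi\<^sup>2 * (fst \<alpha> * fst \<beta> - real_of_int (snd \<alpha>) * real_of_int (snd \<beta>))))) *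
      (\<integral>\<^sup>+\<zeta>. ennreal (cmod (G \<zeta>)) * ennreal (cmod (G (\<zeta> + \<alpha>))) * ennreal (cmod (G (\<zeta> + \<beta>)))
        * ennreal (cmod (G (\<zeta> + \<alpha> + \<beta>))) \<partial>freq) \<partial>freq)" .
  qed
  finally show ?thesis
    unfolding quartic_form_def W_def by (simp add: mult_left_mono)
qed

section \<open>Time weights\<close>

text \<open>Replaces the step function with value c gamma on [gamma, gamma + 1]. For nonnegative
  coefficients, three times this weight dominates the step function almost everywhere, and its
  Fourier transform has compact support.\<close>

definition time_weight :: "int set \<Rightarrow> (int \<Rightarrow> real) \<Rightarrow> real \<Rightarrow> real" where
  "time_weight \<Gamma> c t = (\<Sum>\<gamma>\<in>\<Gamma>. c \<gamma> * fejer (t - real_of_int \<gamma>))"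

lemma fejer_shift_integrable: "integrable lborel (\<lambda>t. fejer (t - s))"
  using lborel_integrable_real_affine[OF fejer_integrable, of 1 "-s"] by simp

lemma time_weight_integrable: "integrable lborel (time_weight \<Gamma> c)"
  unfolding time_weight_def[abs_def] by (intro Bochner_Integration.integrable_sum integrable_mult_right fejer_shift_integrable)

lemma time_weight_measurable [measurable]: "time_weight \<Gamma> c \<in> borel_measurable borel"
  unfolding time_weight_def by measurable

lemma time_weight_fourier:
  "(\<integral>t. time_weight \<Gamma> c t * cis (t * \<mu>) \<partial>lborel)
    = complex_of_real (fejer_mass * triangle \<mu>) * (\<Sum>\<gamma>\<in>\<Gamma>. c \<gamma> * cis (real_of_int \<gamma> * \<mu>))"
proof -
  have int: "integrable lborel (\<lambda>t. complex_of_real (fejer (t - s)) * cis (t * \<mu>))" for s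
    using fejer_shift_integrable by (intro integrable_mult_cis) auto
  have shift: "(\<integral>t. complex_of_real (fejer (t - s)) * cis (t * \<mu>) \<partial>lborel) = complex_of_real (fejer_mass * triangle \<mu>) * cis (s * \<mu>)" for s
  proof -
    have "(\<integral>t. complex_of_real (fejer (t - s)) * cis (t * \<mu>) \<partial>lborel) = (\<integral>t. complex_of_real (fejer t) * cis ((s + t) * \<mu>) \<partial>lborel)"
      using lborel_integral_real_affine[of 1 "\<lambda>t. complex_of_real (fejer (t - s)) * cis (t * \<mu>)" s] by simp
    also have "\<dots> = (\<integral>t. (complex_of_real (fejer t) * cis (t * \<mu>)) * cis (s * \<mu>) \<partial>lborel)"
    proof -
      have "cis ((s + t) * \<mu>) = cis (t * \<mu>) * cis (s * \<mu>)" for t by (simp add: cis_mult algebra_simps)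
      then show ?thesis by (simp only: mult.assoc)
    qed
    also have "\<dots> = complex_of_real (fejer_mass * triangle \<mu>) * cis (s * \<mu>)"
      by (simp only: integral_mult_left_zero fejer_fourier)
    finally show ?thesis .
  qed
  have "(\<integral>t. time_weight \<Gamma> c t * cis (t * \<mu>) \<partial>lborel)
    = (\<integral>t. (\<Sum>\<gamma>\<in>\<Gamma>. complex_of_real (c \<gamma>) * (complex_of_real (fejer (t - real_of_int \<gamma>)) * cis (t * \<mu>))) \<partial>lborel)"
    by (simp add: time_weight_def sum_distrib_right mult.assoc)
  also have "\<dots> = (\<Sum>\<gamma>\<in>\<Gamma>. complex_of_real (c \<gamma>) * (complex_of_real (fejer_mass * triangle \<mu>) * cis (real_of_int \<gamma> * \<mu>)))"
    using int by (subst Bochner_Integration.integral_sum) (auto simp only: integral_mult_right_zero shift intro!: integrable_mult_right)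
  also have "\<dots> = complex_of_real (fejer_mass * triangle \<mu>) * (\<Sum>\<gamma>\<in>\<Gamma>. c \<gamma> * cis (real_of_int \<gamma> * \<mu>))"
    by (simp add: sum_distrib_left mult_ac)
  finally show ?thesis .
qed

text \<open>The transform is a triangle times a trigonometric polynomial with coefficients c. At mu
  = 8 pi^2 s the polynomial has period 1 in y = 4 pi s, while the triangle confines y to less than
  one unit on either side of 0. Parseval over two periods therefore yields the l2 norm of c.\<close>

lemma time_weight_profile:
  assumes \<Gamma>: "finite \<Gamma>"
  shows "kernel_profile (\<lambda>s. ennreal (cmod (\<integral>t. time_weight \<Gamma> c t * cis (t * (8 * pi\<^sup>2 * s)) \<partial>lborel)))
    (2 * fejer_mass * sqrt (\<Sum>\<gamma>\<in>\<Gamma>. (c \<gamma>)\<^sup>2))"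
proof
  define S where "S = (\<Sum>\<gamma>\<in>\<Gamma>. (c \<gamma>)\<^sup>2)"
  have S: "0 \<le> S" by (simp add: S_def sum_nonneg)
  define P where "P y = (\<Sum>\<gamma>\<in>\<Gamma>. complex_of_real (c \<gamma>) * cis (2 * pi * real_of_int \<gamma> * y))" for y
  define g where "g s = ennreal (cmod (\<integral>t. time_weight \<Gamma> c t * cis (t * (8 * pi\<^sup>2 * s)) \<partial>lborel))" for s
  have g_eq: "g s = ennreal (fejer_mass * triangle (8 * pi\<^sup>2 * s) * cmod (P (4 * pi * s)))" for s
  proof -
    have "(\<Sum>\<gamma>\<in>\<Gamma>. c \<gamma> * cis (real_of_int \<gamma> * (8 * pi\<^sup>2 * s))) = P (4 * pi * s)"
      by (simp add: P_def power2_eq_square mult_ac)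
    then show ?thesis
      unfolding g_def time_weight_fourier
      by (simp add: norm_mult abs_mult abs_of_nonneg fejer_mass_nonneg triangle_nonneg)
  qed
  have [measurable]: "P \<in> borel_measurable borel" unfolding P_def by measurable
  have g_meas [measurable]: "g \<in> borel_measurable borel" unfolding g_eq[abs_def] by measurable
  show "(\<lambda>s. ennreal (cmod (\<integral>t. time_weight \<Gamma> c t * cis (t * (8 * pi\<^sup>2 * s)) \<partial>lborel))) \<in> borel_measurable borel"
    using g_meas by (simp add: g_def[abs_def])
  have pi2: "9 \<le> pi\<^sup>2" using power_mono[of 3 pi 2] pi_gt3 by simp
  fix s :: real
  {
    assume s: "1/2 < \<bar>s\<bar>"
    have "1 \<le> 8 * 9 * \<bar>s\<bar>" using s by simp
    also have "\<dots> \<le> 8 * pi\<^sup>2 * \<bar>s\<bar>" using pi2 by (intro mult_right_mono) auto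
    finally have "1 \<le> \<bar>8 * pi\<^sup>2 * s\<bar>" by (simp add: abs_mult)
    then have "g s = 0" by (simp add: g_eq triangle_support)
    then show "ennreal (cmod (\<integral>t. time_weight \<Gamma> c t * cis (t * (8 * pi\<^sup>2 * s)) \<partial>lborel)) = 0"
      by (simp add: g_def)
  }
  have period: "P (y + 1) = P y" for y
  proof -
    have "cis (2 * pi * real_of_int \<gamma> * (y + 1)) = cis (2 * pi * real_of_int \<gamma> * y)" for \<gamma>
    proof -
      have "cis (2 * pi * real_of_int \<gamma> * (y + 1)) = cis (2 * pi * real_of_int \<gamma> * y) * cis (2 * pi * real_of_int \<gamma>)"
        by (simp only: cis_mult distrib_left mult_1_right)
      also have "cis (2 * pi * real_of_int \<gamma>) = 1" by (rule cis_multiple_2pi) simp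
      finally show ?thesis by (simp only: mult_1_right)
    qed
    then show ?thesis by (simp add: P_def)
  qed
  have P_mass: "(\<integral>\<^sup>+y. ennreal ((cmod (P y))\<^sup>2) * indicator {0..<1} y \<partial>lborel) = ennreal S"
    unfolding P_def S_def using parseval_trig_poly[OF \<Gamma>, of "\<lambda>\<gamma>. complex_of_real (c \<gamma>)"] by simp
  have "(\<integral>\<^sup>+s. (g s)\<^sup>2 \<partial>lborel) = ennreal \<bar>1 / (4 * pi)\<bar> * (\<integral>\<^sup>+y. (g (0 + 1 / (4 * pi) * y))\<^sup>2 \<partial>lborel)"
    by (rule nn_integral_real_affine) auto
  \<comment> \<open>The Jacobian 1/(4 pi) is simply bounded by 1.\<close>
  also have "\<dots> \<le> 1 * (\<integral>\<^sup>+y. (g (0 + 1 / (4 * pi) * y))\<^sup>2 \<partial>lborel)"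
    using pi_gt3 by (intro mult_right_mono) (auto simp: ennreal_le_1)
  \<comment> \<open>The interval |y| < 1 is covered by [0, 1) and its translate [-1, 0); the second
    term is the periodic copy that serves the translate.\<close>
  also have "\<dots> \<le> (\<integral>\<^sup>+y. ennreal (fejer_mass\<^sup>2) * (ennreal ((cmod (P y))\<^sup>2) * indicator {0..<1} y
      + ennreal ((cmod (P (y + 1)))\<^sup>2) * indicator {0..<1} (y + 1)) \<partial>lborel)"
  proof (simp only: mult_1_left, intro nn_integral_mono)
    fix y :: real
    have "8 * pi\<^sup>2 * (0 + 1 / (4 * pi) * y) = 2 * pi * y" by (simp add: power2_eq_square)
    moreover have "4 * pi * (0 + 1 / (4 * pi) * y) = y" by simp
    ultimately have g_y: "g (0 + 1 / (4 * pi) * y) = ennreal (fejer_mass * triangle (2 * pi * y) * cmod (P y))"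
      by (simp only: g_eq)
    show "(g (0 + 1 / (4 * pi) * y))\<^sup>2 \<le> ennreal (fejer_mass\<^sup>2) * (ennreal ((cmod (P y))\<^sup>2) * indicator {0..<1} y
      + ennreal ((cmod (P (y + 1)))\<^sup>2) * indicator {0..<1} (y + 1))"
    proof (cases "\<bar>y\<bar> < 1")
      case False
      then have "1 \<le> \<bar>y\<bar>" by simp
      also have "\<dots> \<le> \<bar>2 * pi * y\<bar>" using pi_gt3 mult_right_mono[of 1 "2 * pi" "\<bar>y\<bar>"] by (simp add: abs_mult)
      finally show ?thesis unfolding g_y by (simp add: triangle_support)
    next
      case True
      have "fejer_mass * triangle (2 * pi * y) * cmod (P y) \<le> fejer_mass * 1 * cmod (P y)"
        by (intro mult_right_mono mult_left_mono triangle_le_1 fejer_mass_nonneg) auto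
      then have "(fejer_mass * triangle (2 * pi * y) * cmod (P y))\<^sup>2 \<le> (fejer_mass * cmod (P y))\<^sup>2"
        using fejer_mass_nonneg triangle_nonneg by (intro power_mono) auto
      then have "(g (0 + 1 / (4 * pi) * y))\<^sup>2 \<le> ennreal (fejer_mass\<^sup>2) * ennreal ((cmod (P y))\<^sup>2)"
        unfolding g_y using fejer_mass_nonneg triangle_nonneg
        by (simp add: ennreal_power ennreal_mult[symmetric] power_mult_distrib ennreal_leI)
      also have "ennreal ((cmod (P y))\<^sup>2) \<le> ennreal ((cmod (P y))\<^sup>2) * indicator {0..<1} y
          + ennreal ((cmod (P (y + 1)))\<^sup>2) * indicator {0..<1} (y + 1)"
        using True by (cases "0 \<le> y") (auto simp: period)
      finally show ?thesis by (simp add: mult_left_mono)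
    qed
  qed
  also have "\<dots> = ennreal (fejer_mass\<^sup>2) * ((\<integral>\<^sup>+y. ennreal ((cmod (P y))\<^sup>2) * indicator {0..<1} y \<partial>lborel)
      + (\<integral>\<^sup>+y. ennreal ((cmod (P (y + 1)))\<^sup>2) * indicator {0..<1} (y + 1) \<partial>lborel))"
    by (subst nn_integral_cmult; (measurable)?) (subst nn_integral_add; (measurable)?)
  also have "(\<integral>\<^sup>+y. ennreal ((cmod (P (y + 1)))\<^sup>2) * indicator {0..<1} (y + 1) \<partial>lborel)
      = (\<integral>\<^sup>+y. ennreal ((cmod (P y))\<^sup>2) * indicator {0..<1} y \<partial>lborel)"
    by (rule nn_integral_real_shift) measurable
  also have "ennreal (fejer_mass\<^sup>2) * ((\<integral>\<^sup>+y. ennreal ((cmod (P y))\<^sup>2) * indicator {0..<1} y \<partial>lborel)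
      + (\<integral>\<^sup>+y. ennreal ((cmod (P y))\<^sup>2) * indicator {0..<1} y \<partial>lborel)) = ennreal (fejer_mass\<^sup>2 * (S + S))"
    unfolding P_mass using S by (simp only: ennreal_mult ennreal_plus zero_le_power2 add_nonneg_nonneg)
  \<comment> \<open>Two periods give the factor 2, which is rounded up to 4 = 2^2 so that B contains
    no further square root.\<close>
  also have "\<dots> \<le> ennreal ((2 * fejer_mass * sqrt S)\<^sup>2)"
    using S mult_nonneg_nonneg[OF zero_le_power2[of fejer_mass] S]
    by (intro ennreal_leI) (simp add: power_mult_distrib)
  finally show "(\<integral>\<^sup>+s. (ennreal (cmod (\<integral>t. time_weight \<Gamma> c t * cis (t * (8 * pi\<^sup>2 * s)) \<partial>lborel)))\<^sup>2 \<partial>lborel)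
    \<le> ennreal ((2 * fejer_mass * sqrt (\<Sum>\<gamma>\<in>\<Gamma>. (c \<gamma>)\<^sup>2))\<^sup>2)"
    by (simp add: g_def S_def)
  show "0 \<le> 2 * fejer_mass * sqrt (\<Sum>\<gamma>\<in>\<Gamma>. (c \<gamma>)\<^sup>2)"
    using S fejer_mass_nonneg by (simp add: S_def)
qed

section \<open>Integrals over unit time slabs, tested against weights\<close>

definition L4_slab :: "(real \<Rightarrow> real \<times> real \<Rightarrow> complex) \<Rightarrow> int \<Rightarrow> ennreal" where
  "L4_slab u \<gamma> = (\<integral>\<^sup>+ s\<in>{0..1}. (\<integral>\<^sup>+ z\<in>Mdom. ennreal (cmod (u (real_of_int \<gamma> + s) z) ^ 4) \<partial>lborel) \<partial>lborel)"

lemma evolution_measurable [measurable]: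
  assumes [measurable]: "G \<in> borel_measurable freq"
  shows "case_prod (evolution G) \<in> borel_measurable (borel \<Otimes>\<^sub>M borel)"
  unfolding evolution_def borel_prod[symmetric, where 'a=real and 'b=real] by measurable

lemma Mdom_sets [measurable]: "Mdom \<in> sets borel"
  unfolding Mdom_def borel_prod[symmetric] by (intro pair_measureI) auto

text \<open>The constant is 3 * 12 * 28 * 2 = 2016: from slabs to Fejer weights, from the Plancherel
  inequality, from the quartic form, and from the profile bound
  \<open>2 * fejer_mass * sqrt S\<close>.\<close>

lemma slab_sum_evolution_le:
  fixes G :: "real \<times> int \<Rightarrow> complex" and c :: "int \<Rightarrow> real"
  assumes G: "integrable freq G" and bdd: "\<And>\<zeta>. cmod (G \<zeta>) \<le> M"
    and K: "finite K" and supp: "\<And>\<xi> k. k \<notin> K \<Longrightarrow> G (\<xi>, k) = 0"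
    and \<Gamma>: "finite \<Gamma>" and c: "\<And>\<gamma>. 0 \<le> c \<gamma>"
  shows "(\<Sum>\<gamma>\<in>\<Gamma>. L4_slab (evolution G) \<gamma> * ennreal (c \<gamma>))
    \<le> ennreal (2016 * fejer_mass\<^sup>2 * sqrt (\<Sum>\<gamma>\<in>\<Gamma>. (c \<gamma>)\<^sup>2)) * (\<integral>\<^sup>+\<zeta>. ennreal ((cmod (G \<zeta>))\<^sup>2) \<partial>freq)\<^sup>2"
proof -
  note [measurable] = borel_measurable_integrable[OF G]
  define \<Phi> where "\<Phi> t = (\<integral>\<^sup>+z. ennreal (cmod (evolution G t z) ^ 4) * indicator Mdom z \<partial>lborel)" for t
  have [measurable]: "\<Phi> \<in> borel_measurable borel" unfolding \<Phi>_def by measurable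
  define S where "S = (\<Sum>\<gamma>\<in>\<Gamma>. (c \<gamma>)\<^sup>2)"
  have slab: "L4_slab (evolution G) \<gamma> \<le> (\<integral>\<^sup>+t. 3 * (ennreal (fejer (t - real_of_int \<gamma>)) * \<Phi> t) \<partial>lborel)" for \<gamma>
  proof -
    have "L4_slab (evolution G) \<gamma> = (\<integral>\<^sup>+s. \<Phi> (real_of_int \<gamma> + s) * indicator {0..1} s \<partial>lborel)"
      by (simp add: L4_slab_def \<Phi>_def)
    also have "\<dots> \<le> (\<integral>\<^sup>+s. 3 * (ennreal (fejer s) * \<Phi> (real_of_int \<gamma> + s)) \<partial>lborel)"
    \<comment> \<open>The point s = 0 is discarded as a null set, since \<open>fejer 0 = 0\<close>
      would break the pointwise bound there.\<close>
    proof (rule nn_integral_mono_AE, rule AE_mp[OF AE_lborel_singleton[of 0]], intro AE_I2 impI)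
      fix s :: real assume s: "s \<noteq> 0"
      show "\<Phi> (real_of_int \<gamma> + s) * indicator {0..1} s \<le> 3 * (ennreal (fejer s) * \<Phi> (real_of_int \<gamma> + s))"
      proof (cases "s \<in> {0..1}")
        case True
        then have "1 \<le> 3 * fejer s" using fejer_ge[OF s] by auto
        then have "1 \<le> 3 * ennreal (fejer s)"
          by (simp add: ennreal_mult[symmetric] fejer_nonneg flip: ennreal_numeral ennreal_1)
        then have "1 * \<Phi> (real_of_int \<gamma> + s) \<le> 3 * ennreal (fejer s) * \<Phi> (real_of_int \<gamma> + s)"
          by (rule mult_right_mono) simp
        then show ?thesis using True by (simp add: mult.assoc)
      qed simp
    qed
    also have "\<dots> = (\<integral>\<^sup>+t. 3 * (ennreal (fejer (t - real_of_int \<gamma>)) * \<Phi> t) \<partial>lborel)"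
      using nn_integral_real_shift[of "\<lambda>t. 3 * (ennreal (fejer (t - real_of_int \<gamma>)) * \<Phi> t)" "real_of_int \<gamma>"]
      by (simp add: add.commute)
    finally show ?thesis .
  qed
  have "(\<Sum>\<gamma>\<in>\<Gamma>. L4_slab (evolution G) \<gamma> * ennreal (c \<gamma>))
    \<le> (\<Sum>\<gamma>\<in>\<Gamma>. (\<integral>\<^sup>+t. 3 * (ennreal (fejer (t - real_of_int \<gamma>)) * \<Phi> t) \<partial>lborel) * ennreal (c \<gamma>))"
    by (intro sum_mono mult_right_mono slab) simp
  also have "\<dots> = (\<integral>\<^sup>+t. (\<Sum>\<gamma>\<in>\<Gamma>. 3 * (ennreal (fejer (t - real_of_int \<gamma>)) * \<Phi> t) * ennreal (c \<gamma>)) \<partial>lborel)"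
    by (subst nn_integral_sum) (auto simp: nn_integral_multc)
  also have "\<dots> = (\<integral>\<^sup>+t. 3 * (ennreal (time_weight \<Gamma> c t) * \<Phi> t) \<partial>lborel)"
  proof (intro nn_integral_cong)
    fix t
    have "ennreal (time_weight \<Gamma> c t) = (\<Sum>\<gamma>\<in>\<Gamma>. ennreal (fejer (t - real_of_int \<gamma>)) * ennreal (c \<gamma>))"
      unfolding time_weight_def
      by (subst sum_ennreal[symmetric]) (auto simp: c fejer_nonneg ennreal_mult mult.commute)
    then show "(\<Sum>\<gamma>\<in>\<Gamma>. 3 * (ennreal (fejer (t - real_of_int \<gamma>)) * \<Phi> t) * ennreal (c \<gamma>)) = 3 * (ennreal (time_weight \<Gamma> c t) * \<Phi> t)"
      by (simp add: sum_distrib_left sum_distrib_right mult_ac)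
  qed
  also have "\<dots> = 3 * (\<integral>\<^sup>+t. ennreal (time_weight \<Gamma> c t) * \<Phi> t \<partial>lborel)"
    by (intro nn_integral_cmult) measurable
  also have "\<dots> \<le> 3 * (ennreal (12 * fejer_mass) * quartic_form (\<lambda>\<zeta>. ennreal (cmod (G \<zeta>)))
        (\<lambda>\<alpha> \<beta>. ennreal (cmod (\<integral>t. time_weight \<Gamma> c t * cis (t * (8 * pi\<^sup>2 *
            (fst \<alpha> * fst \<beta> - real_of_int (snd \<alpha>) * real_of_int (snd \<beta>)))) \<partial>lborel))))"
    unfolding \<Phi>_def
    by (intro mult_left_mono weighted_L4_le_quartic_form[OF G bdd K supp time_weight_integrable])
      (auto simp: time_weight_def intro!: sum_nonneg mult_nonneg_nonneg c fejer_nonneg)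
  also have "\<dots> \<le> 3 * (ennreal (12 * fejer_mass) * (ennreal (28 * (2 * fejer_mass * sqrt S))
      * (\<integral>\<^sup>+\<zeta>. (ennreal (cmod (G \<zeta>)))\<^sup>2 \<partial>freq)\<^sup>2))"
    unfolding S_def
    by (intro mult_left_mono kernel_profile.quartic_form_bound[OF time_weight_profile[OF \<Gamma>]]) auto
  also have "\<dots> = ennreal (2016 * fejer_mass\<^sup>2 * sqrt S) * (\<integral>\<^sup>+\<zeta>. ennreal ((cmod (G \<zeta>))\<^sup>2) \<partial>freq)\<^sup>2"
  proof -
    have "ennreal (2016 * fejer_mass\<^sup>2 * sqrt S) = 3 * (ennreal (12 * fejer_mass) * ennreal (28 * (2 * fejer_mass * sqrt S)))"
      using fejer_mass_nonneg by (simp add: S_def sum_nonneg ennreal_mult[symmetric] power2_eq_square mult_ac flip: ennreal_numeral)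
    then show ?thesis by (simp add: ennreal_power mult.assoc)
  qed
  finally show ?thesis unfolding S_def .
qed

section \<open>The propagator as a frequency integral\<close>

lemma cutoff_continuous:
  assumes "cutoff \<phi>"
  shows "continuous_on UNIV \<phi>"
proof -
  have "\<phi> differentiable (at x)" for x
    using assms unfolding cutoff_def by (metis funpow_0)
  then show ?thesis
    by (simp add: continuous_at_imp_continuous_on differentiable_imp_continuous_within)
qed

lemma cutoff_support:
  assumes "cutoff \<phi>" "2 \<le> \<bar>x\<bar>"
  shows "\<phi> x = 0"
  using assms unfolding cutoff_def by blast

text \<open>\<open>cutoff\<close> does not confine the values of phi between 1 and 2 in modulus of
  the argument. A bound comes from compactness, and the final constant depends on phi through
  it.\<close>

lemma cutoff_bounded:
  assumes "cutoff \<phi>"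
  obtains b where "0 \<le> b" "\<And>x. \<bar>\<phi> x\<bar> \<le> b"
proof -
  have "compact (\<phi> ` {-2..2})"
    using cutoff_continuous[OF assms] by (intro compact_continuous_image) (auto intro: continuous_on_subset)
  then obtain b where b: "\<And>x. x \<in> {-2..2} \<Longrightarrow> \<bar>\<phi> x\<bar> \<le> b"
    using compact_imp_bounded bounded_iff by (metis image_eqI real_norm_def)
  have "\<bar>\<phi> x\<bar> \<le> max 0 b" for x
  proof (cases "x \<in> {-2..2}")
    case True
    then show ?thesis using b[of x] by simp
  next
    case False
    then have "\<phi> x = 0" by (intro cutoff_support[OF assms]) auto
    then show ?thesis by simp
  qed
  then show ?thesis using that[of "max 0 b"] by simp
qed

lemma integrable_freq_bounded:
  fixes g :: "real \<times> int \<Rightarrow> complex"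
  assumes [measurable]: "g \<in> borel_measurable freq" and bdd: "\<And>\<zeta>. cmod (g \<zeta>) \<le> c"
    and K: "finite K" and supp: "\<And>\<xi> k. L < \<bar>\<xi>\<bar> \<or> k \<notin> K \<Longrightarrow> g (\<xi>, k) = 0"
  shows "integrable freq g"
proof (rule integrableI_bounded)
  have "(\<integral>\<^sup>+\<zeta>. ennreal (cmod (g \<zeta>)) \<partial>freq) = (\<Sum>k\<in>K. \<integral>\<^sup>+\<xi>. ennreal (cmod (g (\<xi>, k))) \<partial>lborel)"
    by (rule nn_integral_freq_finite[OF _ K]) (auto simp: supp)
  also have "\<dots> \<le> (\<Sum>k\<in>K. \<integral>\<^sup>+\<xi>. ennreal c * indicator {-L..L} \<xi> \<partial>lborel)"
  proof (intro sum_mono nn_integral_mono)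
    fix \<xi> :: real and k :: int
    show "ennreal (cmod (g (\<xi>, k))) \<le> ennreal c * indicator {-L..L} \<xi>"
    proof (cases "L < \<bar>\<xi>\<bar>")
      case False
      then have "\<xi> \<in> {-L..L}" by auto
      then show ?thesis using bdd by (simp add: ennreal_leI)
    qed (simp add: supp)
  qed
  also have "\<dots> < \<infinity>"
    using K by (simp add: nn_integral_cmult_indicator ennreal_mult_less_top emeasure_lborel_Icc_eq of_nat_less_top)
  finally show "(\<integral>\<^sup>+\<zeta>. ennreal (cmod (g \<zeta>)) \<partial>freq) < \<infinity>" .
qed measurable

definition symbol :: "(real \<Rightarrow> real) \<Rightarrow> real \<Rightarrow> real \<times> int \<Rightarrow> complex" where
  "symbol \<phi> N \<zeta> = complex_of_real (\<phi> (fst \<zeta> / N) * \<phi> (real_of_int (snd \<zeta>) / N))"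

definition freq_window :: "real \<Rightarrow> int set" where
  "freq_window N = {k. \<bar>real_of_int k\<bar> \<le> 2 * N}"

lemma finite_freq_window: "finite (freq_window N)"
proof (rule finite_subset)
  show "freq_window N \<subseteq> {-\<lceil>2 * N\<rceil>..\<lceil>2 * N\<rceil>}"
    unfolding freq_window_def by (auto simp: abs_le_iff) linarith+
qed simp

lemma symbol_measurable [measurable]:
  assumes "cutoff \<phi>"
  shows "symbol \<phi> N \<in> borel_measurable freq"
proof -
  have [measurable]: "\<phi> \<in> borel_measurable borel"
    using cutoff_continuous[OF assms] by (rule borel_measurable_continuous_onI)
  show ?thesis unfolding symbol_def by measurable
qed

lemma symbol_support:
  assumes \<phi>: "cutoff \<phi>" and N: "1 \<le> N" and out: "2 * N < \<bar>\<xi>\<bar> \<or> k \<notin> freq_window N"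
  shows "symbol \<phi> N (\<xi>, k) = 0"
proof -
  have "2 \<le> \<bar>x / N\<bar>" if "2 * N < \<bar>x\<bar>" for x
    using that N by (simp add: field_simps)
  then have "\<phi> (\<xi> / N) = 0 \<or> \<phi> (real_of_int k / N) = 0"
    using out cutoff_support[OF \<phi>] unfolding freq_window_def by (metis (no_types, lifting) mem_Collect_eq not_le)
  then show ?thesis by (auto simp: symbol_def)
qed

lemma symbol_bounded:
  assumes "\<And>x. \<bar>\<phi> x\<bar> \<le> b"
  shows "cmod (symbol \<phi> N \<zeta>) \<le> b\<^sup>2"
  unfolding symbol_def norm_of_real abs_mult power2_eq_square
  using assms by (intro mult_mono) (auto intro: order_trans[OF abs_ge_zero])

lemma symbol_integrable:
  assumes "cutoff \<phi>" "1 \<le> N"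
  shows "integrable freq (symbol \<phi> N)"
proof -
  obtain b where "\<And>x. \<bar>\<phi> x\<bar> \<le> b" using cutoff_bounded[OF assms(1)] by blast
  then show ?thesis
    using symbol_support[OF assms] symbol_bounded[of \<phi> b N] symbol_measurable[OF assms(1)]
    by (intro integrable_freq_bounded[OF _ _ finite_freq_window, of _ "b\<^sup>2" "2 * N" N]) auto
qed

text \<open>The symbol is a product and the phase a sum, so the integral over R x Z splits into a
  finite k-sum times a single xi-integral.\<close>

lemma kernel_eq_evolution:
  assumes \<phi>: "cutoff \<phi>" and N: "1 \<le> N"
  shows "kernel \<phi> N t x y = evolution (symbol \<phi> N) t (x, y)"
proof -
  define I where "I = (\<integral>\<xi>. complex_of_real (\<phi> (\<xi> / N)) * cis (- (4 * pi\<^sup>2 * t * \<xi>\<^sup>2)) * cis (2 * pi * \<xi> * x) \<partial>lborel)"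
  have "evolution (symbol \<phi> N) t (x, y) = (\<Sum>k\<in>freq_window N. \<integral>\<xi>. symbol \<phi> N (\<xi>, k) *
      cis (- (4 * pi\<^sup>2 * t * (\<xi>\<^sup>2 - (real_of_int k)\<^sup>2)) + 2 * pi * (\<xi> * x + real_of_int k * y)) \<partial>lborel)"
    unfolding evolution_def using symbol_support[OF \<phi> N]
    by (subst integral_freq_finite[OF _ finite_freq_window, of _ N])
      (auto intro!: integrable_mult_cis symbol_integrable[OF \<phi> N])
  also have "\<dots> = (\<Sum>k\<in>freq_window N. complex_of_real (\<phi> (real_of_int k / N)) *
      cis (4 * pi\<^sup>2 * t * (real_of_int k)\<^sup>2) * cis (2 * pi * real_of_int k * y) * I)"
  proof (intro sum.cong refl)
    fix k
    have "symbol \<phi> N (\<xi>, k) * cis (- (4 * pi\<^sup>2 * t * (\<xi>\<^sup>2 - (real_of_int k)\<^sup>2)) + 2 * pi * (\<xi> * x + real_of_int k * y))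
      = complex_of_real (\<phi> (real_of_int k / N)) * cis (4 * pi\<^sup>2 * t * (real_of_int k)\<^sup>2) * cis (2 * pi * real_of_int k * y)
        * (complex_of_real (\<phi> (\<xi> / N)) * cis (- (4 * pi\<^sup>2 * t * \<xi>\<^sup>2)) * cis (2 * pi * \<xi> * x))" for \<xi>
    proof -
      have "cis (- (4 * pi\<^sup>2 * t * (\<xi>\<^sup>2 - (real_of_int k)\<^sup>2)) + 2 * pi * (\<xi> * x + real_of_int k * y))
        = cis (4 * pi\<^sup>2 * t * (real_of_int k)\<^sup>2) * cis (2 * pi * real_of_int k * y) * cis (- (4 * pi\<^sup>2 * t * \<xi>\<^sup>2)) * cis (2 * pi * \<xi> * x)"
        by (simp add: cis_mult algebra_simps)
      then show ?thesis by (simp add: symbol_def mult_ac)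
    qed
    then show "(\<integral>\<xi>. symbol \<phi> N (\<xi>, k) * cis (- (4 * pi\<^sup>2 * t * (\<xi>\<^sup>2 - (real_of_int k)\<^sup>2))
        + 2 * pi * (\<xi> * x + real_of_int k * y)) \<partial>lborel)
      = complex_of_real (\<phi> (real_of_int k / N)) * cis (4 * pi\<^sup>2 * t * (real_of_int k)\<^sup>2) * cis (2 * pi * real_of_int k * y) * I"
      by (simp only: I_def integral_mult_right_zero)
  qed
  also have "\<dots> = kernel \<phi> N t x y"
    unfolding kernel_def I_def freq_window_def
    by (simp add: sum_distrib_right cis_conv_exp)
  finally show ?thesis ..
qed

text \<open>The convolution theorem by Fubini: an integrable v times an integrable symbol is
  absolutely integrable over physical and frequency variables jointly.\<close>

lemma schrod_eq_evolution:
  assumes \<phi>: "cutoff \<phi>" and N: "1 \<le> N" and v: "integrable lborel v"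
    and v_eq: "\<And>w. v w = indicator Mdom w *\<^sub>R f w"
  shows "schrod \<phi> N f = evolution (\<lambda>\<zeta>. symbol \<phi> N \<zeta> *
    (\<integral>w. v w * cis (- (2 * pi * (fst \<zeta> * fst w + real_of_int (snd \<zeta>) * snd w))) \<partial>lborel))"
proof (intro ext)
  fix t :: real and z :: "real \<times> real"
  interpret P: pair_sigma_finite "lborel :: (real \<times> real) measure" freq ..
  define \<theta> where "\<theta> z \<zeta> = - (4 * pi\<^sup>2 * t * ((fst \<zeta>)\<^sup>2 - (real_of_int (snd \<zeta>))\<^sup>2))
     + 2 * pi * (fst \<zeta> * fst z + real_of_int (snd \<zeta>) * snd z)" for z :: "real \<times> real" and \<zeta> :: "real \<times> int"
  define \<psi> where "\<psi> w \<zeta> = - (2 * pi * (fst \<zeta> * fst w + real_of_int (snd \<zeta>) * snd w))" for w :: "real \<times> real" and \<zeta> :: "real \<times> int"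
  have split: "cis (\<theta> (z - w) \<zeta>) = cis (\<psi> w \<zeta>) * cis (\<theta> z \<zeta>)" for w \<zeta>
    by (simp add: \<theta>_def \<psi>_def cis_mult algebra_simps)
  have "integrable (lborel \<Otimes>\<^sub>M freq) (\<lambda>p. v (fst p) * symbol \<phi> N (snd p))"
    by (intro integrable_tensor v symbol_integrable[OF \<phi> N] lborel.sigma_finite_measure_axioms freq.sigma_finite_measure_axioms)
  moreover have "(\<lambda>p. \<theta> (z - fst p) (snd p)) \<in> borel_measurable (lborel \<Otimes>\<^sub>M freq)"
    unfolding \<theta>_def fst_diff snd_diff lborel_prod[symmetric, where 'a=real and 'b=real] by measurable
  ultimately have "integrable (lborel \<Otimes>\<^sub>M freq) (\<lambda>p. v (fst p) * symbol \<phi> N (snd p) * cis (\<theta> (z - fst p) (snd p)))"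
    by (rule integrable_mult_cis)
  then have joint: "integrable (lborel \<Otimes>\<^sub>M freq) (\<lambda>(w, \<zeta>). v w * symbol \<phi> N \<zeta> * cis (\<theta> (z - w) \<zeta>))"
    by (simp only: case_prod_unfold)
  have "schrod \<phi> N f t z = (\<integral>w. v w * evolution (symbol \<phi> N) t (z - w) \<partial>lborel)"
    unfolding schrod_def set_lebesgue_integral_def kernel_eq_evolution[OF \<phi> N]
    by (intro Bochner_Integration.integral_cong refl) (simp add: v_eq scaleR_conv_of_real mult_ac minus_prod_def)
  also have "\<dots> = (\<integral>w. \<integral>\<zeta>. v w * symbol \<phi> N \<zeta> * cis (\<theta> (z - w) \<zeta>) \<partial>freq \<partial>lborel)"
    by (simp only: evolution_def \<theta>_def integral_mult_right_zero[symmetric] mult.assoc)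
  also have "\<dots> = (\<integral>\<zeta>. \<integral>w. v w * symbol \<phi> N \<zeta> * cis (\<theta> (z - w) \<zeta>) \<partial>lborel \<partial>freq)"
    by (rule P.Fubini_integral[OF joint, symmetric])
  also have "\<dots> = (\<integral>\<zeta>. (symbol \<phi> N \<zeta> * (\<integral>w. v w * cis (\<psi> w \<zeta>) \<partial>lborel)) * cis (\<theta> z \<zeta>) \<partial>freq)"
  proof (intro Bochner_Integration.integral_cong refl)
    fix \<zeta>
    have "v w * symbol \<phi> N \<zeta> * cis (\<theta> (z - w) \<zeta>) = (symbol \<phi> N \<zeta> * (v w * cis (\<psi> w \<zeta>))) * cis (\<theta> z \<zeta>)" for w
      by (simp add: split mult_ac)
    then show "(\<integral>w. v w * symbol \<phi> N \<zeta> * cis (\<theta> (z - w) \<zeta>) \<partial>lborel)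
      = (symbol \<phi> N \<zeta> * (\<integral>w. v w * cis (\<psi> w \<zeta>) \<partial>lborel)) * cis (\<theta> z \<zeta>)"
      by (simp only: integral_mult_left_zero integral_mult_right_zero)
  qed
  also have "\<dots> = evolution (\<lambda>\<zeta>. symbol \<phi> N \<zeta> * (\<integral>w. v w * cis (\<psi> w \<zeta>) \<partial>lborel)) t z"
    by (simp only: evolution_def \<theta>_def)
  finally show "schrod \<phi> N f t z = evolution (\<lambda>\<zeta>. symbol \<phi> N \<zeta> *
    (\<integral>w. v w * cis (- (2 * pi * (fst \<zeta> * fst w + real_of_int (snd \<zeta>) * snd w))) \<partial>lborel)) t z"
    by (simp only: \<psi>_def)
qed

text \<open>The frequency bound is quadratic in the L2 mass of G, and that mass is at most
  \<open>12 * fejer_mass * b ^ 4\<close> times the mass of f. Hence 290304 = 2016 * 12^2, and the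
  powers \<open>fejer_mass ^ 4\<close> and \<open>b ^ 8\<close>.\<close>

lemma slab_sum_schrod_le:
  fixes c :: "int \<Rightarrow> real"
  assumes \<phi>: "cutoff \<phi>" and b: "0 \<le> b" "\<And>x. \<bar>\<phi> x\<bar> \<le> b" and N: "1 \<le> N"
    and f [measurable]: "f \<in> borel_measurable borel" and v: "integrable lborel (\<lambda>w. indicator Mdom w *\<^sub>R f w)"
    and \<Gamma>: "finite \<Gamma>" and c: "\<And>\<gamma>. 0 \<le> c \<gamma>"
  shows "case_prod (schrod \<phi> N f) \<in> borel_measurable (borel \<Otimes>\<^sub>M borel)" (is ?meas)
    and "(\<Sum>\<gamma>\<in>\<Gamma>. L4_slab (schrod \<phi> N f) \<gamma> * ennreal (c \<gamma>))
    \<le> ennreal (290304 * fejer_mass ^ 4 * b ^ 8 * sqrt (\<Sum>\<gamma>\<in>\<Gamma>. (c \<gamma>)\<^sup>2)) * (L2sq f)\<^sup>2" (is ?bound)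
proof -
  define u where "u w = indicator Mdom w *\<^sub>R f w" for w
  have u: "integrable lborel u" using v by (simp add: u_def[abs_def])
  have [measurable]: "u \<in> borel_measurable (borel \<Otimes>\<^sub>M borel)"
    using borel_measurable_integrable[OF u] by (simp add: borel_prod)
  define F where "F \<zeta> = (\<integral>w. u w * cis (- (2 * pi * (fst \<zeta> * fst w + real_of_int (snd \<zeta>) * snd w))) \<partial>lborel)" for \<zeta> :: "real \<times> int"
  define G where "G \<zeta> = symbol \<phi> N \<zeta> * F \<zeta>" for \<zeta>
  note [measurable] = symbol_measurable[OF \<phi>]
  have [measurable]: "F \<in> borel_measurable freq" unfolding F_def lborel_prod[symmetric] by measurable
  have [measurable]: "G \<in> borel_measurable freq" unfolding G_def by measurable
  have F_bdd: "cmod (F \<zeta>) \<le> (\<integral>w. cmod (u w) \<partial>lborel)" for \<zeta>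
    unfolding F_def
    using integral_norm_bound[of lborel "\<lambda>w. u w * cis (- (2 * pi * (fst \<zeta> * fst w + real_of_int (snd \<zeta>) * snd w)))"]
    by (simp add: norm_mult)
  have G_bdd: "cmod (G \<zeta>) \<le> b\<^sup>2 * (\<integral>w. cmod (u w) \<partial>lborel)" for \<zeta>
    unfolding G_def norm_mult using symbol_bounded[OF b(2)] F_bdd by (intro mult_mono) auto
  have G_supp: "G (\<xi>, k) = 0" if "2 * N < \<bar>\<xi>\<bar> \<or> k \<notin> freq_window N" for \<xi> k
    using symbol_support[OF \<phi> N that] by (simp add: G_def)
  have G: "integrable freq G"
    using G_bdd G_supp by (intro integrable_freq_bounded[OF _ _ finite_freq_window, of _ _ "2 * N" N]) auto
  have eq: "schrod \<phi> N f = evolution G"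
    using schrod_eq_evolution[OF \<phi> N u u_def] by (simp add: G_def[abs_def] F_def)
  show ?meas unfolding eq by measurable
  have L2: "L2sq f = (\<integral>\<^sup>+z. ennreal ((cmod (u z))\<^sup>2) \<partial>lborel)"
    unfolding L2sq_def by (intro nn_integral_cong) (auto simp: u_def indicator_def)
  have "(\<integral>\<^sup>+\<zeta>. ennreal ((cmod (G \<zeta>))\<^sup>2) \<partial>freq)
    \<le> (\<integral>\<^sup>+\<zeta>. ennreal (b ^ 4) * (ennreal ((cmod (F \<zeta>))\<^sup>2) * indicator (freq_window N) (snd \<zeta>)) \<partial>freq)"
  proof (intro nn_integral_mono)
    fix \<zeta> :: "real \<times> int"
    show "ennreal ((cmod (G \<zeta>))\<^sup>2) \<le> ennreal (b ^ 4) * (ennreal ((cmod (F \<zeta>))\<^sup>2) * indicator (freq_window N) (snd \<zeta>))"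
    proof (cases "snd \<zeta> \<in> freq_window N")
      case True
      have "(cmod (G \<zeta>))\<^sup>2 \<le> (b\<^sup>2 * cmod (F \<zeta>))\<^sup>2"
        unfolding G_def norm_mult using symbol_bounded[OF b(2)] by (intro power_mono mult_right_mono) auto
      then show ?thesis using True by (simp add: power_mult_distrib ennreal_mult[symmetric] ennreal_leI)
    next
      case False
      then show ?thesis using G_supp[of "fst \<zeta>" "snd \<zeta>"] by simp
    qed
  qed
  also have "\<dots> = ennreal (b ^ 4) * (\<integral>\<^sup>+\<zeta>. ennreal ((cmod (F \<zeta>))\<^sup>2) * indicator (freq_window N) (snd \<zeta>) \<partial>freq)"
    by (rule nn_integral_cmult) measurable
  also have "\<dots> \<le> ennreal (b ^ 4) * (ennreal (12 * fejer_mass) * L2sq f)"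
    unfolding L2 F_def
    by (intro mult_left_mono bessel_freq u finite_freq_window) (auto simp: u_def)
  finally have G_L2: "(\<integral>\<^sup>+\<zeta>. ennreal ((cmod (G \<zeta>))\<^sup>2) \<partial>freq) \<le> ennreal (12 * fejer_mass * b ^ 4) * L2sq f"
    using fejer_mass_nonneg b(1) by (simp add: ennreal_mult mult_ac)
  define S where "S = sqrt (\<Sum>\<gamma>\<in>\<Gamma>. (c \<gamma>)\<^sup>2)"
  have S: "0 \<le> S" by (simp add: S_def sum_nonneg)
  have "(\<Sum>\<gamma>\<in>\<Gamma>. L4_slab (schrod \<phi> N f) \<gamma> * ennreal (c \<gamma>))
    \<le> ennreal (2016 * fejer_mass\<^sup>2 * S) * (\<integral>\<^sup>+\<zeta>. ennreal ((cmod (G \<zeta>))\<^sup>2) \<partial>freq)\<^sup>2"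
    unfolding eq S_def using G_supp by (intro slab_sum_evolution_le[OF G G_bdd finite_freq_window _ \<Gamma> c]) auto
  also have "\<dots> \<le> ennreal (2016 * fejer_mass\<^sup>2 * S) * (ennreal (12 * fejer_mass * b ^ 4) * L2sq f)\<^sup>2"
    by (intro mult_left_mono power_mono G_L2) auto
  also have "\<dots> = ennreal (290304 * fejer_mass ^ 4 * b ^ 8 * S) * (L2sq f)\<^sup>2"
  proof -
    have "ennreal (290304 * fejer_mass ^ 4 * b ^ 8 * S) = ennreal (2016 * fejer_mass\<^sup>2 * S) * (ennreal (12 * fejer_mass * b ^ 4))\<^sup>2"
      using fejer_mass_nonneg b(1) S
      by (simp add: ennreal_power ennreal_mult[symmetric] power_mult_distrib flip: power_mult)
    then show ?thesis by (simp add: power_mult_distrib mult_ac)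
  qed
  finally show ?bound unfolding S_def .
qed

section \<open>Passage to square integrable data\<close>

text \<open>Cutting the height and the x-range suffices, since \<open>Mdom\<close> is bounded in y.
  The result is integrable over \<open>Mdom\<close>, is dominated by f, and agrees with f at each
  point for large n.\<close>

definition truncation :: "nat \<Rightarrow> (real \<times> real \<Rightarrow> complex) \<Rightarrow> real \<times> real \<Rightarrow> complex" where
  "truncation n f z = (if cmod (f z) \<le> real n \<and> \<bar>fst z\<bar> \<le> real n then f z else 0)"

lemma truncation_measurable [measurable]:
  assumes [measurable]: "f \<in> borel_measurable borel"
  shows "truncation n f \<in> borel_measurable borel"
proof -
  have [measurable]: "fst \<in> borel_measurable (borel :: (real \<times> real) measure)"
    unfolding borel_prod[symmetric] by measurable
  show ?thesis unfolding truncation_def by measurable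
qed

lemma truncation_norm_le: "cmod (truncation n f z) \<le> cmod (f z)"
  by (simp add: truncation_def)

lemma truncation_integrable:
  assumes [measurable]: "f \<in> borel_measurable borel"
  shows "integrable lborel (\<lambda>z. indicator Mdom z *\<^sub>R truncation n f z)"
proof (rule Bochner_Integration.integrable_bound)
  have "integrable lborel (indicator ({-real n..real n} \<times> {0..1::real}) :: real \<times> real \<Rightarrow> real)"
  proof (rule integrable_real_indicator)
    show "{- real n..real n} \<times> {0..1::real} \<in> sets lborel"
      by (simp add: borel_closed closed_Times)
    have "emeasure lborel ({- real n..real n} \<times> {0..1::real}) = ennreal (2 * real n)"
      unfolding lborel_prod[symmetric] by (subst lborel.emeasure_pair_measure_Times) auto
    then show "emeasure lborel ({- real n..real n} \<times> {0..1::real}) < \<infinity>" by simp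
  qed
  then show "integrable lborel (\<lambda>z. real n * indicator ({-real n..real n} \<times> {0..1::real}) z :: real)"
    by auto
  show "AE z in lborel. norm (indicator Mdom z *\<^sub>R truncation n f z)
    \<le> norm (real n * indicator ({-real n..real n} \<times> {0..1::real}) z)"
    by (intro AE_I2) (auto simp: truncation_def Mdom_def indicator_def)
qed measurable

lemma L2sq_truncation_le: "L2sq (truncation n f) \<le> L2sq f"
  unfolding L2sq_def
  by (intro nn_integral_mono mult_right_mono ennreal_leI power_mono truncation_norm_le) auto

text \<open>Where the integral defining \<open>schrod\<close> does not converge absolutely, its value is \<open>0\<close> and the
inequality is trivial; so no decay of the kernel is needed.\<close>

lemma schrod_le_liminf_truncation:
  assumes \<phi>: "cutoff \<phi>" and N: "1 \<le> N" and f [measurable]: "f \<in> borel_measurable borel"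
  shows "ennreal (cmod (schrod \<phi> N f t z) ^ 4) \<le> liminf (\<lambda>n. ennreal (cmod (schrod \<phi> N (truncation n f) t z) ^ 4))"
proof -
  define k where "k w = kernel \<phi> N t (fst z - fst w) (snd z - snd w)" for w :: "real \<times> real"
  note [measurable] = symbol_measurable[OF \<phi>]
  have k_meas [measurable]: "k \<in> borel_measurable borel"
  proof -
    have "(\<lambda>w. (t, z - w)) \<in> borel \<rightarrow>\<^sub>M borel \<Otimes>\<^sub>M borel" by measurable
    from measurable_compose[OF this evolution_measurable, of "symbol \<phi> N"]
    have "(\<lambda>w. evolution (symbol \<phi> N) t (z - w)) \<in> borel_measurable borel" by simp
    then show ?thesis
      by (simp add: k_def[abs_def] kernel_eq_evolution[OF \<phi> N] minus_prod_def)
  qed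
  define h where "h g w = indicator Mdom w *\<^sub>R (k w * g w)" for g w
  have sch: "schrod \<phi> N g t z = (\<integral>w. h g w \<partial>lborel)" for g
    by (simp add: schrod_def set_lebesgue_integral_def h_def k_def)
  show ?thesis
  proof (cases "integrable lborel (h f)")
    case False
    then show ?thesis by (simp add: sch not_integrable_integral_eq)
  next
    case True
    \<comment> \<open>The dominating function is the integrand for f itself, because truncation
      never increases the modulus.\<close>
    have "(\<lambda>n. \<integral>w. h (truncation n f) w \<partial>lborel) \<longlonglongrightarrow> (\<integral>w. h f w \<partial>lborel)"
    proof (rule integral_dominated_convergence)
      show "h f \<in> borel_measurable lborel" unfolding h_def by measurable
      show "h (truncation n f) \<in> borel_measurable lborel" for n unfolding h_def by measurable
      show "integrable lborel (\<lambda>w. norm (h f w))" using True by simp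
      show "AE w in lborel. norm (h (truncation n f) w) \<le> norm (h f w)" for n
        by (intro AE_I2) (simp add: h_def norm_mult mult_left_mono truncation_norm_le)
      show "AE w in lborel. (\<lambda>n. h (truncation n f) w) \<longlonglongrightarrow> h f w"
      proof (intro AE_I2 tendsto_eventually)
        fix w :: "real \<times> real"
        obtain m where m: "max (cmod (f w)) \<bar>fst w\<bar> \<le> real m" using real_arch_simple by blast
        show "\<forall>\<^sub>F n in sequentially. h (truncation n f) w = h f w"
          using eventually_ge_at_top[of m]
        proof eventually_elim
          case (elim n)
          then have "real m \<le> real n" by simp
          then have "truncation n f w = f w" using m by (auto simp: truncation_def)
          then show ?case by (simp add: h_def)
        qed
      qed
    qed
    then have "(\<lambda>n. ennreal (cmod (\<integral>w. h (truncation n f) w \<partial>lborel) ^ 4)) \<longlonglongrightarrow> ennreal (cmod (\<integral>w. h f w \<partial>lborel) ^ 4)"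
      by (intro tendsto_ennrealI tendsto_power tendsto_norm)
    then have "liminf (\<lambda>n. ennreal (cmod (\<integral>w. h (truncation n f) w \<partial>lborel) ^ 4)) = ennreal (cmod (\<integral>w. h f w \<partial>lborel) ^ 4)"
      by (intro lim_imp_Liminf) auto
    then show ?thesis by (simp add: sch)
  qed
qed

section \<open>Fatou's lemma, l2 duality and the final estimate\<close>

lemma indicator_liminf_le:
  fixes a :: "nat \<Rightarrow> ennreal"
  shows "liminf a * indicator A x \<le> liminf (\<lambda>n. a n * indicator A x)"
  by (cases "x \<in> A") auto

text \<open>Fatou in z and then in s. The limit u enters only through pointwise comparison, so
  measurability is asked of the approximants alone.\<close>

lemma L4_slab_le_liminf:
  fixes u :: "real \<Rightarrow> real \<times> real \<Rightarrow> complex"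
  assumes [measurable]: "\<And>n. case_prod (v n) \<in> borel_measurable (borel \<Otimes>\<^sub>M borel)"
    and le: "\<And>t z. ennreal (cmod (u t z) ^ 4) \<le> liminf (\<lambda>n. ennreal (cmod (v n t z) ^ 4))"
  shows "L4_slab u \<gamma> \<le> liminf (\<lambda>n. L4_slab (v n) \<gamma>)"
proof -
  define \<Phi> where "\<Phi> n t = (\<integral>\<^sup>+z. ennreal (cmod (v n t z) ^ 4) * indicator Mdom z \<partial>lborel)" for n t
  have [measurable]: "\<Phi> n \<in> borel_measurable borel" for n unfolding \<Phi>_def by measurable
  have inner: "(\<integral>\<^sup>+z. ennreal (cmod (u t z) ^ 4) * indicator Mdom z \<partial>lborel) \<le> liminf (\<lambda>n. \<Phi> n t)" for t
  proof -
    have "(\<integral>\<^sup>+z. ennreal (cmod (u t z) ^ 4) * indicator Mdom z \<partial>lborel)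
      \<le> (\<integral>\<^sup>+z. liminf (\<lambda>n. ennreal (cmod (v n t z) ^ 4) * indicator Mdom z) \<partial>lborel)"
      by (intro nn_integral_mono order_trans[OF mult_right_mono[OF le] indicator_liminf_le]) simp
    also have "\<dots> \<le> liminf (\<lambda>n. \<Phi> n t)"
      unfolding \<Phi>_def by (rule nn_integral_liminf) measurable
    finally show ?thesis .
  qed
  have "L4_slab u \<gamma> \<le> (\<integral>\<^sup>+s. liminf (\<lambda>n. \<Phi> n (real_of_int \<gamma> + s) * indicator {0..1} s) \<partial>lborel)"
    unfolding L4_slab_def
    by (intro nn_integral_mono order_trans[OF mult_right_mono[OF inner] indicator_liminf_le]) simp
  also have "\<dots> \<le> liminf (\<lambda>n. \<integral>\<^sup>+s. \<Phi> n (real_of_int \<gamma> + s) * indicator {0..1} s \<partial>lborel)"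
    by (rule nn_integral_liminf) measurable
  finally show ?thesis by (simp add: L4_slab_def \<Phi>_def)
qed

text \<open>A finite weighted sum is an integral against a point measure, so this too is Fatou's
  lemma.\<close>

lemma sum_liminf_le:
  fixes a :: "nat \<Rightarrow> 'i \<Rightarrow> ennreal"
  assumes \<Gamma>: "finite \<Gamma>" and le: "\<And>n. (\<Sum>\<gamma>\<in>\<Gamma>. a n \<gamma> * c \<gamma>) \<le> B"
  shows "(\<Sum>\<gamma>\<in>\<Gamma>. liminf (\<lambda>n. a n \<gamma>) * c \<gamma>) \<le> B"
proof -
  have "(\<Sum>\<gamma>\<in>\<Gamma>. liminf (\<lambda>n. a n \<gamma>) * c \<gamma>) = (\<integral>\<^sup>+\<gamma>. liminf (\<lambda>n. a n \<gamma>) \<partial>point_measure \<Gamma> c)"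
    using \<Gamma> by (simp add: nn_integral_point_measure_finite mult.commute)
  also have "\<dots> \<le> liminf (\<lambda>n. \<integral>\<^sup>+\<gamma>. a n \<gamma> \<partial>point_measure \<Gamma> c)"
    by (rule nn_integral_liminf) simp
  also have "\<dots> = liminf (\<lambda>n. \<Sum>\<gamma>\<in>\<Gamma>. a n \<gamma> * c \<gamma>)"
    using \<Gamma> by (simp add: nn_integral_point_measure_finite mult.commute)
  also have "\<dots> \<le> liminf (\<lambda>n. B)"
    by (intro Liminf_mono always_eventually allI le)
  finally show ?thesis by (simp add: Liminf_const)
qed

text \<open>Test with c = a: the hypothesis becomes S <= C * sqrt S * x, and sqrt S is
  cancelled.\<close>

lemma l2_duality:
  fixes a :: "'i \<Rightarrow> ennreal"
  assumes \<Gamma>: "finite \<Gamma>" and C: "0 \<le> C" and X: "X < \<infinity>"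
    and le: "\<And>c :: 'i \<Rightarrow> real. (\<And>\<gamma>. 0 \<le> c \<gamma>) \<Longrightarrow>
      (\<Sum>\<gamma>\<in>\<Gamma>. a \<gamma> * ennreal (c \<gamma>)) \<le> ennreal (C * sqrt (\<Sum>\<gamma>\<in>\<Gamma>. (c \<gamma>)\<^sup>2)) * X"
  shows "(\<Sum>\<gamma>\<in>\<Gamma>. (a \<gamma>)\<^sup>2) \<le> ennreal (C\<^sup>2) * X\<^sup>2"
proof -
  obtain x where x: "X = ennreal x" "0 \<le> x" using X by (cases X) auto
  \<comment> \<open>Constant weight 1 shows that each entry is finite; only then can a be turned
    into a real weight.\<close>
  have fin: "a \<gamma> < \<infinity>" if "\<gamma> \<in> \<Gamma>" for \<gamma>
  proof -
    have "a \<gamma> = a \<gamma> * ennreal (1::real)" by simp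
    also have "\<dots> \<le> (\<Sum>\<gamma>\<in>\<Gamma>. a \<gamma> * ennreal 1)"
      using \<Gamma> that by (intro member_le_sum) auto
    also have "\<dots> \<le> ennreal (C * sqrt (\<Sum>\<gamma>\<in>\<Gamma>. (1::real)\<^sup>2)) * X"
      by (rule le) simp
    also have "\<dots> < \<infinity>" using X by (simp add: ennreal_mult_less_top)
    finally show ?thesis .
  qed
  define r where "r \<gamma> = enn2real (a \<gamma>)" for \<gamma>
  have a: "a \<gamma> = ennreal (r \<gamma>)" if "\<gamma> \<in> \<Gamma>" for \<gamma>
    using fin[OF that] by (simp add: r_def ennreal_enn2real_if)
  have r: "0 \<le> r \<gamma>" for \<gamma> by (simp add: r_def)
  define S where "S = (\<Sum>\<gamma>\<in>\<Gamma>. (r \<gamma>)\<^sup>2)"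
  have S: "0 \<le> S" by (simp add: S_def sum_nonneg)
  have sum_eq: "(\<Sum>\<gamma>\<in>\<Gamma>. (a \<gamma>)\<^sup>2) = ennreal S"
    unfolding S_def by (subst sum_ennreal[symmetric]) (auto intro!: sum.cong simp: a r ennreal_power)
  have "(\<Sum>\<gamma>\<in>\<Gamma>. (a \<gamma>)\<^sup>2) = (\<Sum>\<gamma>\<in>\<Gamma>. a \<gamma> * ennreal (r \<gamma>))"
    by (intro sum.cong) (auto simp: a power2_eq_square)
  also have "\<dots> \<le> ennreal (C * sqrt S) * X"
    unfolding S_def by (rule le) (rule r)
  finally have "S \<le> C * sqrt S * x"
    unfolding sum_eq x using S C x by (simp add: ennreal_mult[symmetric])
  then have "sqrt S * sqrt S \<le> (C * x) * sqrt S" using S by (simp add: mult_ac)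
  then have "sqrt S \<le> C * x"
  proof (cases "S = 0")
    case False
    then have "0 < sqrt S" using S by simp
    then show ?thesis using \<open>sqrt S * sqrt S \<le> (C * x) * sqrt S\<close> by (rule mult_right_le_imp_le[rotated])
  qed (use C x in simp)
  then have "(sqrt S)\<^sup>2 \<le> (C * x)\<^sup>2" using S by (intro power_mono) auto
  then have "S \<le> C\<^sup>2 * x\<^sup>2" using S by (simp add: power_mult_distrib)
  then show ?thesis unfolding sum_eq x using x(2)
    by (simp add: ennreal_power ennreal_mult[symmetric] ennreal_leI)
qed

lemma nn_integral_int_le:
  fixes a :: "int \<Rightarrow> ennreal"
  assumes "\<And>\<Gamma>. finite \<Gamma> \<Longrightarrow> (\<Sum>\<gamma>\<in>\<Gamma>. a \<gamma>) \<le> B"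
  shows "(\<integral>\<^sup>+\<gamma>. a \<gamma> \<partial>count_space UNIV) \<le> B"
proof -
  have "(\<integral>\<^sup>+\<gamma>. a \<gamma> \<partial>count_space UNIV) = (\<integral>\<^sup>+\<gamma>. (SUP n. a \<gamma> * indicator {-int n..int n} \<gamma>) \<partial>count_space UNIV)"
  proof (intro nn_integral_cong antisym)
    fix \<gamma> :: int
    have "\<gamma> \<in> {-int (nat \<bar>\<gamma>\<bar>)..int (nat \<bar>\<gamma>\<bar>)}" by auto
    then show "a \<gamma> \<le> (SUP n. a \<gamma> * indicator {-int n..int n} \<gamma>)"
      by (intro SUP_upper2[of "nat \<bar>\<gamma>\<bar>"]) auto
  qed (auto intro!: SUP_least simp: indicator_def)
  also have "\<dots> = (SUP n. \<integral>\<^sup>+\<gamma>. a \<gamma> * indicator {-int n..int n} \<gamma> \<partial>count_space UNIV)"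
    by (intro nn_integral_monotone_convergence_SUP) (auto simp: incseq_def le_fun_def indicator_def)
  also have "\<dots> \<le> B"
  proof (rule SUP_least)
    fix n
    have "(\<integral>\<^sup>+\<gamma>. a \<gamma> * indicator {-int n..int n} \<gamma> \<partial>count_space UNIV) = (\<Sum>\<gamma>\<in>{-int n..int n}. a \<gamma>)"
      by (subst nn_integral_count_space'[of "{-int n..int n}"]) auto
    then show "(\<integral>\<^sup>+\<gamma>. a \<gamma> * indicator {-int n..int n} \<gamma> \<partial>count_space UNIV) \<le> B"
      using assms[of "{-int n..int n}"] by simp
  qed
  finally show ?thesis .
qed

text \<open>The eighth power of the norm is the squared l2 norm of the slab integrals. Duality is
  applied with X equal to the fourth power of the L2 norm of f, and its conclusion squares
  X.\<close>

lemma strichartz_uniform: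
  assumes \<phi>: "cutoff \<phi>" and b: "0 \<le> b" "\<And>x. \<bar>\<phi> x\<bar> \<le> b" and N: "1 \<le> N"
    and f: "f \<in> borel_measurable borel" and fin: "L2sq f < \<infinity>"
  shows "l8L4L4_pow8 (schrod \<phi> N f) \<le> ennreal ((290304 * fejer_mass ^ 4 * b ^ 8)\<^sup>2) * L2sq f ^ 4"
proof -
  define C where "C = 290304 * fejer_mass ^ 4 * b ^ 8"
  have C: "0 \<le> C" using b(1) by (simp add: C_def)
  note trunc = slab_sum_schrod_le[OF \<phi> b N truncation_measurable[OF f] truncation_integrable[OF f]]
  have slab: "L4_slab (schrod \<phi> N f) \<gamma> \<le> liminf (\<lambda>n. L4_slab (schrod \<phi> N (truncation n f)) \<gamma>)" for \<gamma>
    by (intro L4_slab_le_liminf schrod_le_liminf_truncation[OF \<phi> N f] trunc(1)[of "{}" "\<lambda>_. 0"]) auto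
  have dual: "(\<Sum>\<gamma>\<in>\<Gamma>. L4_slab (schrod \<phi> N f) \<gamma> * ennreal (c \<gamma>)) \<le> ennreal (C * sqrt (\<Sum>\<gamma>\<in>\<Gamma>. (c \<gamma>)\<^sup>2)) * (L2sq f)\<^sup>2"
    if \<Gamma>: "finite \<Gamma>" and c: "\<And>\<gamma>. 0 \<le> c \<gamma>" for \<Gamma> c
  proof -
    have "(\<Sum>\<gamma>\<in>\<Gamma>. L4_slab (schrod \<phi> N f) \<gamma> * ennreal (c \<gamma>))
      \<le> (\<Sum>\<gamma>\<in>\<Gamma>. liminf (\<lambda>n. L4_slab (schrod \<phi> N (truncation n f)) \<gamma>) * ennreal (c \<gamma>))"
      by (intro sum_mono mult_right_mono slab) simp
    also have "\<dots> \<le> ennreal (C * sqrt (\<Sum>\<gamma>\<in>\<Gamma>. (c \<gamma>)\<^sup>2)) * (L2sq f)\<^sup>2"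
    proof (rule sum_liminf_le[OF \<Gamma>])
      fix n
      have "(\<Sum>\<gamma>\<in>\<Gamma>. L4_slab (schrod \<phi> N (truncation n f)) \<gamma> * ennreal (c \<gamma>))
        \<le> ennreal (C * sqrt (\<Sum>\<gamma>\<in>\<Gamma>. (c \<gamma>)\<^sup>2)) * (L2sq (truncation n f))\<^sup>2"
        unfolding C_def by (rule trunc(2)[OF \<Gamma> c])
      also have "\<dots> \<le> ennreal (C * sqrt (\<Sum>\<gamma>\<in>\<Gamma>. (c \<gamma>)\<^sup>2)) * (L2sq f)\<^sup>2"
        by (intro mult_left_mono power_mono L2sq_truncation_le) auto
      finally show "(\<Sum>\<gamma>\<in>\<Gamma>. L4_slab (schrod \<phi> N (truncation n f)) \<gamma> * ennreal (c \<gamma>))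
        \<le> ennreal (C * sqrt (\<Sum>\<gamma>\<in>\<Gamma>. (c \<gamma>)\<^sup>2)) * (L2sq f)\<^sup>2" .
    qed
    finally show ?thesis .
  qed
  have "(\<integral>\<^sup>+\<gamma>. (L4_slab (schrod \<phi> N f) \<gamma>)\<^sup>2 \<partial>count_space UNIV) \<le> ennreal (C\<^sup>2) * ((L2sq f)\<^sup>2)\<^sup>2"
    using fin by (intro nn_integral_int_le l2_duality C dual) (auto simp: power2_eq_square ennreal_mult_less_top)
  then show ?thesis
    by (simp add: l8L4L4_pow8_def L4_slab_def C_def flip: power_mult)
qed

theorem theorem4p1:
  fixes \<phi> :: "real \<Rightarrow> real"
  assumes "cutoff \<phi>"
  shows "\<forall>\<epsilon>>0. \<exists>C::real. \<forall>N::real. \<forall>f :: real \<times> real \<Rightarrow> complex.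
           N \<ge> 1 \<and> f \<in> borel_measurable lborel \<and> L2sq f < \<infinity> \<longrightarrow>
           l8L4L4_pow8 (schrod \<phi> N f)
             \<le> ennreal ((C * N powr \<epsilon>) ^ 8) * L2sq f ^ 4"
proof (intro allI impI)
  fix \<epsilon> :: real assume \<epsilon>: "0 < \<epsilon>"
  obtain b where b: "0 \<le> b" "\<And>x. \<bar>\<phi> x\<bar> \<le> b" using cutoff_bounded[OF assms] by blast
  define D where "D = 290304 * fejer_mass ^ 4 * b ^ 8"
  \<comment> \<open>C does not depend on epsilon: the loss is used only through N powr epsilon >= 1.
    The maximum with 1 ensures C * N powr epsilon >= 1, so that the uniform constant D^2 fits below
    the eighth power in the claim.\<close>
  define C where "C = max 1 D"
  have D: "0 \<le> D" using b(1) by (simp add: D_def)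
  show "\<exists>C::real. \<forall>N::real. \<forall>f :: real \<times> real \<Rightarrow> complex.
           N \<ge> 1 \<and> f \<in> borel_measurable lborel \<and> L2sq f < \<infinity> \<longrightarrow>
           l8L4L4_pow8 (schrod \<phi> N f) \<le> ennreal ((C * N powr \<epsilon>) ^ 8) * L2sq f ^ 4"
  proof (intro exI[of _ C] allI impI)
    fix N :: real and f :: "real \<times> real \<Rightarrow> complex"
    assume "N \<ge> 1 \<and> f \<in> borel_measurable lborel \<and> L2sq f < \<infinity>"
    then have N: "1 \<le> N" and f: "f \<in> borel_measurable borel" and fin: "L2sq f < \<infinity>" by simp_all
    have C: "1 \<le> C * N powr \<epsilon>" "D \<le> C * N powr \<epsilon>"
    proof -
      have "1 \<le> N powr \<epsilon>" using N \<epsilon> by (simp add: ge_one_powr_ge_zero)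
      then have "C * 1 \<le> C * N powr \<epsilon>" by (intro mult_left_mono) (auto simp: C_def)
      then show "1 \<le> C * N powr \<epsilon>" "D \<le> C * N powr \<epsilon>" by (auto simp: C_def)
    qed
    have "D\<^sup>2 \<le> (C * N powr \<epsilon>)\<^sup>2" using C(2) D by (intro power_mono)
    also have "\<dots> \<le> (C * N powr \<epsilon>) ^ 8" using C(1) by (intro power_increasing) auto
    finally have "ennreal (D\<^sup>2) * L2sq f ^ 4 \<le> ennreal ((C * N powr \<epsilon>) ^ 8) * L2sq f ^ 4"
      by (intro mult_right_mono ennreal_leI) auto
    with strichartz_uniform[OF assms b N f fin]
    show "l8L4L4_pow8 (schrod \<phi> N f) \<le> ennreal ((C * N powr \<epsilon>) ^ 8) * L2sq f ^ 4"
      unfolding D_def by (rule order_trans)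
  qed
qed

end
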